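(* For any positive integer $t$, the hereditary property $\mathrm{Forb}(K_{t,t})$ has no accumulation points in the interval $(0,1]$.
   Context: All graphs are finite and simple; $K_{t,t}$ is the complete bipartite graph with both parts of size $t$. For a graph $H$, $\mathrm{Forb}(H)$ is the family of all graphs not containing $H$ as an induced subgraph; for a family $\mathcal F$ of graphs, $\mathrm{Forb}(\mathcal F)=\bigcap_{F\in\mathcal F}\mathrm{Forb}(F)$. A hereditary property is a family of graphs closed under isomorphism and vertex-deletion (each is of the form $\mathrm{Forb}(\mathcal F)$); it is non-trivial if it contains graphs of unbounded order (and then it contains graphs of every order). Edit distance function. For graphs $G,H$ on the same vertex set $V$, $\mathrm{dist}(G,H)=|E(G)\triangle E(H)|/\binom{|V|}{2}$. For a non-trivial hereditary property $\mathcal H$, $\mathrm{dist}(G,\mathcal H)=\min\{\mathrm{dist}(G,H):H\in\mathcal H,\ V(H)=V(G)\}$, and $$\mathrm{ed}_{\mathcal H}(p)=\limsup_{n\to\infty}\max\Bigl\{\mathrm{dist}(G,\mathcal H):|V(G)|=n,\ |E(G)|=\Bigl\lfloor p\tbinom n2\Bigr\rfloor\Bigr\},\qquad p\in[0,1].$$ CRGs. A colored regularity graph (CRG) $K$ is a finite non-empty clique together with a partition of its vertices into black and white, $V(K)=VB(K)\sqcup VW(K)$, and a partition of its edges into black, white and gray, $E(K)=EB(K)\sqcup EW(K)\sqcup EG(K)$. For a graph $F$, write $F\mapsto K$ if there is a function $\phi\colon V(F)\to V(K)$ such that: for every $uv\in E(F)$, either $\phi(u)=\phi(v)\in VB(K)$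 or $\phi(u)\phi(v)\in EB(K)\cup EG(K)$; and for every pair of distinct $u,v$ with $uv\notin E(F)$, either $\phi(u)=\phi(v)\in VW(K)$ or $\phi(u)\phi(v)\in EW(K)\cup EG(K)$. For a family $\mathcal F$, write $\mathcal F\mapsto K$ if $F\mapsto K$ for some $F\in\mathcal F$, and $\mathcal F\not\mapsto K$ otherwise. For $\mathcal H=\mathrm{Forb}(\mathcal F)$ non-trivial, $\mathcal K(\mathcal H)$ is the set of all CRGs $K$ with $\mathcal F\not\mapsto K$. For $p\in[0,1]$, $M_K(p)\in\mathbb R^{V(K)\times V(K)}$ is the matrix whose $(x,y)$ entry is $p$ if $x=y\in VW(K)$ or $xy\in EW(K)$; $1-p$ if $x=y\in VB(K)$ or $xy\in EB(K)$; and $0$ if $xy\in EG(K)$. Set $g_K(p)=\min\{\langle\mu,M_K(p)\mu\rangle:\mu\in\Delta^K\}$, where $\Delta^K$ is the set of all probability masses on $V(K)$. Accumulation points. Let $\mathcal H$ be a non-trivial hereditary property. A point $p_0\in[0,1]$ is a regular point of $\mathcal H$ if there are $\epsilon>0$ and a finite subset $\mathcal K'\subseteq\mathcal K(\mathcal H)$ such that $\mathrm{ed}_{\mathcal H}(p)=\min_{K\in\mathcal K'}g_K(p)$ for every $p\in(p_0-\epsilon,p_0+\epsilon)\cap[0,1]$. Otherwise $p_0$ is an accumulation point of $\mathcal H$. *)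

theory Defs
  imports "HOL-Analysis.Analysis"
begin

text \<open>
  Vertices are natural numbers: every finite graph and every finite CRG has an isomorphic copy
  there, so families of graphs become sets of a fixed type.
\<close>

record graph =
  verts :: "nat set"
  edges :: "nat set set"

definition all_pairs :: "nat set \<Rightarrow> nat set set" where
  "all_pairs V = {{u, v} | u v. u \<in> V \<and> v \<in> V \<and> u \<noteq> v}"

definition is_graph :: "graph \<Rightarrow> bool" where
  "is_graph G \<longleftrightarrow> finite (verts G) \<and> edges G \<subseteq> all_pairs (verts G)"

definition graph_iso :: "graph \<Rightarrow> graph \<Rightarrow> bool" where
  "graph_iso G H \<longleftrightarrow>
     (\<exists>f. bij_betw f (verts G) (verts H) \<and> edges H = (\<lambda>e. f ` e) ` edges G)"

definition induced :: "graph \<Rightarrow> nat set \<Rightarrow> graph" where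
  "induced G S = \<lparr>verts = S, edges = {e \<in> edges G. e \<subseteq> S}\<rparr>"

definition contains_induced :: "graph \<Rightarrow> graph \<Rightarrow> bool" where
  "contains_induced G H \<longleftrightarrow> (\<exists>S \<subseteq> verts G. graph_iso H (induced G S))"

definition complete_bipartite :: "nat \<Rightarrow> nat \<Rightarrow> graph" where
  "complete_bipartite s t =
     \<lparr>verts = {..<s + t}, edges = {{u, v} | u v. u < s \<and> s \<le> v \<and> v < s + t}\<rparr>"


subsection \<open>Hereditary properties\<close>

definition Forb :: "graph \<Rightarrow> graph set" where
  "Forb H = {G. is_graph G \<and> \<not> contains_induced G H}"

text \<open>The explicit restriction to graphs only matters for the empty family.\<close>

definition Forb_family :: "graph set \<Rightarrow> graph set" where
  "Forb_family \<F> = {G. is_graph G} \<inter> (\<Inter>F\<in>\<F>. Forb F)"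

definition hereditary :: "graph set \<Rightarrow> bool" where
  "hereditary \<H> \<longleftrightarrow>
     (\<forall>G\<in>\<H>. is_graph G) \<and>
     (\<forall>G\<in>\<H>. \<forall>H. is_graph H \<and> graph_iso G H \<longrightarrow> H \<in> \<H>) \<and>
     (\<forall>G\<in>\<H>. \<forall>v\<in>verts G. induced G (verts G - {v}) \<in> \<H>)"

definition nontrivial :: "graph set \<Rightarrow> bool" where
  "nontrivial \<H> \<longleftrightarrow> (\<forall>n. \<exists>G\<in>\<H>. n \<le> card (verts G))"


subsection \<open>The edit distance function\<close>

definition graph_dist :: "graph \<Rightarrow> graph \<Rightarrow> real" where
  "graph_dist G H =
     real (card ((edges G - edges H) \<union> (edges H - edges G))) / real (card (verts G) choose 2)"

text \<open>
  Both extrema below range over finite sets of values (there are finitely many graphs on a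
  given finite vertex set, and the distance depends only on the isomorphism type of the graph);
  these sets are nonempty for nontrivial hereditary properties and \<open>p \<in> {0..1}\<close>.
\<close>

definition dist_to :: "graph \<Rightarrow> graph set \<Rightarrow> real" where
  "dist_to G \<H> = Min {graph_dist G H | H. H \<in> \<H> \<and> verts H = verts G}"

definition max_dist :: "graph set \<Rightarrow> real \<Rightarrow> nat \<Rightarrow> real" where
  "max_dist \<H> p n =
     Max {dist_to G \<H> | G. is_graph G \<and> card (verts G) = n \<and>
            int (card (edges G)) = \<lfloor>p * real (n choose 2)\<rfloor>}"

text \<open>The upper limit is taken in the extended reals; it lies in the interval from 0 to 1.\<close>

definition ed :: "graph set \<Rightarrow> real \<Rightarrow> real" where
  "ed \<H> p = real_of_ereal (limsup (\<lambda>n. ereal (max_dist \<H> p n)))"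


subsection \<open>Colored regularity graphs\<close>

record crg =
  VB :: "nat set"
  VW :: "nat set"
  EB :: "nat set set"
  EW :: "nat set set"
  EG :: "nat set set"

definition crg_verts :: "crg \<Rightarrow> nat set" where
  "crg_verts K = VB K \<union> VW K"

definition is_crg :: "crg \<Rightarrow> bool" where
  "is_crg K \<longleftrightarrow>
     finite (crg_verts K) \<and> crg_verts K \<noteq> {} \<and> VB K \<inter> VW K = {} \<and>
     EB K \<union> EW K \<union> EG K = all_pairs (crg_verts K) \<and>
     EB K \<inter> EW K = {} \<and> EB K \<inter> EG K = {} \<and> EW K \<inter> EG K = {}"

definition maps_to :: "graph \<Rightarrow> crg \<Rightarrow> bool" where
  "maps_to F K \<longleftrightarrow>
     (\<exists>\<phi> \<in> verts F \<rightarrow> crg_verts K.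
        (\<forall>u\<in>verts F. \<forall>v\<in>verts F. {u, v} \<in> edges F \<longrightarrow>
           (\<phi> u = \<phi> v \<and> \<phi> u \<in> VB K) \<or> {\<phi> u, \<phi> v} \<in> EB K \<union> EG K) \<and>
        (\<forall>u\<in>verts F. \<forall>v\<in>verts F. u \<noteq> v \<and> {u, v} \<notin> edges F \<longrightarrow>
           (\<phi> u = \<phi> v \<and> \<phi> u \<in> VW K) \<or> {\<phi> u, \<phi> v} \<in> EW K \<union> EG K))"

definition family_maps_to :: "graph set \<Rightarrow> crg \<Rightarrow> bool" where
  "family_maps_to \<F> K \<longleftrightarrow> (\<exists>F\<in>\<F>. maps_to F K)"

text \<open>
  The existential quantifier picks some presentation of \<open>\<H>\<close> by a forbidden family; by
  \<open>crg_class_Forb_family\<close> below, the choice of the family is irrelevant.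
\<close>

definition crg_class :: "graph set \<Rightarrow> crg set" where
  "crg_class \<H> =
     {K. is_crg K \<and>
         (\<exists>\<F>. (\<forall>F\<in>\<F>. is_graph F) \<and> \<H> = Forb_family \<F> \<and> \<not> family_maps_to \<F> K)}"

definition crg_matrix :: "crg \<Rightarrow> real \<Rightarrow> nat \<Rightarrow> nat \<Rightarrow> real" where
  "crg_matrix K p x y =
     (if (x = y \<and> x \<in> VW K) \<or> {x, y} \<in> EW K then p
      else if (x = y \<and> x \<in> VB K) \<or> {x, y} \<in> EB K then 1 - p
      else 0)"

definition prob_masses :: "nat set \<Rightarrow> (nat \<Rightarrow> real) set" where
  "prob_masses V = {\<mu>. (\<forall>x. 0 \<le> \<mu> x) \<and> (\<forall>x. x \<notin> V \<longrightarrow> \<mu> x = 0) \<and> (\<Sum>x\<in>V. \<mu> x) = 1}"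

text \<open>
  The infimum is a minimum, since a quadratic form attains its infimum on the compact simplex.
\<close>

definition crg_g :: "crg \<Rightarrow> real \<Rightarrow> real" where
  "crg_g K p =
     (INF \<mu> \<in> prob_masses (crg_verts K).
        \<Sum>x\<in>crg_verts K. \<mu> x * (\<Sum>y\<in>crg_verts K. crg_matrix K p x y * \<mu> y))"


subsection \<open>Accumulation points\<close>

definition regular_point :: "graph set \<Rightarrow> real \<Rightarrow> bool" where
  "regular_point \<H> p0 \<longleftrightarrow>
     p0 \<in> {0..1} \<and>
     (\<exists>\<epsilon>>0. \<exists>\<K>. finite \<K> \<and> \<K> \<noteq> {} \<and> \<K> \<subseteq> crg_class \<H> \<and>
        (\<forall>p \<in> {p0 - \<epsilon><..<p0 + \<epsilon>} \<inter> {0..1}. ed \<H> p = (MIN K\<in>\<K>. crg_g K p)))"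

definition accumulation_point :: "graph set \<Rightarrow> real \<Rightarrow> bool" where
  "accumulation_point \<H> p0 \<longleftrightarrow> p0 \<in> {0..1} \<and> \<not> regular_point \<H> p0"


subsection \<open>Sanity checks\<close>

lemma graph_iso_refl: "graph_iso G G"
  unfolding graph_iso_def by (rule exI[of _ id]) simp

lemma contains_induced_refl:
  assumes "is_graph G"
  shows "contains_induced G G"
proof -
  have "induced G (verts G) = G"
    using assms by (cases G) (auto simp: induced_def is_graph_def all_pairs_def)
  then show ?thesis
    unfolding contains_induced_def using graph_iso_refl[of G] by (intro exI[of _ "verts G"]) auto
qed

lemma maps_to_contained:
  assumes ci: "contains_induced G H" and H: "is_graph H" and m: "maps_to G K"
  shows "maps_to H K"
proof -
  obtain S f where S: "S \<subseteq> verts G" and f: "bij_betw f (verts H) S"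
    and e: "{e \<in> edges G. e \<subseteq> S} = (\<lambda>e. f ` e) ` edges H"
    using ci unfolding contains_induced_def graph_iso_def induced_def by auto
  have inj: "inj_on f (verts H)" and im: "f ` verts H = S"
    using f by (auto simp: bij_betw_def)
  have sub: "a \<subseteq> verts H" if "a \<in> edges H" for a
    using that H by (auto simp: is_graph_def all_pairs_def)
  have eq: "{u, v} \<in> edges H \<longleftrightarrow> {f u, f v} \<in> edges G" if uv: "u \<in> verts H" "v \<in> verts H" for u v
  proof
    assume "{u, v} \<in> edges H"
    then have "f ` {u, v} \<in> {e \<in> edges G. e \<subseteq> S}" unfolding e by (rule imageI)
    then show "{f u, f v} \<in> edges G" by simp
  next
    assume "{f u, f v} \<in> edges G"
    then have "f ` {u, v} \<in> {e \<in> edges G. e \<subseteq> S}" using uv im by auto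
    then obtain a where a: "a \<in> edges H" "f ` {u, v} = f ` a" unfolding e by auto
    have "{u, v} = a"
      using inj_on_image_eq_iff[OF inj, of "{u, v}" a] a sub uv by auto
    then show "{u, v} \<in> edges H" using a by simp
  qed
  obtain \<phi> where p: "\<phi> \<in> verts G \<rightarrow> crg_verts K"
    and p1: "\<And>u v. u \<in> verts G \<Longrightarrow> v \<in> verts G \<Longrightarrow> {u, v} \<in> edges G \<Longrightarrow>
           (\<phi> u = \<phi> v \<and> \<phi> u \<in> VB K) \<or> {\<phi> u, \<phi> v} \<in> EB K \<union> EG K"
    and p2: "\<And>u v. u \<in> verts G \<Longrightarrow> v \<in> verts G \<Longrightarrow> u \<noteq> v \<Longrightarrow> {u, v} \<notin> edges G \<Longrightarrow>
           (\<phi> u = \<phi> v \<and> \<phi> u \<in> VW K) \<or> {\<phi> u, \<phi> v} \<in> EW K \<union> EG K"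
    using m unfolding maps_to_def by blast
  have fG: "f u \<in> verts G" if "u \<in> verts H" for u using that im S by auto
  show ?thesis
    unfolding maps_to_def
  proof (intro bexI[of _ "\<phi> \<circ> f"] conjI ballI impI)
    show "\<phi> \<circ> f \<in> verts H \<rightarrow> crg_verts K" using p fG by auto
  next
    fix u v assume "u \<in> verts H" "v \<in> verts H" "{u, v} \<in> edges H"
    then show "(\<phi> \<circ> f) u = (\<phi> \<circ> f) v \<and> (\<phi> \<circ> f) u \<in> VB K \<or>
          {(\<phi> \<circ> f) u, (\<phi> \<circ> f) v} \<in> EB K \<union> EG K"
      using p1[of "f u" "f v"] fG eq by simp
  next
    fix u v assume *: "u \<in> verts H" "v \<in> verts H" "u \<noteq> v \<and> {u, v} \<notin> edges H"
    then have "f u \<noteq> f v" using inj by (auto dest: inj_onD)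
    with * show "(\<phi> \<circ> f) u = (\<phi> \<circ> f) v \<and> (\<phi> \<circ> f) u \<in> VW K \<or>
          {(\<phi> \<circ> f) u, (\<phi> \<circ> f) v} \<in> EW K \<union> EG K"
      using p2[of "f u" "f v"] fG eq by simp
  qed
qed

lemma crg_class_Forb_family:
  assumes "\<And>F. F \<in> \<F> \<Longrightarrow> is_graph F"
  shows "crg_class (Forb_family \<F>) = {K. is_crg K \<and> \<not> family_maps_to \<F> K}"
proof -
  have "\<not> family_maps_to \<F> K"
    if g: "\<forall>F\<in>\<F>'. is_graph F" and eq: "Forb_family \<F> = Forb_family \<F>'"
      and n: "\<not> family_maps_to \<F>' K" for \<F>' K
  proof
    assume "family_maps_to \<F> K"
    then obtain F where F: "F \<in> \<F>" "maps_to F K" unfolding family_maps_to_def by auto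
    then have "F \<notin> Forb_family \<F>"
      using contains_induced_refl[of F] assms[of F] by (auto simp: Forb_family_def Forb_def)
    then obtain F' where "F' \<in> \<F>'" "contains_induced F F'"
      using assms[of F] F eq by (auto simp: Forb_family_def Forb_def)
    then show False
      using maps_to_contained[of F F' K] F g n by (auto simp: family_maps_to_def)
  qed
  then show ?thesis using assms unfolding crg_class_def by blast
qed

lemma Forb_family_singleton: "Forb_family {H} = Forb H"
  by (auto simp: Forb_family_def Forb_def)

lemma is_graph_complete_bipartite: "is_graph (complete_bipartite s t)"
proof -
  have "{u, v} \<in> all_pairs {..<s + t}" if "u < s" "s \<le> v" "v < s + t" for u v
    unfolding all_pairs_def mem_Collect_eq
    by (rule exI[of _ u], rule exI[of _ v]) (use that in simp)
  then show ?thesis by (auto simp: is_graph_def complete_bipartite_def)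
qed

lemma hereditary_Forb: "hereditary (Forb H)"
proof -
  have iso: "G' \<in> Forb H" if G: "G \<in> Forb H" and G': "is_graph G'" and i: "graph_iso G G'" for G G'
  proof (rule ccontr)
    assume "G' \<notin> Forb H"
    then obtain S g where S: "S \<subseteq> verts G'" and g: "bij_betw g (verts H) S"
      and eg: "{e \<in> edges G'. e \<subseteq> S} = (\<lambda>e. g ` e) ` edges H"
      using G' by (auto simp: Forb_def contains_induced_def graph_iso_def induced_def)
    obtain f where f: "bij_betw f (verts G) (verts G')" and ef: "edges G' = (\<lambda>e. f ` e) ` edges G"
      using i unfolding graph_iso_def by auto
    define h where "h = inv_into (verts G) f"
    have h: "bij_betw h (verts G') (verts G)" unfolding h_def by (rule bij_betw_inv_into[OF f])
    have hf: "h (f x) = x" if "x \<in> verts G" for x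
      using f that unfolding h_def by (auto simp: bij_betw_def)
    have fh: "f (h x) = x" if "x \<in> verts G'" for x
      using f that unfolding h_def by (auto simp: bij_betw_def f_inv_into_f)
    have sub: "a \<subseteq> verts G" if "a \<in> edges G" for a
      using that G by (auto simp: Forb_def is_graph_def all_pairs_def)
    have hfi: "h ` f ` a = a" if "a \<subseteq> verts G" for a
    proof -
      have "(\<lambda>x. h (f x)) ` a = (\<lambda>x. x) ` a" by (rule image_cong) (use that hf in auto)
      then show ?thesis by (simp add: image_image)
    qed
    have fhi: "f ` h ` a = a" if "a \<subseteq> verts G'" for a
    proof -
      have "(\<lambda>x. f (h x)) ` a = (\<lambda>x. x) ` a" by (rule image_cong) (use that fh in auto)
      then show ?thesis by (simp add: image_image)
    qed
    have "{e \<in> edges G. e \<subseteq> h ` S} = (\<lambda>e. h ` e) ` {e \<in> edges G'. e \<subseteq> S}"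
    proof (intro equalityI subsetI)
      fix e assume e: "e \<in> {e \<in> edges G. e \<subseteq> h ` S}"
      then have "f ` e \<subseteq> S" using fhi[OF S] by blast
      moreover have "f ` e \<in> edges G'" using e ef by auto
      ultimately show "e \<in> (\<lambda>e. h ` e) ` {e \<in> edges G'. e \<subseteq> S}"
        using e hfi sub by (intro image_eqI[of _ _ "f ` e"]) auto
    next
      fix e assume "e \<in> (\<lambda>e. h ` e) ` {e \<in> edges G'. e \<subseteq> S}"
      then obtain a where a: "a \<in> edges G" "f ` a \<subseteq> S" "e = h ` f ` a" using ef by auto
      then show "e \<in> {e \<in> edges G. e \<subseteq> h ` S}"
        using hfi[OF sub[OF a(1)]] image_mono[OF a(2), of h] by simp
    qed
    then have "{e \<in> edges G. e \<subseteq> h ` S} = (\<lambda>e. (h \<circ> g) ` e) ` edges H"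
      unfolding eg by (simp add: image_image)
    moreover have "bij_betw (h \<circ> g) (verts H) (h ` S)"
      using g h S by (meson bij_betw_subset bij_betw_trans)
    moreover have "h ` S \<subseteq> verts G" using h S by (auto simp: bij_betw_def)
    ultimately have "graph_iso H (induced G (h ` S))" "h ` S \<subseteq> verts G"
      unfolding graph_iso_def induced_def graph.simps by blast+
    then have "contains_induced G H" unfolding contains_induced_def by blast
    then show False using G by (simp add: Forb_def)
  qed
  have del: "induced G (verts G - {v}) \<in> Forb H" if G: "G \<in> Forb H" for G v
  proof -
    have "is_graph (induced G (verts G - {v}))"
      using G unfolding Forb_def is_graph_def induced_def all_pairs_def by auto blast
    moreover have "\<not> contains_induced (induced G (verts G - {v})) H"
    proof
      assume "contains_induced (induced G (verts G - {v})) H"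
      then obtain S where S: "S \<subseteq> verts G - {v}"
        and i: "graph_iso H (induced (induced G (verts G - {v})) S)"
        unfolding contains_induced_def by (auto simp: induced_def)
      have "induced (induced G (verts G - {v})) S = induced G S"
        using S by (auto simp: induced_def)
      then have "contains_induced G H" using S i unfolding contains_induced_def by auto
      then show False using G by (simp add: Forb_def)
    qed
    ultimately show ?thesis by (simp add: Forb_def)
  qed
  show ?thesis unfolding hereditary_def using iso del by (auto simp: Forb_def)
qed

lemma nontrivial_Forb_complete_bipartite:
  assumes "t \<ge> 1"
  shows "nontrivial (Forb (complete_bipartite t t))"
  unfolding nontrivial_def
proof
  fix n
  define G where "G = \<lparr>verts = {..<n}, edges = {}\<rparr>"
  have "{0, t} \<in> edges (complete_bipartite t t)"
    unfolding complete_bipartite_def graph.simps mem_Collect_eq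
    by (rule exI[of _ 0], rule exI[of _ t]) (use assms in simp)
  then have "\<not> contains_induced G (complete_bipartite t t)"
    by (auto simp: contains_induced_def graph_iso_def induced_def G_def)
  then have "G \<in> Forb (complete_bipartite t t)"
    by (auto simp: Forb_def is_graph_def G_def)
  then show "\<exists>G\<in>Forb (complete_bipartite t t). n \<le> card (verts G)"
    by (rule bexI[rotated]) (simp add: G_def)
qed

end

theory Submission
  imports Defs "HOL-Library.Ramsey" "HOL-Computational_Algebra.Primes"
begin

text \<open>
  The theorem follows from a uniform statement, \<open>finitely_many_crgs_suffice\<close>: for every \<open>\<delta> > 0\<close>
  a finite set \<open>\<K>\<close> of CRGs satisfies \<open>ed p = (MIN K\<in>\<K>. g\<^sub>K p)\<close> for all \<open>p \<in> [\<delta>, 1]\<close>. With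
  \<open>\<delta> = p0 / 2\<close> this makes every \<open>p0 > 0\<close> regular. Three facts give the uniform statement.

  \<^emph>\<open>CRGs bound the edit distance from above\<close> (\<open>ed_le_crg_g\<close>). Given a graph \<open>G\<close>, a CRG \<open>K\<close> of
  the class and a mass \<open>\<mu>\<close> on \<open>K\<close>, send the vertices of \<open>G\<close> to \<open>K\<close> independently with law \<open>\<mu>\<close>
  and edit each pair as its colour demands. The expected proportion of edits is the quadratic
  form of \<open>K\<close> at \<open>\<mu>\<close>, and the edited graph maps to \<open>K\<close>, so it has no forbidden subgraph.

  \<^emph>\<open>They also bound it from below\<close>, up to an arbitrary \<open>\<gamma> > 0\<close> (\<open>crg_below_max_dist\<close>, for every
  forbidden graph \<open>F\<close>). Let \<open>G\<close> be a quasirandom graph of density \<open>p\<close> and \<open>H\<close> a nearest graph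
  with the property. Weak regularity replaces \<open>H\<close> by a step function that is close in cut norm;
  cutting its values off near 0 and 1 colours the pairs of vertices white, black and gray. Up to
  a small error, this template costs at most as much as the edits between \<open>G\<close> and \<open>H\<close>, because
  \<open>G\<close> has density \<open>p\<close> between any two large sets. As \<open>H\<close> has no induced \<open>F\<close>, the counting lemma
  leaves the template few copies of \<open>F\<close>, and a random sample of bounded size has none and is
  still cheap. In this sample the box theorem finds a blow-up of a cheap pattern, and Ramsey's
  theorem makes each blown-up vertex white or black. The pattern is then a CRG that \<open>F\<close> does not
  map to. Weak regularity is enough for this route; the strong regularity lemma that usually
  proves this bound is replaced by the box theorem.

  \<^emph>\<open>For \<open>K\<^bsub>t,t\<^esub>\<close> and \<open>p \<ge> \<delta>\<close>, boundedly many vertices are enough\<close> (\<open>bounded_colouring\<close>). Take a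
  CRG with as few vertices as possible whose value is at most a given one. Its optimal mass is
  positive everywhere, and moving all mass of some vertices to another one strictly increases
  the quadratic form. Hence two black vertices are never joined by a black edge, and there is at
  most one white vertex. If \<open>p \<ge> 1/2\<close>, the black vertices are joined by gray edges only; if
  \<open>p < 1/2\<close>, a white vertex has only gray edges. In both cases \<open>t\<close> black vertices would receive
  a map from \<open>K\<^bsub>t,t\<^esub>\<close>. What remains, \<open>p < 1/2\<close> and all vertices black, is \<open>few_black_vertices\<close>.
  There every vertex has gray neighbours of total mass at least \<open>1 - g/p\<close>. Among very many
  vertices, many light ones share a set \<open>S\<close> of heavy gray neighbours; since no gray \<open>K\<^bsub>t,t\<^esub>\<close>
  exists, \<open>S\<close> has fewer than \<open>t\<close> elements and yet carries almost all of that mass. But \<open>g\<close> is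
  below the value \<open>1 / (1/p + (t-1)/(1-p))\<close> of the all-gray CRG with one white and \<open>t-1\<close> black
  vertices, so the mass of \<open>S\<close> is too small unless \<open>S\<close> is a gray clique of size \<open>t-1\<close>; a light
  vertex then extends it to one of size \<open>t\<close>, which \<open>K\<^bsub>t,t\<^esub>\<close> maps to along a perfect matching.
\<close>

section \<open>Colourings and CRGs\<close>

text \<open>
  A CRG is handled as one symmetric colouring of all pairs of its vertices, where the diagonal
  carries the vertex colours. Black and white on the diagonal then constrain edges and non-edges
  exactly as they do off the diagonal, and the entries of the matrix depend on the colour alone.
\<close>

datatype colour = White | Black | Gray

definition fits :: "colour \<Rightarrow> bool \<Rightarrow> bool" where
  "fits c adj \<longleftrightarrow> (if adj then c \<noteq> White else c \<noteq> Black)"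

definition cost :: "real \<Rightarrow> colour \<Rightarrow> real" where
  "cost p c = (case c of White \<Rightarrow> p | Black \<Rightarrow> 1 - p | Gray \<Rightarrow> 0)"

definition kcol :: "crg \<Rightarrow> nat \<Rightarrow> nat \<Rightarrow> colour" where
  "kcol K x y =
     (if (x = y \<and> x \<in> VW K) \<or> {x, y} \<in> EW K then White
      else if (x = y \<and> x \<in> VB K) \<or> {x, y} \<in> EB K then Black
      else Gray)"

definition crg_of :: "nat set \<Rightarrow> (nat \<Rightarrow> nat \<Rightarrow> colour) \<Rightarrow> crg" where
  "crg_of I c =
     \<lparr>VB = {x \<in> I. c x x = Black}, VW = {x \<in> I. c x x = White},
      EB = {{x, y} | x y. x \<in> I \<and> y \<in> I \<and> x \<noteq> y \<and> c x y = Black},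
      EW = {{x, y} | x y. x \<in> I \<and> y \<in> I \<and> x \<noteq> y \<and> c x y = White},
      EG = {{x, y} | x y. x \<in> I \<and> y \<in> I \<and> x \<noteq> y \<and> c x y = Gray}\<rparr>"

definition is_colouring :: "nat set \<Rightarrow> (nat \<Rightarrow> nat \<Rightarrow> colour) \<Rightarrow> bool" where
  "is_colouring I c \<longleftrightarrow>
     finite I \<and> I \<noteq> {} \<and> (\<forall>x\<in>I. \<forall>y\<in>I. c x y = c y x) \<and> (\<forall>x\<in>I. c x x \<noteq> Gray)"

definition embeds :: "graph \<Rightarrow> nat set \<Rightarrow> (nat \<Rightarrow> nat \<Rightarrow> colour) \<Rightarrow> bool" where
  "embeds F I c \<longleftrightarrow>
     (\<exists>\<phi>. (\<forall>u\<in>verts F. \<phi> u \<in> I) \<and>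
        (\<forall>u\<in>verts F. \<forall>v\<in>verts F. u \<noteq> v \<longrightarrow> fits (c (\<phi> u) (\<phi> v)) ({u, v} \<in> edges F)))"

definition qform :: "(nat \<Rightarrow> nat \<Rightarrow> colour) \<Rightarrow> real \<Rightarrow> nat set \<Rightarrow> (nat \<Rightarrow> real) \<Rightarrow> real" where
  "qform c p I \<mu> = (\<Sum>x\<in>I. \<mu> x * (\<Sum>y\<in>I. cost p (c x y) * \<mu> y))"

lemma cost_simps [simp]: "cost p White = p" "cost p Black = 1 - p" "cost p Gray = 0"
  by (simp_all add: cost_def)

lemma cost_bounds:
  assumes "p \<in> {0..1}"
  shows "0 \<le> cost p c" "cost p c \<le> 1"
  using assms by (cases c; simp)+

lemma crg_matrix_kcol: "crg_matrix K p x y = cost p (kcol K x y)"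
  unfolding crg_matrix_def kcol_def by (simp only: if_distrib[of "cost p"] cost_simps)

lemma crg_g_qform: "crg_g K p = (INF \<mu> \<in> prob_masses (crg_verts K). qform (kcol K) p (crg_verts K) \<mu>)"
  by (simp add: crg_g_def qform_def crg_matrix_kcol)

lemma all_pairs_neq: "{x, y} \<in> all_pairs V \<longleftrightarrow> x \<in> V \<and> y \<in> V \<and> x \<noteq> y"
  by (auto simp: all_pairs_def doubleton_eq_iff)

lemma crg_edges:
  assumes "is_crg K"
  shows "{x, y} \<in> EB K \<union> EW K \<union> EG K \<longleftrightarrow> x \<in> crg_verts K \<and> y \<in> crg_verts K \<and> x \<noteq> y"
proof -
  have "EB K \<union> EW K \<union> EG K = all_pairs (crg_verts K)" using assms by (simp add: is_crg_def)
  then show ?thesis by (simp only: all_pairs_neq)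
qed

lemma kcol_distinct:
  assumes K: "is_crg K" and xy: "x \<in> crg_verts K" "y \<in> crg_verts K" "x \<noteq> y"
  shows "kcol K x y = White \<longleftrightarrow> {x, y} \<in> EW K"
    "kcol K x y = Black \<longleftrightarrow> {x, y} \<in> EB K"
    "kcol K x y = Gray \<longleftrightarrow> {x, y} \<in> EG K"
proof -
  have "{x, y} \<in> EB K \<union> EW K \<union> EG K" using crg_edges[OF K] xy by blast
  moreover have "EB K \<inter> EW K = {}" "EB K \<inter> EG K = {}" "EW K \<inter> EG K = {}"
    using K by (auto simp: is_crg_def)
  ultimately show "kcol K x y = White \<longleftrightarrow> {x, y} \<in> EW K"
    "kcol K x y = Black \<longleftrightarrow> {x, y} \<in> EB K"
    "kcol K x y = Gray \<longleftrightarrow> {x, y} \<in> EG K"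
    using xy(3) unfolding kcol_def by auto
qed

lemma kcol_diag:
  assumes K: "is_crg K" and x: "x \<in> crg_verts K"
  shows "kcol K x x = White \<longleftrightarrow> x \<in> VW K" "kcol K x x = Black \<longleftrightarrow> x \<in> VB K"
proof -
  have n: "{x, x} \<notin> EW K" "{x, x} \<notin> EB K" using crg_edges[OF K, of x x] by auto
  have d: "VB K \<inter> VW K = {}" "x \<in> VB K \<union> VW K" using K x by (auto simp: is_crg_def crg_verts_def)
  show "kcol K x x = White \<longleftrightarrow> x \<in> VW K" "kcol K x x = Black \<longleftrightarrow> x \<in> VB K"
    using n d unfolding kcol_def by auto
qed

lemma is_colouring_kcol:
  assumes "is_crg K"
  shows "is_colouring (crg_verts K) (kcol K)"
proof -
  have "kcol K x x \<noteq> Gray" if "x \<in> crg_verts K" for x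
    using that unfolding kcol_def crg_verts_def by auto
  moreover have "kcol K x y = kcol K y x" for x y
    unfolding kcol_def by (auto simp: insert_commute)
  ultimately show ?thesis using assms by (auto simp: is_colouring_def is_crg_def)
qed

lemma maps_to_iff_embeds:
  assumes K: "is_crg K" and F: "is_graph F"
  shows "maps_to F K \<longleftrightarrow> embeds F (crg_verts K) (kcol K)"
proof -
  have loop: "u \<noteq> v" if "{u, v} \<in> edges F" for u v
  proof -
    have "{u, v} \<in> all_pairs (verts F)" using that F by (auto simp: is_graph_def)
    then show ?thesis by (simp add: all_pairs_neq)
  qed
  have adj: "((a = b \<and> a \<in> VB K) \<or> {a, b} \<in> EB K \<union> EG K) \<longleftrightarrow> fits (kcol K a b) True"
    if "a \<in> crg_verts K" "b \<in> crg_verts K" for a b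
  proof (cases "a = b")
    case True
    have "kcol K a a \<noteq> Gray" using is_colouring_kcol[OF K] that by (auto simp: is_colouring_def)
    then have "fits (kcol K a a) True \<longleftrightarrow> kcol K a a = Black"
      by (cases "kcol K a a") (auto simp: fits_def)
    moreover have "{a, a} \<notin> EB K \<union> EG K" using crg_edges[OF K, of a a] by auto
    ultimately show ?thesis using True kcol_diag[OF K that(1)] by simp
  next
    case False
    have "fits (kcol K a b) True \<longleftrightarrow> kcol K a b = Black \<or> kcol K a b = Gray"
      by (cases "kcol K a b") (auto simp: fits_def)
    then show ?thesis using False kcol_distinct[OF K that False] by simp
  qed
  have nadj: "((a = b \<and> a \<in> VW K) \<or> {a, b} \<in> EW K \<union> EG K) \<longleftrightarrow> fits (kcol K a b) False"
    if "a \<in> crg_verts K" "b \<in> crg_verts K" for a b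
  proof (cases "a = b")
    case True
    have "kcol K a a \<noteq> Gray" using is_colouring_kcol[OF K] that by (auto simp: is_colouring_def)
    then have "fits (kcol K a a) False \<longleftrightarrow> kcol K a a = White"
      by (cases "kcol K a a") (auto simp: fits_def)
    moreover have "{a, a} \<notin> EW K \<union> EG K" using crg_edges[OF K, of a a] by auto
    ultimately show ?thesis using True kcol_diag[OF K that(1)] by simp
  next
    case False
    have "fits (kcol K a b) False \<longleftrightarrow> kcol K a b = White \<or> kcol K a b = Gray"
      by (cases "kcol K a b") (auto simp: fits_def)
    then show ?thesis using False kcol_distinct[OF K that False] by simp
  qed
  show ?thesis
  proof
    assume "maps_to F K"
    then obtain \<phi> where m: "\<phi> \<in> verts F \<rightarrow> crg_verts K"
      and e: "\<And>u v. u \<in> verts F \<Longrightarrow> v \<in> verts F \<Longrightarrow> {u, v} \<in> edges F \<Longrightarrow>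
           (\<phi> u = \<phi> v \<and> \<phi> u \<in> VB K) \<or> {\<phi> u, \<phi> v} \<in> EB K \<union> EG K"
      and n: "\<And>u v. u \<in> verts F \<Longrightarrow> v \<in> verts F \<Longrightarrow> u \<noteq> v \<Longrightarrow> {u, v} \<notin> edges F \<Longrightarrow>
           (\<phi> u = \<phi> v \<and> \<phi> u \<in> VW K) \<or> {\<phi> u, \<phi> v} \<in> EW K \<union> EG K"
      unfolding maps_to_def by blast
    have m': "\<phi> u \<in> crg_verts K" if "u \<in> verts F" for u using m that by auto
    have "fits (kcol K (\<phi> u) (\<phi> v)) ({u, v} \<in> edges F)"
      if uv: "u \<in> verts F" "v \<in> verts F" "u \<noteq> v" for u v
    proof (cases "{u, v} \<in> edges F")
      case True
      then show ?thesis using adj[OF m'[OF uv(1)] m'[OF uv(2)]] e[OF uv(1,2)] by auto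
    next
      case False
      then show ?thesis using nadj[OF m'[OF uv(1)] m'[OF uv(2)]] n[OF uv] by auto
    qed
    then show "embeds F (crg_verts K) (kcol K)"
      unfolding embeds_def using m' by blast
  next
    assume "embeds F (crg_verts K) (kcol K)"
    then obtain \<phi> where m: "\<And>u. u \<in> verts F \<Longrightarrow> \<phi> u \<in> crg_verts K"
      and f: "\<And>u v. u \<in> verts F \<Longrightarrow> v \<in> verts F \<Longrightarrow> u \<noteq> v \<Longrightarrow>
        fits (kcol K (\<phi> u) (\<phi> v)) ({u, v} \<in> edges F)"
      unfolding embeds_def by blast
    show "maps_to F K"
      unfolding maps_to_def
    proof (intro bexI[of _ \<phi>] conjI ballI impI)
      fix u v assume uv: "u \<in> verts F" "v \<in> verts F" and "{u, v} \<in> edges F"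
      then show "(\<phi> u = \<phi> v \<and> \<phi> u \<in> VB K) \<or> {\<phi> u, \<phi> v} \<in> EB K \<union> EG K"
        using adj[OF m m, OF uv] f[OF uv loop] by simp
    next
      fix u v assume uv: "u \<in> verts F" "v \<in> verts F" and "u \<noteq> v \<and> {u, v} \<notin> edges F"
      then show "(\<phi> u = \<phi> v \<and> \<phi> u \<in> VW K) \<or> {\<phi> u, \<phi> v} \<in> EW K \<union> EG K"
        using nadj[OF m m, OF uv] f[OF uv] by simp
    qed (use m in auto)
  qed
qed

lemma crg_class_Forb:
  assumes "is_graph F"
  shows "K \<in> crg_class (Forb F) \<longleftrightarrow> is_crg K \<and> \<not> embeds F (crg_verts K) (kcol K)"
  using crg_class_Forb_family[of "{F}"] maps_to_iff_embeds[of K F] assms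
  by (auto simp: Forb_family_singleton family_maps_to_def)

lemma crg_of_colouring:
  assumes c: "is_colouring I c"
  shows "is_crg (crg_of I c)" "crg_verts (crg_of I c) = I"
    "x \<in> I \<Longrightarrow> y \<in> I \<Longrightarrow> kcol (crg_of I c) x y = c x y"
proof -
  have sym: "\<And>x y. x \<in> I \<Longrightarrow> y \<in> I \<Longrightarrow> c x y = c y x"
    and dg: "\<And>x. x \<in> I \<Longrightarrow> c x x \<noteq> Gray" and fin: "finite I" "I \<noteq> {}"
    using c unfolding is_colouring_def by auto
  have two: "c x x = Black \<or> c x x = White" if "x \<in> I" for x using dg[OF that] by (cases "c x x") auto
  show v: "crg_verts (crg_of I c) = I"
    using two unfolding crg_verts_def crg_of_def by auto
  have E: "{x, y} \<in> {{x, y} | x y. x \<in> I \<and> y \<in> I \<and> x \<noteq> y \<and> c x y = C} \<longleftrightarrow>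
      x \<in> I \<and> y \<in> I \<and> x \<noteq> y \<and> c x y = C" for x y C
    using sym by (auto simp: doubleton_eq_iff)
  have disj: "{{x, y} | x y. x \<in> I \<and> y \<in> I \<and> x \<noteq> y \<and> c x y = C} \<inter>
     {{x, y} | x y. x \<in> I \<and> y \<in> I \<and> x \<noteq> y \<and> c x y = D} = {}" if "C \<noteq> D" for C D
  proof -
    { fix e assume "e \<in> {{x, y} | x y. x \<in> I \<and> y \<in> I \<and> x \<noteq> y \<and> c x y = C}"
        "e \<in> {{x, y} | x y. x \<in> I \<and> y \<in> I \<and> x \<noteq> y \<and> c x y = D}"
      moreover from this(1) obtain x y where "e = {x, y}" by blast
      ultimately have False using E[of x y C] E[of x y D] that by simp }
    then show ?thesis by blast
  qed
  have un: "{{x, y} | x y. x \<in> I \<and> y \<in> I \<and> x \<noteq> y \<and> c x y = Black} \<union>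
     {{x, y} | x y. x \<in> I \<and> y \<in> I \<and> x \<noteq> y \<and> c x y = White} \<union>
     {{x, y} | x y. x \<in> I \<and> y \<in> I \<and> x \<noteq> y \<and> c x y = Gray} = all_pairs I" (is "?L = ?R")
  proof (intro equalityI subsetI)
    fix e assume "e \<in> ?R"
    then obtain x y where e: "e = {x, y}" "x \<in> I" "y \<in> I" "x \<noteq> y" by (auto simp: all_pairs_def)
    then show "e \<in> ?L" by (cases "c x y") blast+
  qed (auto simp: all_pairs_def)
  show "is_crg (crg_of I c)"
    unfolding is_crg_def v using fin un disj[of Black White] disj[of Black Gray] disj[of White Gray]
    by (simp add: crg_of_def) auto
  show "kcol (crg_of I c) x y = c x y" if "x \<in> I" "y \<in> I"
  proof (cases "x = y")
    case True
    then show ?thesis using that two[OF that(1)] E[of x x] by (simp add: kcol_def crg_of_def) auto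
  next
    case False
    then show ?thesis using that E[of x y] by (cases "c x y") (simp_all add: kcol_def crg_of_def)
  qed
qed

lemma embeds_cong:
  assumes "\<And>x y. x \<in> I \<Longrightarrow> y \<in> I \<Longrightarrow> c x y = d x y"
  shows "embeds F I c \<longleftrightarrow> embeds F I d"
  unfolding embeds_def using assms by (intro ex_cong1 conj_cong refl) auto

lemma qform_cong:
  assumes "\<And>x y. x \<in> I \<Longrightarrow> y \<in> I \<Longrightarrow> c x y = d x y"
  shows "qform c p I \<mu> = qform d p I \<mu>"
  unfolding qform_def using assms by (intro sum.cong refl arg_cong2[where f="(*)"]) auto

lemma crg_of_class:
  assumes c: "is_colouring I c" and F: "is_graph F" and n: "\<not> embeds F I c"
  shows "crg_of I c \<in> crg_class (Forb F)"
  using crg_of_colouring[OF c] n embeds_cong[of I "kcol (crg_of I c)" c F]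
  by (simp add: crg_class_Forb[OF F])

text \<open>
  The induced subgraph inherits the map; this is \<open>maps_to_contained\<close> for the CRG with the given
  colouring.
\<close>

lemma embeds_contained:
  assumes "contains_induced G F" and F: "is_graph F" and G: "is_graph G"
    and c: "is_colouring I c" and e: "embeds G I c"
  shows "embeds F I c"
proof -
  have iff: "embeds H I c \<longleftrightarrow> maps_to H (crg_of I c)" if "is_graph H" for H
    using maps_to_iff_embeds[OF crg_of_colouring(1)[OF c] that] crg_of_colouring(2,3)[OF c] embeds_cong[of I "kcol (crg_of I c)" c H]
    by simp
  show ?thesis using maps_to_contained[OF assms(1,2)] e iff[OF F] iff[OF G] by blast
qed

lemma crg_g_crg_of:
  assumes c: "is_colouring I c"
  shows "crg_g (crg_of I c) p = (INF \<mu> \<in> prob_masses I. qform c p I \<mu>)"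
  unfolding crg_g_qform crg_of_colouring(2)[OF c]
  by (intro INF_cong refl qform_cong crg_of_colouring(3)[OF c])

lemma qform_nonneg:
  assumes "p \<in> {0..1}" "\<mu> \<in> prob_masses I"
  shows "0 \<le> qform c p I \<mu>"
  unfolding qform_def using assms cost_bounds(1)[OF assms(1)]
  by (intro sum_nonneg mult_nonneg_nonneg) (auto simp: prob_masses_def)

lemma INF_qform_le:
  assumes "p \<in> {0..1}" "\<mu> \<in> prob_masses I"
  shows "(INF \<mu> \<in> prob_masses I. qform c p I \<mu>) \<le> qform c p I \<mu>"
  by (rule cINF_lower[OF _ assms(2)]) (auto intro!: bdd_belowI2[of _ 0] qform_nonneg[OF assms(1)])

section \<open>CRGs bound the edit distance from above\<close>

lemma exists_le_weighted_average:
  fixes \<mu> T :: "nat \<Rightarrow> real"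
  assumes "\<mu> \<in> prob_masses I"
  shows "\<exists>i\<in>I. T i \<le> (\<Sum>i\<in>I. \<mu> i * T i)"
proof (rule ccontr)
  let ?A = "\<Sum>i\<in>I. \<mu> i * T i"
  assume "\<not> ?thesis"
  then have gt: "\<And>i. i \<in> I \<Longrightarrow> T i > ?A" by force
  have one: "(\<Sum>i\<in>I. \<mu> i) = 1" and pos: "\<And>i. 0 \<le> \<mu> i" using assms by (auto simp: prob_masses_def)
  have fin: "finite I" using one sum.infinite[of I \<mu>] by (cases "finite I") auto
  obtain k where k: "k \<in> I" "\<mu> k > 0"
  proof -
    have "\<exists>k\<in>I. \<mu> k \<noteq> 0" using one by (metis sum.neutral zero_neq_one)
    then show ?thesis using pos that by (metis order_le_less)
  qed
  have "(\<Sum>i\<in>I. \<mu> i * ?A) < (\<Sum>i\<in>I. \<mu> i * T i)"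
  proof (rule sum_strict_mono_ex1[OF fin])
    show "\<forall>i\<in>I. \<mu> i * ?A \<le> \<mu> i * T i"
    proof
      fix i assume "i \<in> I"
      then show "\<mu> i * ?A \<le> \<mu> i * T i" using gt[of i] pos[of i] by (intro mult_left_mono) simp_all
    qed
    show "\<exists>i\<in>I. \<mu> i * ?A < \<mu> i * T i"
      using k gt[OF k(1)] by (intro bexI[OF _ k(1)]) simp
  qed
  moreover have "(\<Sum>i\<in>I. \<mu> i * ?A) = ?A" using one by (simp add: sum_distrib_right[symmetric])
  ultimately show False by simp
qed

text \<open>
  The method of conditional expectations: the right-hand side is the expected cost when the
  vertices are placed independently with law \<open>\<mu>\<close>. The vertex costs \<open>f\<close> make the induction work,
  since placing \<open>w\<close> turns the pair costs with \<open>w\<close> into vertex costs of the remaining vertices.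
\<close>

lemma exists_cheap_assignment:
  fixes \<mu> :: "nat \<Rightarrow> real" and f :: "nat \<Rightarrow> nat \<Rightarrow> real" and c :: "nat \<Rightarrow> nat \<Rightarrow> nat \<Rightarrow> nat \<Rightarrow> real"
  assumes V: "finite V" and \<mu>: "\<mu> \<in> prob_masses I" and c0: "\<And>u i j. c u u i j = 0"
  shows "\<exists>\<phi>. (\<forall>v\<in>V. \<phi> v \<in> I) \<and>
     (\<Sum>v\<in>V. f v (\<phi> v)) + (\<Sum>u\<in>V. \<Sum>v\<in>V. c u v (\<phi> u) (\<phi> v)) \<le>
     (\<Sum>v\<in>V. \<Sum>i\<in>I. \<mu> i * f v i) + (\<Sum>u\<in>V. \<Sum>v\<in>V. \<Sum>i\<in>I. \<Sum>j\<in>I. \<mu> i * \<mu> j * c u v i j)"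
  using V
proof (induction V arbitrary: f rule: finite_induct)
  case empty
  then show ?case by simp
next
  case (insert w V)
  define F where "F i v j = f v j + c w v i j + c v w j i" for i v j
  define Z where "Z = (\<Sum>u\<in>V. \<Sum>v\<in>V. \<Sum>i\<in>I. \<Sum>j\<in>I. \<mu> i * \<mu> j * c u v i j)"
  define T where "T i = f w i + (\<Sum>v\<in>V. \<Sum>j\<in>I. \<mu> j * F i v j) + Z" for i
  have one: "(\<Sum>i\<in>I. \<mu> i) = 1" using \<mu> by (simp add: prob_masses_def)
  obtain i where i: "i \<in> I" "T i \<le> (\<Sum>i\<in>I. \<mu> i * T i)"
    using exists_le_weighted_average[OF \<mu>, of T] by auto
  obtain \<phi> where \<phi>: "\<And>v. v \<in> V \<Longrightarrow> \<phi> v \<in> I"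
     "(\<Sum>v\<in>V. F i v (\<phi> v)) + (\<Sum>u\<in>V. \<Sum>v\<in>V. c u v (\<phi> u) (\<phi> v)) \<le>
       (\<Sum>v\<in>V. \<Sum>j\<in>I. \<mu> j * F i v j) + Z"
    using insert.IH[of "F i"] unfolding Z_def by blast
  define \<psi> where "\<psi> = \<phi>(w := i)"
  have \<psi>w: "\<psi> w = i" and \<psi>: "\<And>v. v \<in> V \<Longrightarrow> \<psi> v = \<phi> v"
    using insert.hyps by (auto simp: \<psi>_def)
  have split: "(\<Sum>u\<in>insert w V. \<Sum>v\<in>insert w V. g u v) =
      (\<Sum>v\<in>V. g w v) + (\<Sum>v\<in>V. g v w) + (\<Sum>u\<in>V. \<Sum>v\<in>V. g u v)"
    if "g w w = 0" for g :: "nat \<Rightarrow> nat \<Rightarrow> real"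
    using insert.hyps that by (simp add: sum.distrib)
  have "(\<Sum>v\<in>insert w V. f v (\<psi> v)) + (\<Sum>u\<in>insert w V. \<Sum>v\<in>insert w V. c u v (\<psi> u) (\<psi> v))
     = f w i + (\<Sum>v\<in>V. f v (\<phi> v)) + ((\<Sum>v\<in>V. c w v i (\<phi> v)) + (\<Sum>v\<in>V. c v w (\<phi> v) i)
        + (\<Sum>u\<in>V. \<Sum>v\<in>V. c u v (\<phi> u) (\<phi> v)))"
    unfolding split[of "\<lambda>u v. c u v (\<psi> u) (\<psi> v)", OF c0]
    using insert.hyps by (simp add: \<psi>w \<psi> cong: sum.cong)
  also have "\<dots> = f w i + ((\<Sum>v\<in>V. F i v (\<phi> v)) + (\<Sum>u\<in>V. \<Sum>v\<in>V. c u v (\<phi> u) (\<phi> v)))"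
    unfolding F_def by (simp add: sum.distrib)
  also have "\<dots> \<le> T i" using \<phi>(2) by (simp add: T_def)
  also have "\<dots> \<le> (\<Sum>i\<in>I. \<mu> i * T i)" by (rule i)
  also have "\<dots> = (\<Sum>i\<in>I. \<mu> i * f w i) + (\<Sum>i\<in>I. \<mu> i * (\<Sum>v\<in>V. \<Sum>j\<in>I. \<mu> j * F i v j)) + Z"
    using one unfolding T_def by (simp add: distrib_left sum.distrib sum_distrib_right[symmetric])
  also have "(\<Sum>i\<in>I. \<mu> i * (\<Sum>v\<in>V. \<Sum>j\<in>I. \<mu> j * F i v j)) =
     (\<Sum>v\<in>V. \<Sum>i\<in>I. \<Sum>j\<in>I. \<mu> i * \<mu> j * F i v j)"
    by (subst sum.swap) (simp add: sum_distrib_left mult.assoc)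
  also have "\<dots> = (\<Sum>v\<in>V. \<Sum>i\<in>I. \<Sum>j\<in>I. \<mu> i * \<mu> j * f v j) +
     (\<Sum>v\<in>V. \<Sum>i\<in>I. \<Sum>j\<in>I. \<mu> i * \<mu> j * c w v i j) + (\<Sum>v\<in>V. \<Sum>i\<in>I. \<Sum>j\<in>I. \<mu> i * \<mu> j * c v w j i)"
    by (simp add: F_def distrib_left sum.distrib)
  also have "(\<Sum>v\<in>V. \<Sum>i\<in>I. \<Sum>j\<in>I. \<mu> i * \<mu> j * f v j) = (\<Sum>v\<in>V. \<Sum>j\<in>I. \<mu> j * f v j)"
    using one by (simp add: mult.assoc sum_distrib_left[symmetric] sum_distrib_right[symmetric])
  also have "(\<Sum>v\<in>V. \<Sum>i\<in>I. \<Sum>j\<in>I. \<mu> i * \<mu> j * c v w j i) = (\<Sum>v\<in>V. \<Sum>i\<in>I. \<Sum>j\<in>I. \<mu> i * \<mu> j * c v w i j)"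
    by (rule sum.cong[OF refl], subst sum.swap) (simp add: mult.commute)
  finally have "(\<Sum>v\<in>insert w V. f v (\<psi> v)) + (\<Sum>u\<in>insert w V. \<Sum>v\<in>insert w V. c u v (\<psi> u) (\<psi> v))
     \<le> (\<Sum>i\<in>I. \<mu> i * f w i) + (\<Sum>v\<in>V. \<Sum>j\<in>I. \<mu> j * f v j) +
       ((\<Sum>v\<in>V. \<Sum>i\<in>I. \<Sum>j\<in>I. \<mu> i * \<mu> j * c w v i j) + (\<Sum>v\<in>V. \<Sum>i\<in>I. \<Sum>j\<in>I. \<mu> i * \<mu> j * c v w i j) + Z)"
    by simp
  also have "(\<Sum>v\<in>V. \<Sum>i\<in>I. \<Sum>j\<in>I. \<mu> i * \<mu> j * c w v i j) + (\<Sum>v\<in>V. \<Sum>i\<in>I. \<Sum>j\<in>I. \<mu> i * \<mu> j * c v w i j) + Z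
      = (\<Sum>u\<in>insert w V. \<Sum>v\<in>insert w V. \<Sum>i\<in>I. \<Sum>j\<in>I. \<mu> i * \<mu> j * c u v i j)"
    unfolding Z_def by (subst split) (simp_all add: c0)
  also have "(\<Sum>i\<in>I. \<mu> i * f w i) + (\<Sum>v\<in>V. \<Sum>j\<in>I. \<mu> j * f v j) = (\<Sum>v\<in>insert w V. \<Sum>j\<in>I. \<mu> j * f v j)"
    using insert.hyps by simp
  finally show ?case using \<phi>(1) i(1) by (intro exI[of _ \<psi>]) (auto simp: \<psi>_def)
qed

subsection \<open>Counting edges\<close>

lemma finite_all_pairs: "finite V \<Longrightarrow> finite (all_pairs V)"
  by (rule finite_subset[of _ "Pow V"]) (auto simp: all_pairs_def)

lemma card_all_pairs: "finite V \<Longrightarrow> card (all_pairs V) = card V choose 2"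
proof -
  assume V: "finite V"
  have "all_pairs V = {e. e \<subseteq> V \<and> card e = 2}"
    by (auto simp: all_pairs_def card_2_iff)
  then show ?thesis using n_subsets[OF V, of 2] by simp
qed

lemma sum_adjacency:
  assumes V: "finite V" and E: "E \<subseteq> all_pairs V"
  shows "(\<Sum>u\<in>V. \<Sum>v\<in>V. of_bool ({u, v} \<in> E)) = 2 * real (card E)"
proof -
  have "finite E" using E finite_all_pairs[OF V] finite_subset by auto
  then show ?thesis using E
  proof (induction E rule: finite_induct)
    case empty
    then show ?case by simp
  next
    case (insert e E)
    obtain a b where e: "e = {a, b}" "a \<in> V" "b \<in> V" "a \<noteq> b" using insert.prems by (auto simp: all_pairs_def)
    have "(\<Sum>u\<in>V. \<Sum>v\<in>V. of_bool ({u, v} \<in> insert e E)) =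
       (\<Sum>u\<in>V. \<Sum>v\<in>V. of_bool ({u, v} \<in> E) + (of_bool (u = a) * of_bool (v = b) + of_bool (u = b) * of_bool (v = a)) :: real)"
    proof (intro sum.cong refl)
      fix u v
      show "(of_bool ({u, v} \<in> insert e E) :: real) =
        of_bool ({u, v} \<in> E) + (of_bool (u = a) * of_bool (v = b) + of_bool (u = b) * of_bool (v = a))"
        using e(1,4) insert.hyps(2) by (cases "{u, v} = e") (auto simp: doubleton_eq_iff insert_commute)
    qed
    also have "\<dots> = (\<Sum>u\<in>V. \<Sum>v\<in>V. of_bool ({u, v} \<in> E)) + ((\<Sum>u\<in>V. of_bool (u = a)) * (\<Sum>v\<in>V. of_bool (v = b)) +
        (\<Sum>u\<in>V. of_bool (u = b)) * (\<Sum>v\<in>V. of_bool (v = a)))"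
      by (simp add: sum.distrib sum_product)
    also have "\<dots> = (\<Sum>u\<in>V. \<Sum>v\<in>V. of_bool ({u, v} \<in> E)) + 2"
      using e V by (simp add: of_bool_def sum.delta)
    finally show ?case using insert by simp
  qed
qed

lemma real_choose_two: "real (n choose 2) = real n * (real n - 1) / 2"
  by (induction n) (auto simp: numeral_2_eq_2 field_simps)

lemma symmetric_difference_subset:
  assumes "is_graph G" "is_graph H" "verts H = verts G"
  shows "edges G - edges H \<union> (edges H - edges G) \<subseteq> all_pairs (verts G)"
  using assms by (auto simp: is_graph_def)

lemma finite_graphs_on: "finite V \<Longrightarrow> finite {H. is_graph H \<and> verts H = V}"
proof -
  assume V: "finite V"
  have "{H. is_graph H \<and> verts H = V} \<subseteq> (\<lambda>E. \<lparr>verts = V, edges = E\<rparr>) ` Pow (all_pairs V)"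
  proof
    fix H assume "H \<in> {H. is_graph H \<and> verts H = V}"
    then show "H \<in> (\<lambda>E. \<lparr>verts = V, edges = E\<rparr>) ` Pow (all_pairs V)"
      by (intro image_eqI[of _ _ "edges H"]) (auto simp: is_graph_def)
  qed
  then show ?thesis using finite_all_pairs[OF V] by (meson finite_Pow_iff finite_imageI finite_subset)
qed

text \<open>
  This is what keeps the minimum in the distance to \<open>\<H>\<close> from being taken over an empty set.
\<close>

definition spans_all :: "graph set \<Rightarrow> bool" where
  "spans_all \<H> \<longleftrightarrow> (\<forall>G\<in>\<H>. is_graph G) \<and> (\<forall>V. finite V \<longrightarrow> (\<exists>H\<in>\<H>. verts H = V))"

lemma dist_to_le:
  assumes s: "spans_all \<H>" and G: "is_graph G" and H: "H \<in> \<H>" "verts H = verts G"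
  shows "dist_to G \<H> \<le> graph_dist G H"
proof -
  have "{graph_dist G H | H. H \<in> \<H> \<and> verts H = verts G} \<subseteq> graph_dist G ` {H. is_graph H \<and> verts H = verts G}"
    using s by (auto simp: spans_all_def)
  then have "finite {graph_dist G H | H. H \<in> \<H> \<and> verts H = verts G}"
    using finite_graphs_on[of "verts G"] G by (meson finite_imageI finite_subset is_graph_def)
  then show ?thesis unfolding dist_to_def using H by (intro Min_le) auto
qed

lemma dist_to_attained:
  assumes s: "spans_all \<H>" and G: "is_graph G"
  shows "\<exists>H\<in>\<H>. verts H = verts G \<and> dist_to G \<H> = graph_dist G H"
proof -
  have "{graph_dist G H | H. H \<in> \<H> \<and> verts H = verts G} \<subseteq> graph_dist G ` {H. is_graph H \<and> verts H = verts G}"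
    using s by (auto simp: spans_all_def)
  then have "finite {graph_dist G H | H. H \<in> \<H> \<and> verts H = verts G}"
    using finite_graphs_on[of "verts G"] G by (meson finite_imageI finite_subset is_graph_def)
  moreover have "{graph_dist G H | H. H \<in> \<H> \<and> verts H = verts G} \<noteq> {}"
    using s G unfolding spans_all_def is_graph_def by blast
  ultimately have "dist_to G \<H> \<in> {graph_dist G H | H. H \<in> \<H> \<and> verts H = verts G}"
    unfolding dist_to_def by (rule Min_in)
  then show ?thesis by blast
qed

lemma graph_dist_values:
  assumes "is_graph G" "is_graph H" "verts H = verts G" "card (verts G) = n"
  shows "graph_dist G H \<in> (\<lambda>k. real k / real (n choose 2)) ` {..n choose 2}"
proof -
  have "card (edges G - edges H \<union> (edges H - edges G)) \<le> n choose 2"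
    using card_mono[OF finite_all_pairs symmetric_difference_subset[OF assms(1-3)]] assms card_all_pairs[of "verts G"]
    by (simp add: is_graph_def)
  then show ?thesis unfolding graph_dist_def using assms(4) by auto
qed

lemma graph_dist_bounds:
  assumes "is_graph G" "is_graph H" "verts H = verts G"
  shows "0 \<le> graph_dist G H" "graph_dist G H \<le> 1"
  using graph_dist_values[OF assms refl] by (auto simp: divide_le_eq_1)

lemma exists_edge_count:
  assumes p: "p \<in> {0..1}"
  shows "\<exists>e. e \<le> N \<and> int e = \<lfloor>p * real N\<rfloor>"
proof -
  have "0 \<le> \<lfloor>p * real N\<rfloor>" "\<lfloor>p * real N\<rfloor> \<le> int N"
    using p mult_left_le_one_le[of "real N" p] by (auto simp: floor_le_iff)
  then show ?thesis by (intro exI[of _ "nat \<lfloor>p * real N\<rfloor>"]) auto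
qed

text \<open>
  There are infinitely many graphs of order \<open>n\<close> on subsets of the naturals, but their distances
  are multiples of \<open>1 / (n choose 2)\<close> that do not exceed 1.
\<close>

lemma max_dist_set:
  fixes p :: real
  assumes s: "spans_all \<H>" and p: "p \<in> {0..1}"
  defines "D n \<equiv> {dist_to G \<H> | G. is_graph G \<and> card (verts G) = n \<and>
            int (card (edges G)) = \<lfloor>p * real (n choose 2)\<rfloor>}"
  shows "finite (D n)" "D n \<noteq> {}"
proof -
  have "D n \<subseteq> (\<lambda>k. real k / real (n choose 2)) ` {..n choose 2}"
  proof
    fix d assume "d \<in> D n"
    then obtain G where G: "is_graph G" "card (verts G) = n" "d = dist_to G \<H>" unfolding D_def by blast
    obtain H where "H \<in> \<H>" "verts H = verts G" "dist_to G \<H> = graph_dist G H"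
      using dist_to_attained[OF s G(1)] by blast
    then show "d \<in> (\<lambda>k. real k / real (n choose 2)) ` {..n choose 2}"
      using graph_dist_values[OF G(1), of H n] G s by (auto simp: spans_all_def)
  qed
  then show "finite (D n)" by (rule finite_subset) simp
  obtain e where e: "e \<le> n choose 2" "int e = \<lfloor>p * real (n choose 2)\<rfloor>" using exists_edge_count[OF p] by blast
  obtain E where E: "E \<subseteq> all_pairs {..<n}" "card E = e"
    using obtain_subset_with_card_n[of e "all_pairs {..<n}"] e(1) card_all_pairs[of "{..<n}"] by auto
  have "is_graph \<lparr>verts = {..<n}, edges = E\<rparr>" using E by (simp add: is_graph_def)
  then have "dist_to \<lparr>verts = {..<n}, edges = E\<rparr> \<H> \<in> D n"
    unfolding D_def using E e by force
  then show "D n \<noteq> {}" by blast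
qed

lemma max_dist_ge:
  assumes s: "spans_all \<H>" and p: "p \<in> {0..1}" and G: "is_graph G" "card (verts G) = n"
    "int (card (edges G)) = \<lfloor>p * real (n choose 2)\<rfloor>"
  shows "dist_to G \<H> \<le> max_dist \<H> p n"
  unfolding max_dist_def using max_dist_set(1)[OF s p] G by (intro Max_ge) blast+

lemma max_dist_attained:
  assumes s: "spans_all \<H>" and p: "p \<in> {0..1}"
  shows "\<exists>G. is_graph G \<and> card (verts G) = n \<and> int (card (edges G)) = \<lfloor>p * real (n choose 2)\<rfloor> \<and>
     max_dist \<H> p n = dist_to G \<H>"
  using Max_in[OF max_dist_set[OF s p], of n] unfolding max_dist_def by blast

lemma max_dist_bounds:
  assumes s: "spans_all \<H>" and p: "p \<in> {0..1}"
  shows "0 \<le> max_dist \<H> p n" "max_dist \<H> p n \<le> 1"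
proof -
  obtain G where G: "is_graph G" "max_dist \<H> p n = dist_to G \<H>" using max_dist_attained[OF s p] by blast
  obtain H where H: "H \<in> \<H>" "verts H = verts G" "dist_to G \<H> = graph_dist G H"
    using dist_to_attained[OF s G(1)] by blast
  show "0 \<le> max_dist \<H> p n" "max_dist \<H> p n \<le> 1"
    using graph_dist_bounds[OF G(1), of H] H G s by (auto simp: spans_all_def)
qed

lemma ed_limsup:
  assumes s: "spans_all \<H>" and p: "p \<in> {0..1}"
  shows "ereal (ed \<H> p) = limsup (\<lambda>n. ereal (max_dist \<H> p n))"
proof -
  let ?L = "limsup (\<lambda>n. ereal (max_dist \<H> p n))"
  have "?L \<le> 1" using max_dist_bounds[OF s p] by (intro Limsup_bounded) auto
  moreover have "0 \<le> ?L"
    using max_dist_bounds[OF s p]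
    by (intro le_Limsup) auto
  ultimately have "\<bar>?L\<bar> \<noteq> \<infinity>" by auto
  then show ?thesis unfolding ed_def by (simp add: ereal_real)
qed

lemma ed_le:
  assumes s: "spans_all \<H>" and p: "p \<in> {0..1}"
    and b: "\<And>n. n \<ge> 2 \<Longrightarrow> max_dist \<H> p n \<le> b + 1 / real (n choose 2)"
  shows "ed \<H> p \<le> b"
proof -
  have c: "real n - 1 \<le> real (n choose 2)" if "n \<ge> 2" for n
  proof -
    have "1 * real (n - 1) \<le> (real n / 2) * real (n - 1)"
      using that by (intro mult_right_mono) simp_all
    also have "\<dots> = real (n choose 2)"
      using that by (simp add: real_choose_two of_nat_diff)
    finally show ?thesis using that by (simp add: of_nat_diff)
  qed
  have "(\<lambda>n. b + 1 / (real n - 1)) \<longlonglongrightarrow> b + 0"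
    by (intro tendsto_intros) real_asymp
  then have "(\<lambda>n. ereal (b + 1 / (real n - 1))) \<longlonglongrightarrow> ereal b" by simp
  then have lim: "limsup (\<lambda>n. ereal (b + 1 / (real n - 1))) = ereal b"
    using lim_imp_Limsup trivial_limit_sequentially by blast
  have "ereal (ed \<H> p) \<le> limsup (\<lambda>n. ereal (b + 1 / (real n - 1)))"
    unfolding ed_limsup[OF s p]
  proof (rule Limsup_mono)
    show "\<forall>\<^sub>F n in sequentially. ereal (max_dist \<H> p n) \<le> ereal (b + 1 / (real n - 1))"
      using eventually_ge_at_top[of 2]
    proof eventually_elim
      case (elim n)
      then have "1 / real (n choose 2) \<le> 1 / (real n - 1)" using c[OF elim] by (intro divide_left_mono) auto
      then show ?case using b[OF elim] by simp
    qed
  qed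
  then show ?thesis unfolding lim by simp
qed

lemma ed_ge:
  assumes s: "spans_all \<H>" and p: "p \<in> {0..1}"
    and b: "\<And>n0. \<exists>n\<ge>n0. b \<le> max_dist \<H> p n"
  shows "b \<le> ed \<H> p"
proof (rule ccontr)
  assume "\<not> ?thesis"
  then have "limsup (\<lambda>n. ereal (max_dist \<H> p n)) < ereal b"
    using ed_limsup[OF s p] by (metis ereal_less_eq(3) not_le)
  then have "\<forall>\<^sub>F n in sequentially. ereal (max_dist \<H> p n) < ereal b"
    by (rule Limsup_lessD)
  then obtain n0 where "\<And>n. n \<ge> n0 \<Longrightarrow> max_dist \<H> p n < b" by (auto simp: eventually_sequentially)
  then show False using b[of n0] by force
qed

subsection \<open>Editing towards a CRG\<close>

text \<open>
  A pair of \<open>G\<close> is edited if it is an edge on a white pair or a non-edge on a black pair. On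
  average over \<open>\<mu>\<close>, the proportion of such pairs is \<open>p P\<^sub>w + (1 - p) P\<^sub>b\<close>, which is the
  quadratic form; the error term comes from rounding the number of edges.
\<close>

lemma edit_towards_crg:
  assumes F: "is_graph F" and s: "spans_all (Forb F)" and p: "p \<in> {0..1}"
    and K: "is_colouring I c" "\<not> embeds F I c" and \<mu>: "\<mu> \<in> prob_masses I"
    and G: "is_graph G" "card (verts G) = n" "n \<ge> 2"
      "int (card (edges G)) = \<lfloor>p * real (n choose 2)\<rfloor>"
  shows "dist_to G (Forb F) \<le> qform c p I \<mu> + 1 / real (n choose 2)"
proof -
  define V where "V = verts G"
  define E where "E = edges G"
  have V: "finite V" and E: "E \<subseteq> all_pairs V" using G(1) by (auto simp: V_def E_def is_graph_def)
  define N where "N = real (n choose 2)"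
  have N: "N \<ge> 1" unfolding N_def using G(3) by (simp add: Suc_leI zero_less_binomial)
  have finI: "finite I" using K by (simp add: is_colouring_def)
  have one: "(\<Sum>i\<in>I. \<mu> i) = 1" and mu0: "\<And>i. 0 \<le> \<mu> i" using \<mu> by (auto simp: prob_masses_def)
  define w :: "nat \<Rightarrow> nat \<Rightarrow> nat \<Rightarrow> nat \<Rightarrow> real" where
    "w u v i j = (if u = v then 0 else if {u, v} \<in> E then of_bool (c i j = White) else of_bool (c i j = Black))"
    for u v i j
  obtain \<phi> where \<phi>: "\<And>v. v \<in> V \<Longrightarrow> \<phi> v \<in> I"
    "(\<Sum>u\<in>V. \<Sum>v\<in>V. w u v (\<phi> u) (\<phi> v)) \<le> (\<Sum>u\<in>V. \<Sum>v\<in>V. \<Sum>i\<in>I. \<Sum>j\<in>I. \<mu> i * \<mu> j * w u v i j)"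
    using exists_cheap_assignment[OF V \<mu>, of w "\<lambda>_ _. 0"] by (auto simp: w_def)
  define P where "P C = (\<Sum>i\<in>I. \<Sum>j\<in>I. \<mu> i * \<mu> j * of_bool (c i j = C))" for C
  have P0: "0 \<le> P C" for C unfolding P_def using mu0 by (intro sum_nonneg) simp
  have P1: "P C \<le> 1" for C
  proof -
    have "P C \<le> (\<Sum>i\<in>I. \<Sum>j\<in>I. \<mu> i * \<mu> j)" unfolding P_def
      by (intro sum_mono) (simp add: mu0 of_bool_def)
    also have "\<dots> = 1" using one by (simp add: sum_distrib_left[symmetric] sum_distrib_right[symmetric])
    finally show ?thesis .
  qed
  define H where "H = \<lparr>verts = V, edges = {{u, v} | u v. u \<in> V \<and> v \<in> V \<and> u \<noteq> v \<and>
     (c (\<phi> u) (\<phi> v) = Black \<or> c (\<phi> u) (\<phi> v) = Gray \<and> {u, v} \<in> E)}\<rparr>"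
  have csym: "c (\<phi> u) (\<phi> v) = c (\<phi> v) (\<phi> u)" if "u \<in> V" "v \<in> V" for u v
    using K(1) \<phi>(1) that by (auto simp: is_colouring_def)
  have He: "{u, v} \<in> edges H \<longleftrightarrow> u \<noteq> v \<and>
     (c (\<phi> u) (\<phi> v) = Black \<or> c (\<phi> u) (\<phi> v) = Gray \<and> {u, v} \<in> E)"
    if "u \<in> V" "v \<in> V" for u v
  proof
    assume "{u, v} \<in> edges H"
    then show "u \<noteq> v \<and> (c (\<phi> u) (\<phi> v) = Black \<or> c (\<phi> u) (\<phi> v) = Gray \<and> {u, v} \<in> E)"
      using csym[OF that] unfolding H_def by (auto simp: doubleton_eq_iff insert_commute)
  next
    assume "u \<noteq> v \<and> (c (\<phi> u) (\<phi> v) = Black \<or> c (\<phi> u) (\<phi> v) = Gray \<and> {u, v} \<in> E)"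
    then show "{u, v} \<in> edges H" using that unfolding H_def by auto
  qed
  have Hg: "is_graph H" using V by (auto simp: H_def is_graph_def all_pairs_def)
  have HV: "verts H = V" by (simp add: H_def)
  have "\<not> contains_induced H F"
  proof
    assume "contains_induced H F"
    moreover have "embeds H I c"
      unfolding embeds_def HV using \<phi>(1) He by (intro exI[of _ \<phi>]) (auto simp: fits_def)
    ultimately show False using embeds_contained[OF _ F Hg] K by blast
  qed
  then have HF: "H \<in> Forb F" using Hg by (simp add: Forb_def)
  define Q where "Q = edges G - edges H \<union> (edges H - edges G)"
  have Q: "Q \<subseteq> all_pairs V" using symmetric_difference_subset[OF G(1) Hg] HV by (simp add: Q_def V_def)
  have eE: "real (card E) \<le> p * N" "N - real (card E) \<le> (1 - p) * N + 1"
  proof -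
    have "real (card E) = of_int \<lfloor>p * N\<rfloor>" using G(4) unfolding E_def N_def by (metis of_int_of_nat_eq)
    then show "real (card E) \<le> p * N" "N - real (card E) \<le> (1 - p) * N + 1"
      using real_of_int_floor_add_one_gt[of "p * N"] of_int_floor_le[of "p * N"] by (auto simp: algebra_simps)
  qed
  have "2 * real (card Q) = (\<Sum>u\<in>V. \<Sum>v\<in>V. of_bool ({u, v} \<in> Q))" using sum_adjacency[OF V Q] by simp
  also have "\<dots> = (\<Sum>u\<in>V. \<Sum>v\<in>V. w u v (\<phi> u) (\<phi> v))"
  proof (intro sum.cong refl)
    fix u v assume uv: "u \<in> V" "v \<in> V"
    have "{u, v} \<in> E \<Longrightarrow> u \<noteq> v" using E all_pairs_neq[of u v V] by blast
    then show "of_bool ({u, v} \<in> Q) = w u v (\<phi> u) (\<phi> v)"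
      using He[OF uv] unfolding Q_def w_def E_def[symmetric]
      by (cases "c (\<phi> u) (\<phi> v)") auto
  qed
  also have "\<dots> \<le> (\<Sum>u\<in>V. \<Sum>v\<in>V. \<Sum>i\<in>I. \<Sum>j\<in>I. \<mu> i * \<mu> j * w u v i j)" by (rule \<phi>)
  also have "\<dots> = (\<Sum>u\<in>V. \<Sum>v\<in>V. of_bool ({u, v} \<in> E) * P White + of_bool ({u, v} \<in> all_pairs V - E) * P Black)"
  proof (intro sum.cong refl)
    fix u v assume uv: "u \<in> V" "v \<in> V"
    have "{u, v} \<in> E \<Longrightarrow> u \<noteq> v" using E all_pairs_neq[of u v V] by blast
    then show "(\<Sum>i\<in>I. \<Sum>j\<in>I. \<mu> i * \<mu> j * w u v i j) =
      of_bool ({u, v} \<in> E) * P White + of_bool ({u, v} \<in> all_pairs V - E) * P Black"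
      using uv unfolding P_def w_def by (auto simp: all_pairs_neq)
  qed
  also have "\<dots> = 2 * real (card E) * P White + 2 * real (card (all_pairs V - E)) * P Black"
    unfolding sum.distrib sum_distrib_right[symmetric]
    by (subst (1 2) sum_adjacency) (use V E in auto)
  also have "real (card (all_pairs V - E)) = N - real (card E)"
    using card_Diff_subset[of E "all_pairs V"] E finite_all_pairs[OF V] card_mono[OF _ E] card_all_pairs[OF V] G(2)
    by (simp add: finite_subset of_nat_diff N_def V_def)
  finally have "real (card Q) \<le> real (card E) * P White + (N - real (card E)) * P Black"
    by (simp add: algebra_simps)
  also have "\<dots> \<le> (p * N) * P White + ((1 - p) * N + 1) * P Black"
    using eE P0 by (intro add_mono mult_right_mono) auto
  also have "\<dots> \<le> N * (p * P White + (1 - p) * P Black) + 1" using P1[of Black] by (simp add: algebra_simps)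
  also have "p * P White + (1 - p) * P Black = qform c p I \<mu>"
  proof -
    have "qform c p I \<mu> = (\<Sum>i\<in>I. \<Sum>j\<in>I. p * (\<mu> i * \<mu> j * of_bool (c i j = White)) + (1 - p) * (\<mu> i * \<mu> j * of_bool (c i j = Black)))"
      unfolding qform_def sum_distrib_left
    proof (intro sum.cong refl)
      fix i j show "\<mu> i * (cost p (c i j) * \<mu> j) =
        p * (\<mu> i * \<mu> j * of_bool (c i j = White)) + (1 - p) * (\<mu> i * \<mu> j * of_bool (c i j = Black))"
        by (cases "c i j") (auto simp: algebra_simps)
    qed
    then show ?thesis by (simp add: P_def sum.distrib sum_distrib_left)
  qed
  finally have "real (card Q) / N \<le> qform c p I \<mu> + 1 / N"
    using N by (simp add: field_simps)
  moreover have "graph_dist G H = real (card Q) / N"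
    unfolding graph_dist_def Q_def N_def using G(2) by simp
  ultimately show ?thesis using dist_to_le[OF s G(1) HF] HV by (simp add: V_def N_def)
qed

lemma ed_le_crg_g:
  assumes F: "is_graph F" and s: "spans_all (Forb F)" and p: "p \<in> {0..1}"
    and K: "K \<in> crg_class (Forb F)"
  shows "ed (Forb F) p \<le> crg_g K p"
  unfolding crg_g_qform
proof (rule cINF_greatest)
  have Kc: "is_crg K" "\<not> embeds F (crg_verts K) (kcol K)" using K crg_class_Forb[OF F] by auto
  obtain k where k: "k \<in> crg_verts K" "finite (crg_verts K)" using Kc(1) by (auto simp: is_crg_def)
  show "prob_masses (crg_verts K) \<noteq> {}"
  proof -
    have "(\<lambda>x. of_bool (x = k)) \<in> prob_masses (crg_verts K)"
      using k by (auto simp: prob_masses_def of_bool_def)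
    then show ?thesis by blast
  qed
  fix \<mu> assume \<mu>: "\<mu> \<in> prob_masses (crg_verts K)"
  show "ed (Forb F) p \<le> qform (kcol K) p (crg_verts K) \<mu>"
  proof (rule ed_le[OF s p])
    fix n :: nat assume n: "n \<ge> 2"
    obtain G where "is_graph G" "card (verts G) = n" "int (card (edges G)) = \<lfloor>p * real (n choose 2)\<rfloor>"
      "max_dist (Forb F) p n = dist_to G (Forb F)"
      using max_dist_attained[OF s p] by blast
    then show "max_dist (Forb F) p n \<le> qform (kcol K) p (crg_verts K) \<mu> + 1 / real (n choose 2)"
      using edit_towards_crg[OF F s p is_colouring_kcol[OF Kc(1)] Kc(2) \<mu>] n by simp
  qed
qed

section \<open>Weak regularity\<close>

text \<open>
  The kernel averages over the class of \<open>x\<close> in the partition of \<open>V\<close> by labels \<open>c\<close>. It is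
  symmetric and stochastic, so the block means are an orthogonal projection.
\<close>

definition block_kernel :: "nat set \<Rightarrow> (nat \<Rightarrow> nat) \<Rightarrow> nat \<Rightarrow> nat \<Rightarrow> real" where
  "block_kernel V c x y = of_bool (c x = c y) / real (card {z \<in> V. c z = c x})"

definition block_mean :: "nat set \<Rightarrow> (nat \<Rightarrow> nat) \<Rightarrow> (nat \<Rightarrow> nat \<Rightarrow> real) \<Rightarrow> nat \<Rightarrow> nat \<Rightarrow> real" where
  "block_mean V c a x y = (\<Sum>x'\<in>V. \<Sum>y'\<in>V. block_kernel V c x x' * block_kernel V c y y' * a x' y')"

lemma block_kernel_sym: "block_kernel V c x y = block_kernel V c y x"
  by (simp add: block_kernel_def)

lemma block_kernel_nonneg: "0 \<le> block_kernel V c x y"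
  by (simp add: block_kernel_def)

lemma block_kernel_sum:
  assumes "finite V" "x \<in> V"
  shows "(\<Sum>y\<in>V. block_kernel V c x y) = 1"
proof -
  have "(\<Sum>y\<in>V. block_kernel V c x y) = (\<Sum>y\<in>V. of_bool (c y = c x)) / real (card {z \<in> V. c z = c x})"
    unfolding block_kernel_def sum_divide_distrib by (intro sum.cong refl) (auto simp: of_bool_def)
  also have "(\<Sum>y\<in>V. of_bool (c y = c x)) = real (card {z \<in> V. c z = c x})"
    using assms by (simp add: sum_of_bool_eq Int_def)
  finally show ?thesis using assms by auto
qed

lemma block_mean_label_cong:
  assumes "c x = c x'" "c y = c y'"
  shows "block_mean V c a x y = block_mean V c a x' y'"
  using assms unfolding block_mean_def block_kernel_def by simp

lemma block_mean_sym:
  assumes "\<And>x y. x \<in> V \<Longrightarrow> y \<in> V \<Longrightarrow> a x y = a y x"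
  shows "block_mean V c a x y = block_mean V c a y x"
  unfolding block_mean_def
  by (subst sum.swap) (intro sum.cong refl, use assms in \<open>auto simp: mult_ac\<close>)

lemma block_mean_bounds:
  assumes V: "finite V" and a: "\<And>x y. x \<in> V \<Longrightarrow> y \<in> V \<Longrightarrow> a x y \<in> {0..1}" and xy: "x \<in> V" "y \<in> V"
  shows "block_mean V c a x y \<in> {0..1}"
proof -
  have "block_mean V c a x y \<le> (\<Sum>x'\<in>V. \<Sum>y'\<in>V. block_kernel V c x x' * block_kernel V c y y')"
    unfolding block_mean_def using a block_kernel_nonneg
    by (intro sum_mono mult_right_le_one_le mult_nonneg_nonneg) auto
  also have "\<dots> = 1"
    using block_kernel_sum[OF V] xy by (simp add: sum_product[symmetric])
  moreover have "0 \<le> block_mean V c a x y"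
    unfolding block_mean_def using a block_kernel_nonneg by (intro sum_nonneg mult_nonneg_nonneg) auto
  ultimately show ?thesis by simp
qed

text \<open>
  Block averaging is self-adjoint and fixes the functions \<open>\<phi>\<close> that are constant on the blocks.
\<close>

lemma block_mean_projection:
  assumes V: "finite V" and \<phi>: "\<And>x y x' y'. c x = c x' \<Longrightarrow> c y = c y' \<Longrightarrow> \<phi> x y = \<phi> x' y'"
  shows "(\<Sum>x\<in>V. \<Sum>y\<in>V. block_mean V c a x y * \<phi> x y) = (\<Sum>x\<in>V. \<Sum>y\<in>V. a x y * \<phi> x y)"
proof -
  have k0: "block_kernel V c x x' * block_kernel V c y y' * a x' y' * \<phi> x y =
      block_kernel V c x x' * block_kernel V c y y' * a x' y' * \<phi> x' y'" for x x' y y'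
  proof (cases "c x = c x' \<and> c y = c y'")
    case True
    then show ?thesis using \<phi>[of x x' y y'] by simp
  next
    case False
    then show ?thesis by (auto simp: block_kernel_def)
  qed
  have "(\<Sum>x\<in>V. \<Sum>y\<in>V. block_mean V c a x y * \<phi> x y) =
     (\<Sum>x\<in>V. \<Sum>y\<in>V. \<Sum>x'\<in>V. \<Sum>y'\<in>V. block_kernel V c x x' * block_kernel V c y y' * a x' y' * \<phi> x' y')"
    unfolding block_mean_def sum_distrib_right by (intro sum.cong refl k0)
  also have "\<dots> = (\<Sum>x\<in>V. \<Sum>x'\<in>V. \<Sum>y\<in>V. \<Sum>y'\<in>V. block_kernel V c x x' * block_kernel V c y y' * a x' y' * \<phi> x' y')"
    by (intro sum.cong refl sum.swap)
  also have "\<dots> = (\<Sum>x'\<in>V. \<Sum>x\<in>V. \<Sum>y\<in>V. \<Sum>y'\<in>V. block_kernel V c x x' * block_kernel V c y y' * a x' y' * \<phi> x' y')"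
    by (rule sum.swap)
  also have "\<dots> = (\<Sum>x'\<in>V. \<Sum>x\<in>V. \<Sum>y'\<in>V. \<Sum>y\<in>V. block_kernel V c x x' * block_kernel V c y y' * a x' y' * \<phi> x' y')"
    by (intro sum.cong refl sum.swap)
  also have "\<dots> = (\<Sum>x'\<in>V. \<Sum>y'\<in>V. \<Sum>x\<in>V. \<Sum>y\<in>V. block_kernel V c x x' * block_kernel V c y y' * a x' y' * \<phi> x' y')"
    by (intro sum.cong refl sum.swap)
  also have "\<dots> = (\<Sum>x'\<in>V. \<Sum>y'\<in>V. (\<Sum>x\<in>V. block_kernel V c x' x) * (\<Sum>y\<in>V. block_kernel V c y' y) * (a x' y' * \<phi> x' y'))"
  proof (rule sum.cong[OF refl], rule sum.cong[OF refl])
    fix x' y'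
    show "(\<Sum>x\<in>V. \<Sum>y\<in>V. block_kernel V c x x' * block_kernel V c y y' * a x' y' * \<phi> x' y') =
       (\<Sum>x\<in>V. block_kernel V c x' x) * (\<Sum>y\<in>V. block_kernel V c y' y) * (a x' y' * \<phi> x' y')"
      unfolding sum_product unfolding sum_distrib_right block_kernel_sym[of V c _ x'] block_kernel_sym[of V c _ y']
      by (simp only: mult.assoc)
  qed
  also have "\<dots> = (\<Sum>x'\<in>V. \<Sum>y'\<in>V. a x' y' * \<phi> x' y')"
    using block_kernel_sum[OF V] by (intro sum.cong refl) simp
  finally show ?thesis .
qed

definition cut_close :: "nat set \<Rightarrow> real \<Rightarrow> (nat \<Rightarrow> nat \<Rightarrow> real) \<Rightarrow> (nat \<Rightarrow> nat \<Rightarrow> real) \<Rightarrow> bool" where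
  "cut_close V \<epsilon> a b \<longleftrightarrow>
     (\<forall>S\<subseteq>V. \<forall>T\<subseteq>V. \<bar>\<Sum>x\<in>S. \<Sum>y\<in>T. a x y - b x y\<bar> \<le> \<epsilon> * (real (card V))\<^sup>2)"

definition block_energy :: "nat set \<Rightarrow> (nat \<Rightarrow> nat) \<Rightarrow> (nat \<Rightarrow> nat \<Rightarrow> real) \<Rightarrow> real" where
  "block_energy V c a = (\<Sum>x\<in>V. \<Sum>y\<in>V. (block_mean V c a x y)\<^sup>2)"

lemma sum_subset_indicator:
  assumes "finite V" "S \<subseteq> V" "T \<subseteq> V"
  shows "(\<Sum>x\<in>S. \<Sum>y\<in>T. g x y) = (\<Sum>x\<in>V. \<Sum>y\<in>V. (g x y :: real) * (of_bool (x \<in> S) * of_bool (y \<in> T)))"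
proof -
  have "(\<Sum>x\<in>V. \<Sum>y\<in>V. g x y * (of_bool (x \<in> S) * of_bool (y \<in> T))) =
    (\<Sum>x\<in>V. if x \<in> S then \<Sum>y\<in>V. (if y \<in> T then g x y else 0) else 0)"
    by (intro sum.cong refl) (auto intro!: sum.cong)
  also have "\<dots> = (\<Sum>x\<in>V \<inter> S. \<Sum>y\<in>V \<inter> T. g x y)"
    using assms by (simp add: sum.inter_restrict)
  finally show ?thesis using assms by (simp add: Int_absorb1)
qed

text \<open>
  A rectangle \<open>S \<times> T\<close> on which \<open>a\<close> deviates from its block means correlates with the difference
  of the new and the old block means, as it is a union of new blocks. By Cauchy--Schwarz this
  difference is large in square mean, and by orthogonality (Pythagoras) the energy grows by
  exactly that much.
\<close>

lemma energy_increment: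
  assumes V: "finite V" and \<epsilon>: "\<epsilon> \<ge> 0" and ST: "S \<subseteq> V" "T \<subseteq> V"
    and far: "\<bar>\<Sum>x\<in>S. \<Sum>y\<in>T. a x y - block_mean V c a x y\<bar> > \<epsilon> * (real (card V))\<^sup>2"
    and c': "\<And>x y. c' x = c' y \<Longrightarrow> c x = c y \<and> (x \<in> S \<longleftrightarrow> y \<in> S) \<and> (x \<in> T \<longleftrightarrow> y \<in> T)"
  shows "block_energy V c' a \<ge> block_energy V c a + \<epsilon>\<^sup>2 * (real (card V))\<^sup>2"
proof -
  define h where "h = block_mean V c a"
  define h' where "h' = block_mean V c' a"
  define s where "s x y = (of_bool (x \<in> S) * of_bool (y \<in> T) :: real)" for x y
  let ?\<Sigma> = "\<lambda>g. \<Sum>x\<in>V. \<Sum>y\<in>V. (g x y :: real)"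
  let ?n = "real (card V)"
  have hh: "h x y = h x' y'" if "c' x = c' x'" "c' y = c' y'" for x y x' y'
    unfolding h_def using c'[OF that(1)] c'[OF that(2)] by (intro block_mean_label_cong) simp_all
  have "?\<Sigma> (\<lambda>x y. h' x y * h x y) = ?\<Sigma> (\<lambda>x y. a x y * h x y)"
    unfolding h'_def by (rule block_mean_projection[OF V]) (rule hh)
  moreover have "?\<Sigma> (\<lambda>x y. h x y * h x y) = ?\<Sigma> (\<lambda>x y. a x y * h x y)"
    unfolding h_def by (rule block_mean_projection[OF V]) (rule block_mean_label_cong)
  ultimately have orth: "?\<Sigma> (\<lambda>x y. h' x y * h x y) = ?\<Sigma> (\<lambda>x y. h x y * h x y)" by simp
  have "?\<Sigma> (\<lambda>x y. (h' x y - h x y)\<^sup>2) = ?\<Sigma> (\<lambda>x y. (h' x y)\<^sup>2) - 2 * ?\<Sigma> (\<lambda>x y. h' x y * h x y) + ?\<Sigma> (\<lambda>x y. (h x y)\<^sup>2)"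
    by (simp add: power2_eq_square algebra_simps sum.distrib sum_subtractf sum_distrib_left)
  also have "\<dots> = block_energy V c' a - block_energy V c a"
    using orth unfolding block_energy_def h_def h'_def by (simp add: power2_eq_square)
  finally have E: "block_energy V c' a - block_energy V c a = ?\<Sigma> (\<lambda>x y. (h' x y - h x y)\<^sup>2)" by simp
  have "?\<Sigma> (\<lambda>x y. h' x y * s x y) = ?\<Sigma> (\<lambda>x y. a x y * s x y)"
    unfolding h'_def
  proof (rule block_mean_projection[OF V])
    fix x y x' y' assume "c' x = c' x'" "c' y = c' y'"
    then show "s x y = s x' y'" using c'[of x x'] c'[of y y'] by (simp add: s_def)
  qed
  then have "?\<Sigma> (\<lambda>x y. (h' x y - h x y) * s x y) = ?\<Sigma> (\<lambda>x y. (a x y - h x y) * s x y)"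
    by (simp add: left_diff_distrib sum_subtractf)
  also have "\<dots> = (\<Sum>x\<in>S. \<Sum>y\<in>T. a x y - h x y)"
    unfolding s_def using sum_subset_indicator[OF V ST] by simp
  finally have big: "\<epsilon> * ?n\<^sup>2 < \<bar>?\<Sigma> (\<lambda>x y. (h' x y - h x y) * s x y)\<bar>" using far by (simp add: h_def)
  have cs: "(?\<Sigma> (\<lambda>x y. (h' x y - h x y) * s x y))\<^sup>2 \<le> ?\<Sigma> (\<lambda>x y. (h' x y - h x y)\<^sup>2) * ?\<Sigma> (\<lambda>x y. (s x y)\<^sup>2)"
    unfolding sum.cartesian_product
    using Cauchy_Schwarz_ineq_sum[of "\<lambda>(x, y). h' x y - h x y" "\<lambda>(x, y). s x y" "V \<times> V"]
    by (simp add: case_prod_unfold)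
  have "?\<Sigma> (\<lambda>x y. (s x y)\<^sup>2) \<le> ?\<Sigma> (\<lambda>x y. 1)" by (intro sum_mono) (auto simp: s_def)
  also have "\<dots> = ?n\<^sup>2" by (simp add: power2_eq_square)
  finally have s2: "?\<Sigma> (\<lambda>x y. (s x y)\<^sup>2) \<le> ?n\<^sup>2" .
  have "(\<epsilon> * ?n\<^sup>2)\<^sup>2 \<le> (?\<Sigma> (\<lambda>x y. (h' x y - h x y) * s x y))\<^sup>2"
    using big \<epsilon> by (subst abs_le_square_iff[symmetric]) simp
  also have "\<dots> \<le> ?\<Sigma> (\<lambda>x y. (h' x y - h x y)\<^sup>2) * ?n\<^sup>2"
    using cs s2 by (meson mult_left_mono order_trans sum_nonneg zero_le_power2)
  finally have "(\<epsilon>\<^sup>2 * ?n\<^sup>2) * ?n\<^sup>2 \<le> ?\<Sigma> (\<lambda>x y. (h' x y - h x y)\<^sup>2) * ?n\<^sup>2"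
    by (simp add: power_mult_distrib power2_eq_square mult_ac)
  moreover have "?n > 0"
  proof (rule ccontr)
    assume "\<not> ?n > 0"
    then have "V = {}" using V by simp
    then show False using big by simp
  qed
  ultimately have "\<epsilon>\<^sup>2 * ?n\<^sup>2 \<le> ?\<Sigma> (\<lambda>x y. (h' x y - h x y)\<^sup>2)" by simp
  then show ?thesis using E by simp
qed

text \<open>
  The regularity lemma of Frieze and Kannan. The energy is at most \<open>|V|\<^sup>2\<close> and each refinement
  adds \<open>\<epsilon>\<^sup>2 |V|\<^sup>2\<close>, so fewer than \<open>1/\<epsilon>\<^sup>2 + 1\<close> refinements by four are possible.
\<close>

lemma weak_regularity:
  assumes \<epsilon>: "\<epsilon> > 0"
  shows "\<exists>k. \<forall>V a. finite V \<longrightarrow> (\<forall>x\<in>V. \<forall>y\<in>V. a x y \<in> {0..1}) \<longrightarrow>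
     (\<exists>c. (\<forall>x. c x < k) \<and> cut_close V \<epsilon> a (block_mean V c a))"
proof -
  obtain J :: nat where J: "1 / \<epsilon>\<^sup>2 < real J" using reals_Archimedean2 by blast
  show ?thesis
  proof (intro exI[of _ "4 ^ J"] allI impI)
    fix V :: "nat set" and a :: "nat \<Rightarrow> nat \<Rightarrow> real"
    assume V: "finite V" and a: "\<forall>x\<in>V. \<forall>y\<in>V. a x y \<in> {0..1}"
    let ?n = "real (card V)"
    have "(\<exists>c. (\<forall>x. c x < 4 ^ J) \<and> cut_close V \<epsilon> a (block_mean V c a)) \<or>
      (\<exists>c. (\<forall>x. c x < 4 ^ j) \<and> real j * \<epsilon>\<^sup>2 * ?n\<^sup>2 \<le> block_energy V c a)" if "j \<le> J" for j
      using that
    proof (induction j)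
      case 0
      show ?case by (intro disjI2 exI[of _ "\<lambda>_. 0"]) (auto simp: block_energy_def intro!: sum_nonneg)
    next
      case (Suc j)
      show ?case
      proof (cases "\<exists>c. (\<forall>x. c x < 4 ^ J) \<and> cut_close V \<epsilon> a (block_mean V c a)")
        case False
        then obtain c where c: "\<And>x. c x < 4 ^ j" "real j * \<epsilon>\<^sup>2 * ?n\<^sup>2 \<le> block_energy V c a"
          using Suc by auto
        have "c x < 4 ^ J" for x
          using c(1)[of x] Suc.prems power_increasing[of j J "4::nat"] by linarith
        then obtain S T where ST: "S \<subseteq> V" "T \<subseteq> V"
          "\<bar>\<Sum>x\<in>S. \<Sum>y\<in>T. a x y - block_mean V c a x y\<bar> > \<epsilon> * ?n\<^sup>2"
          using False unfolding cut_close_def by (meson not_le)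
        \<comment> \<open>The common refinement by \<open>S\<close> and \<open>T\<close>: their indicators become the two lowest binary digits.\<close>
        define c' where "c' x = 4 * c x + 2 * of_bool (x \<in> S) + of_bool (x \<in> T)" for x
        have lab: "c x = c y \<and> (x \<in> S \<longleftrightarrow> y \<in> S) \<and> (x \<in> T \<longleftrightarrow> y \<in> T)" if "c' x = c' y" for x y
        proof -
          have digits: "c z = c' z div 4" "of_bool (z \<in> S) = c' z mod 4 div 2" "of_bool (z \<in> T) = c' z mod 2" for z
            unfolding c'_def by (cases "z \<in> S"; cases "z \<in> T"; simp; presburger)+
          have "c x = c y" "(of_bool (x \<in> S) :: nat) = of_bool (y \<in> S)" "(of_bool (x \<in> T) :: nat) = of_bool (y \<in> T)"
            unfolding digits that by simp_all
          then show ?thesis by (simp add: of_bool_eq_iff)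
        qed
        have "block_energy V c' a \<ge> block_energy V c a + \<epsilon>\<^sup>2 * ?n\<^sup>2"
          by (rule energy_increment[OF V _ ST lab]) (use \<epsilon> in auto)
        then have "real (Suc j) * \<epsilon>\<^sup>2 * ?n\<^sup>2 \<le> block_energy V c' a" using c(2) by (simp add: algebra_simps)
        moreover have "c' x < 4 ^ Suc j" for x using c(1)[of x] by (auto simp: c'_def of_bool_def)
        ultimately show ?thesis by blast
      qed auto
    qed
    from this[OF order_refl] show "\<exists>c. (\<forall>x. c x < 4 ^ J) \<and> cut_close V \<epsilon> a (block_mean V c a)"
    proof (elim disjE)
      assume "\<exists>c. (\<forall>x. c x < 4 ^ J) \<and> real J * \<epsilon>\<^sup>2 * ?n\<^sup>2 \<le> block_energy V c a"
      then obtain c where c: "\<And>x. c x < 4 ^ J" "real J * \<epsilon>\<^sup>2 * ?n\<^sup>2 \<le> block_energy V c a" by blast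
      have "block_energy V c a \<le> (\<Sum>x\<in>V. \<Sum>y\<in>V. 1)"
        unfolding block_energy_def
        using block_mean_bounds[OF V, of a] a by (intro sum_mono) (auto simp: power_le_one)
      also have "\<dots> = ?n\<^sup>2" by (simp add: power2_eq_square)
      finally have "(real J * \<epsilon>\<^sup>2) * ?n\<^sup>2 \<le> 1 * ?n\<^sup>2" using c by simp
      moreover have "1 < real J * \<epsilon>\<^sup>2" using J \<epsilon> by (simp add: field_simps)
      ultimately have "\<not> 0 < ?n\<^sup>2" by (meson mult_right_le_imp_le not_le)
      then have "?n = 0" by simp
      then have "V = {}" using V by simp
      then show ?thesis using c(1) by (intro exI[of _ c]) (auto simp: cut_close_def)
    qed auto
  qed
qed

section \<open>Counting copies in a template\<close>

text \<open>
  Redrawing one coordinate of a uniformly random tuple leaves it uniform: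
  \<open>(z, y) \<mapsto> (z(a := y), z a)\<close> is an involution.
\<close>

lemma resample:
  fixes g :: "('a \<Rightarrow> 'b) \<Rightarrow> real"
  assumes a: "a \<in> I"
  shows "(\<Sum>z\<in>I \<rightarrow>\<^sub>E V. \<Sum>y\<in>V. g (z(a := y))) = real (card V) * (\<Sum>z\<in>I \<rightarrow>\<^sub>E V. g z)"
proof -
  have "(\<Sum>z\<in>I \<rightarrow>\<^sub>E V. \<Sum>y\<in>V. g (z(a := y))) = (\<Sum>(z, y)\<in>(I \<rightarrow>\<^sub>E V) \<times> V. g (z(a := y)))"
    by (simp add: sum.cartesian_product)
  also have "\<dots> = (\<Sum>(z, y)\<in>(I \<rightarrow>\<^sub>E V) \<times> V. g z)"
    by (rule sum.reindex_bij_witness[where i = "\<lambda>(z, y). (z(a := y), z a)" and j = "\<lambda>(z, y). (z(a := y), z a)"])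
       (use a in \<open>auto simp: PiE_iff extensional_def\<close>)
  also have "\<dots> = (\<Sum>z\<in>I \<rightarrow>\<^sub>E V. \<Sum>y\<in>V. g z)" by (simp only: sum.cartesian_product)
  finally show ?thesis by (simp add: sum_distrib_left)
qed

lemma resample_two:
  fixes g :: "('a \<Rightarrow> 'b) \<Rightarrow> real"
  assumes "a \<in> I" "b \<in> I"
  shows "(\<Sum>z\<in>I \<rightarrow>\<^sub>E V. \<Sum>y\<in>V. \<Sum>y'\<in>V. g (z(a := y, b := y'))) = (real (card V))\<^sup>2 * (\<Sum>z\<in>I \<rightarrow>\<^sub>E V. g z)"
proof -
  have "(\<Sum>z\<in>I \<rightarrow>\<^sub>E V. \<Sum>y\<in>V. \<Sum>y'\<in>V. g (z(a := y, b := y'))) =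
     real (card V) * (\<Sum>z\<in>I \<rightarrow>\<^sub>E V. \<Sum>y'\<in>V. g (z(b := y')))"
    by (rule resample[OF assms(1), where g = "\<lambda>z. \<Sum>y'\<in>V. g (z(b := y'))"])
  also have "\<dots> = real (card V) * (real (card V) * (\<Sum>z\<in>I \<rightarrow>\<^sub>E V. g z))"
    by (simp only: resample[OF assms(2)])
  finally show ?thesis by (simp only: power2_eq_square mult.assoc)
qed

lemma sum_le_positive_part:
  fixes u c :: "nat \<Rightarrow> real"
  assumes V: "finite V" and u: "\<And>y. y \<in> V \<Longrightarrow> u y \<in> {0..1}"
  shows "\<exists>S\<subseteq>V. (\<Sum>y\<in>V. u y * c y) \<le> (\<Sum>y\<in>S. c y)"
proof (intro exI[of _ "{y \<in> V. c y > 0}"] conjI)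
  have "(\<Sum>y\<in>V. u y * c y) \<le> (\<Sum>y\<in>V. if c y > 0 then c y else 0)"
  proof (rule sum_mono)
    fix y assume "y \<in> V"
    then show "u y * c y \<le> (if c y > 0 then c y else 0)"
      using u[of y] by (auto simp: mult_left_le_one_le mult_nonneg_nonpos)
  qed
  also have "\<dots> = (\<Sum>y\<in>{y \<in> V. c y > 0}. c y)" using V by (simp add: sum.inter_filter)
  finally show "(\<Sum>y\<in>V. u y * c y) \<le> (\<Sum>y\<in>{y \<in> V. c y > 0}. c y)" .
qed auto

text \<open>
  A bilinear form on the unit cube is maximal at a vertex of the cube, that is, at a pair of
  indicators.
\<close>

lemma bilinear_le_rectangle:
  fixes u v :: "nat \<Rightarrow> real" and d :: "nat \<Rightarrow> nat \<Rightarrow> real"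
  assumes V: "finite V" and u: "\<And>y. y \<in> V \<Longrightarrow> u y \<in> {0..1}" and v: "\<And>y. y \<in> V \<Longrightarrow> v y \<in> {0..1}"
    and rect: "\<And>S T. S \<subseteq> V \<Longrightarrow> T \<subseteq> V \<Longrightarrow> (\<Sum>x\<in>S. \<Sum>y\<in>T. d x y) \<le> B"
  shows "(\<Sum>x\<in>V. \<Sum>y\<in>V. d x y * (u x * v y)) \<le> B"
proof -
  have "\<exists>S\<subseteq>V. (\<Sum>x\<in>V. u x * (\<Sum>y\<in>V. d x y * v y)) \<le> (\<Sum>x\<in>S. \<Sum>y\<in>V. d x y * v y)"
    by (rule sum_le_positive_part[OF V]) (rule u)
  then obtain S where S: "S \<subseteq> V" "(\<Sum>x\<in>V. u x * (\<Sum>y\<in>V. d x y * v y)) \<le> (\<Sum>x\<in>S. \<Sum>y\<in>V. d x y * v y)"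
    by blast
  have "\<exists>T\<subseteq>V. (\<Sum>y\<in>V. v y * (\<Sum>x\<in>S. d x y)) \<le> (\<Sum>y\<in>T. \<Sum>x\<in>S. d x y)"
    by (rule sum_le_positive_part[OF V]) (rule v)
  then obtain T where T: "T \<subseteq> V" "(\<Sum>y\<in>V. v y * (\<Sum>x\<in>S. d x y)) \<le> (\<Sum>y\<in>T. \<Sum>x\<in>S. d x y)"
    by blast
  have "(\<Sum>x\<in>V. \<Sum>y\<in>V. d x y * (u x * v y)) = (\<Sum>x\<in>V. u x * (\<Sum>y\<in>V. d x y * v y))"
    by (simp add: sum_distrib_left mult_ac)
  also have "\<dots> \<le> (\<Sum>x\<in>S. \<Sum>y\<in>V. d x y * v y)" by (rule S)
  also have "\<dots> = (\<Sum>y\<in>V. v y * (\<Sum>x\<in>S. d x y))"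
    by (subst sum.swap) (simp add: sum_distrib_left mult_ac)
  also have "\<dots> \<le> (\<Sum>y\<in>T. \<Sum>x\<in>S. d x y)" by (rule T)
  also have "\<dots> = (\<Sum>x\<in>S. \<Sum>y\<in>T. d x y)" by (rule sum.swap)
  also have "\<dots> \<le> B" by (rule rect[OF S(1) T(1)])
  finally show ?thesis .
qed

lemma cut_close_bilinear:
  fixes u v :: "nat \<Rightarrow> real"
  assumes V: "finite V" and u: "\<And>y. y \<in> V \<Longrightarrow> u y \<in> {0..1}" and v: "\<And>y. y \<in> V \<Longrightarrow> v y \<in> {0..1}"
    and cc: "cut_close V \<epsilon> a b"
  shows "\<bar>\<Sum>x\<in>V. \<Sum>y\<in>V. (a x y - b x y) * (u x * v y)\<bar> \<le> \<epsilon> * (real (card V))\<^sup>2"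
proof -
  let ?B = "\<epsilon> * (real (card V))\<^sup>2"
  have 1: "(\<Sum>x\<in>S. \<Sum>y\<in>T. a x y - b x y) \<le> ?B" "(\<Sum>x\<in>S. \<Sum>y\<in>T. b x y - a x y) \<le> ?B"
    if "S \<subseteq> V" "T \<subseteq> V" for S T
  proof -
    have "\<bar>\<Sum>x\<in>S. \<Sum>y\<in>T. a x y - b x y\<bar> \<le> ?B" using cc that by (simp add: cut_close_def)
    moreover have "(\<Sum>x\<in>S. \<Sum>y\<in>T. b x y - a x y) = - (\<Sum>x\<in>S. \<Sum>y\<in>T. a x y - b x y)"
      by (simp add: sum_negf[symmetric])
    ultimately show "(\<Sum>x\<in>S. \<Sum>y\<in>T. a x y - b x y) \<le> ?B" "(\<Sum>x\<in>S. \<Sum>y\<in>T. b x y - a x y) \<le> ?B"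
      by linarith+
  qed
  have "(\<Sum>x\<in>V. \<Sum>y\<in>V. (a x y - b x y) * (u x * v y)) \<le> ?B"
    by (rule bilinear_le_rectangle[OF V u v 1(1)])
  moreover have "(\<Sum>x\<in>V. \<Sum>y\<in>V. (b x y - a x y) * (u x * v y)) \<le> ?B"
    by (rule bilinear_le_rectangle[OF V u v 1(2)])
  moreover have "(\<Sum>x\<in>V. \<Sum>y\<in>V. (b x y - a x y) * (u x * v y)) = - (\<Sum>x\<in>V. \<Sum>y\<in>V. (a x y - b x y) * (u x * v y))"
    unfolding sum_negf[symmetric] by (intro sum.cong refl) (simp add: algebra_simps)
  ultimately show ?thesis by linarith
qed

text \<open>
  Redraw the two coordinates used by the exchanged pair. No remaining factor depends on both of
  them, because \<open>\<sigma>\<close> is injective and the pairs are increasing. Hence the product of the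
  remaining factors splits into a function of one coordinate times a function of the other, and
  closeness in cut norm applies.
\<close>

lemma swap_one_factor:
  fixes W :: "nat \<times> nat \<Rightarrow> nat \<Rightarrow> nat \<Rightarrow> real"
  assumes V: "finite V" and I: "finite I" and \<sigma>: "\<sigma> ` U \<subseteq> I" "inj_on \<sigma> U"
    and R: "finite R" "R \<subseteq> {(u, v). u \<in> U \<and> v \<in> U \<and> u < v}" "(u0, v0) \<notin> R"
    and uv: "u0 \<in> U" "v0 \<in> U" "u0 < v0"
    and W: "\<And>e x y. e \<in> R \<Longrightarrow> x \<in> V \<Longrightarrow> y \<in> V \<Longrightarrow> W e x y \<in> {0..1}"
    and cc: "cut_close V \<epsilon> d d'" and \<epsilon>: "\<epsilon> \<ge> 0"
  shows "\<bar>\<Sum>z\<in>I \<rightarrow>\<^sub>E V. (d (z (\<sigma> u0)) (z (\<sigma> v0)) - d' (z (\<sigma> u0)) (z (\<sigma> v0))) *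
            (\<Prod>e\<in>R. W e (z (\<sigma> (fst e))) (z (\<sigma> (snd e))))\<bar> \<le> \<epsilon> * real (card V) ^ card I"
proof (cases "V = {}")
  case True
  have "I \<noteq> {}" using \<sigma> uv by auto
  then have "I \<rightarrow>\<^sub>E V = {}" using True by (auto simp: PiE_eq_empty_iff)
  then show ?thesis using \<epsilon> by simp
next
  case False
  let ?n = "real (card V)"
  have n: "?n > 0" using False V by (simp add: card_gt_0_iff)
  define a where "a = \<sigma> u0"
  define b where "b = \<sigma> v0"
  have aI: "a \<in> I" and bI: "b \<in> I" using \<sigma> uv by (auto simp: a_def b_def)
  have ab: "a \<noteq> b" using \<sigma> uv unfolding a_def b_def by (metis inj_onD less_irrefl)
  define g where "g z = (d (z a) (z b) - d' (z a) (z b)) * (\<Prod>e\<in>R. W e (z (\<sigma> (fst e))) (z (\<sigma> (snd e))))" for z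
  define A where "A = {e \<in> R. fst e = u0 \<or> snd e = u0}"
  have RA: "R = A \<union> (R - A)" "finite A" "A \<subseteq> R" using R(1) by (auto simp: A_def)
  have inner: "\<bar>\<Sum>y\<in>V. \<Sum>y'\<in>V. g (z(a := y, b := y'))\<bar> \<le> \<epsilon> * ?n\<^sup>2" if z: "z \<in> I \<rightarrow>\<^sub>E V" for z
  proof -
    define u where "u y = (\<Prod>e\<in>A. W e ((z(a := y)) (\<sigma> (fst e))) ((z(a := y)) (\<sigma> (snd e))))" for y
    define v where "v y = (\<Prod>e\<in>R - A. W e ((z(b := y)) (\<sigma> (fst e))) ((z(b := y)) (\<sigma> (snd e))))" for y
    have eU: "fst e \<in> U" "snd e \<in> U" "fst e < snd e" if "e \<in> R" for e using R(2) that by auto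
    have zV: "(z(k := y)) (\<sigma> x) \<in> V" if "y \<in> V" "x \<in> U" for k y x
    proof -
      have "z (\<sigma> x) \<in> V" using PiE_mem[OF z, of "\<sigma> x"] \<sigma>(1) that(2) by blast
      then show ?thesis using that(1) by simp
    qed
    have u: "u y \<in> {0..1}" if "y \<in> V" for y
    proof -
      have "W e ((z(a := y)) (\<sigma> (fst e))) ((z(a := y)) (\<sigma> (snd e))) \<in> {0..1}" if "e \<in> A" for e
      proof -
        have eR: "e \<in> R" using RA(3) that by blast
        show ?thesis by (rule W[OF eR zV[OF \<open>y \<in> V\<close> eU(1)[OF eR]] zV[OF \<open>y \<in> V\<close> eU(2)[OF eR]]])
      qed
      then show ?thesis unfolding u_def atLeastAtMost_iff by (intro conjI prod_nonneg prod_le_1) simp_all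
    qed
    have v: "v y \<in> {0..1}" if "y \<in> V" for y
    proof -
      have "W e ((z(b := y)) (\<sigma> (fst e))) ((z(b := y)) (\<sigma> (snd e))) \<in> {0..1}" if "e \<in> R - A" for e
      proof -
        have eR: "e \<in> R" using that by blast
        show ?thesis by (rule W[OF eR zV[OF \<open>y \<in> V\<close> eU(1)[OF eR]] zV[OF \<open>y \<in> V\<close> eU(2)[OF eR]]])
      qed
      then show ?thesis unfolding v_def atLeastAtMost_iff by (intro conjI prod_nonneg prod_le_1) simp_all
    qed
    have sa: "\<sigma> x = a \<longleftrightarrow> x = u0" and sb: "\<sigma> x = b \<longleftrightarrow> x = v0" if "x \<in> U" for x
      unfolding a_def b_def by (rule inj_on_eq_iff[OF \<sigma>(2) that uv(1)], rule inj_on_eq_iff[OF \<sigma>(2) that uv(2)])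
    have "g (z(a := y, b := y')) = (d y y' - d' y y') * (u y * v y')" for y y'
    proof -
      let ?z = "z(a := y, b := y')"
      have "(\<Prod>e\<in>A. W e (?z (\<sigma> (fst e))) (?z (\<sigma> (snd e)))) = u y"
        unfolding u_def
      proof (rule prod.cong[OF refl])
        fix e assume e: "e \<in> A"
        then have eR: "e \<in> R" using RA by blast
        have "fst e \<noteq> v0 \<and> snd e \<noteq> v0"
        proof (intro conjI notI)
          assume "fst e = v0"
          then show False using e eU(3)[OF eR] uv(3) unfolding A_def by simp
        next
          assume v: "snd e = v0"
          then have "fst e = u0" using e uv(3) unfolding A_def by simp
          then have "e = (u0, v0)" using v by (metis prod.collapse)
          then show False using R(3) eR by simp
        qed
        then show "W e (?z (\<sigma> (fst e))) (?z (\<sigma> (snd e))) =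
            W e ((z(a := y)) (\<sigma> (fst e))) ((z(a := y)) (\<sigma> (snd e)))"
          using sb[OF eU(1)[OF eR]] sb[OF eU(2)[OF eR]] by simp
      qed
      moreover have "(\<Prod>e\<in>R - A. W e (?z (\<sigma> (fst e))) (?z (\<sigma> (snd e)))) = v y'"
        unfolding v_def
      proof (rule prod.cong[OF refl])
        fix e assume e: "e \<in> R - A"
        then have eR: "e \<in> R" by blast
        have "fst e \<noteq> u0 \<and> snd e \<noteq> u0" using e unfolding A_def by blast
        then show "W e (?z (\<sigma> (fst e))) (?z (\<sigma> (snd e))) =
            W e ((z(b := y')) (\<sigma> (fst e))) ((z(b := y')) (\<sigma> (snd e)))"
          using sa[OF eU(1)[OF eR]] sa[OF eU(2)[OF eR]] by simp
      qed
      moreover have "(\<Prod>e\<in>R. W e (?z (\<sigma> (fst e))) (?z (\<sigma> (snd e)))) =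
         (\<Prod>e\<in>A. W e (?z (\<sigma> (fst e))) (?z (\<sigma> (snd e)))) * (\<Prod>e\<in>R - A. W e (?z (\<sigma> (fst e))) (?z (\<sigma> (snd e))))"
        using prod.subset_diff[OF RA(3) R(1)] by (simp add: mult.commute)
      moreover have "?z a = y" "?z b = y'" using ab by auto
      ultimately show ?thesis unfolding g_def by simp
    qed
    then show ?thesis using cut_close_bilinear[OF V u v cc] by simp
  qed
  have "?n\<^sup>2 * \<bar>\<Sum>z\<in>I \<rightarrow>\<^sub>E V. g z\<bar> = \<bar>\<Sum>z\<in>I \<rightarrow>\<^sub>E V. \<Sum>y\<in>V. \<Sum>y'\<in>V. g (z(a := y, b := y'))\<bar>"
  proof -
    have "(\<Sum>z\<in>I \<rightarrow>\<^sub>E V. \<Sum>y\<in>V. \<Sum>y'\<in>V. g (z(a := y, b := y'))) = ?n\<^sup>2 * (\<Sum>z\<in>I \<rightarrow>\<^sub>E V. g z)"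
      by (rule resample_two[OF aI bI])
    then show ?thesis by (simp only: abs_mult abs_power2)
  qed
  also have "\<dots> \<le> (\<Sum>z\<in>I \<rightarrow>\<^sub>E V. \<epsilon> * ?n\<^sup>2)"
    by (rule order_trans[OF sum_abs sum_mono[OF inner]])
  also have "\<dots> = ?n\<^sup>2 * (\<epsilon> * ?n ^ card I)" using I by (simp add: card_PiE mult_ac)
  finally have "\<bar>\<Sum>z\<in>I \<rightarrow>\<^sub>E V. g z\<bar> \<le> \<epsilon> * ?n ^ card I" using n by simp
  then show ?thesis unfolding g_def a_def b_def .
qed

text \<open>
  The factors are exchanged one by one, each at the price \<open>\<epsilon>\<close>.
\<close>

lemma counting_lemma:
  fixes w w' :: "nat \<times> nat \<Rightarrow> nat \<Rightarrow> nat \<Rightarrow> real"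
  assumes V: "finite V" and I: "finite I" and \<sigma>: "\<sigma> ` U \<subseteq> I" "inj_on \<sigma> U"
    and P: "finite P" "P \<subseteq> {(u, v). u \<in> U \<and> v \<in> U \<and> u < v}"
    and w: "\<And>e x y. e \<in> P \<Longrightarrow> x \<in> V \<Longrightarrow> y \<in> V \<Longrightarrow> w e x y \<in> {0..1}"
    and w': "\<And>e x y. e \<in> P \<Longrightarrow> x \<in> V \<Longrightarrow> y \<in> V \<Longrightarrow> w' e x y \<in> {0..1}"
    and cc: "\<And>e. e \<in> P \<Longrightarrow> cut_close V \<epsilon> (w e) (w' e)" and \<epsilon>: "\<epsilon> \<ge> 0"
  shows "\<bar>(\<Sum>z\<in>I \<rightarrow>\<^sub>E V. \<Prod>e\<in>P. w e (z (\<sigma> (fst e))) (z (\<sigma> (snd e)))) -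
          (\<Sum>z\<in>I \<rightarrow>\<^sub>E V. \<Prod>e\<in>P. w' e (z (\<sigma> (fst e))) (z (\<sigma> (snd e))))\<bar>
        \<le> real (card P) * \<epsilon> * real (card V) ^ card I"
proof -
  define X where "X Q = (\<Sum>z\<in>I \<rightarrow>\<^sub>E V. \<Prod>e\<in>P. (if e \<in> Q then w' else w) e (z (\<sigma> (fst e))) (z (\<sigma> (snd e))))" for Q
  have "\<bar>X {} - X Q\<bar> \<le> real (card Q) * \<epsilon> * real (card V) ^ card I" if "Q \<subseteq> P" for Q
  proof -
    have "finite Q" using that P(1) finite_subset by blast
    then show ?thesis using that
    proof (induction Q rule: finite_induct)
      case empty
      then show ?case by simp
    next
      case (insert e Q)
      obtain u0 v0 where e: "e = (u0, v0)" by (cases e)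
      define W where "W e' = (if e' \<in> Q then w' else w) e'" for e'
      have step: "X Q - X (insert e Q) = (\<Sum>z\<in>I \<rightarrow>\<^sub>E V. (w e (z (\<sigma> u0)) (z (\<sigma> v0)) - w' e (z (\<sigma> u0)) (z (\<sigma> v0))) *
            (\<Prod>e'\<in>P - {e}. W e' (z (\<sigma> (fst e'))) (z (\<sigma> (snd e')))))"
        unfolding X_def sum_subtractf[symmetric]
      proof (rule sum.cong[OF refl])
        fix z
        have eP: "e \<in> P" using insert.prems by simp
        have r: "prod g P = g e * prod g (P - {e})" for g :: "nat \<times> nat \<Rightarrow> real"
          by (rule prod.remove[OF P(1) eP])
        have "(\<Prod>e'\<in>P - {e}. (if e' \<in> insert e Q then w' else w) e' (z (\<sigma> (fst e'))) (z (\<sigma> (snd e')))) =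
          (\<Prod>e'\<in>P - {e}. W e' (z (\<sigma> (fst e'))) (z (\<sigma> (snd e'))))"
          unfolding W_def by (intro prod.cong) auto
        moreover have "(\<Prod>e'\<in>P - {e}. (if e' \<in> Q then w' else w) e' (z (\<sigma> (fst e'))) (z (\<sigma> (snd e')))) =
          (\<Prod>e'\<in>P - {e}. W e' (z (\<sigma> (fst e'))) (z (\<sigma> (snd e'))))"
          unfolding W_def by (intro prod.cong) auto
        ultimately show "(\<Prod>e'\<in>P. (if e' \<in> Q then w' else w) e' (z (\<sigma> (fst e'))) (z (\<sigma> (snd e')))) -
           (\<Prod>e'\<in>P. (if e' \<in> insert e Q then w' else w) e' (z (\<sigma> (fst e'))) (z (\<sigma> (snd e')))) =
           (w e (z (\<sigma> u0)) (z (\<sigma> v0)) - w' e (z (\<sigma> u0)) (z (\<sigma> v0))) *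
            (\<Prod>e'\<in>P - {e}. W e' (z (\<sigma> (fst e'))) (z (\<sigma> (snd e'))))"
          using r[of "\<lambda>e'. (if e' \<in> Q then w' else w) e' (z (\<sigma> (fst e'))) (z (\<sigma> (snd e')))"]
            r[of "\<lambda>e'. (if e' \<in> insert e Q then w' else w) e' (z (\<sigma> (fst e'))) (z (\<sigma> (snd e')))"]
            insert.hyps(2) by (simp only: insertI1 if_True if_False not_False_eq_True left_diff_distrib if_not_P[OF insert.hyps(2)]) (simp add: e)
      qed
      have uv: "u0 \<in> U" "v0 \<in> U" "u0 < v0" using P(2) insert.prems e by auto
      have "\<bar>X Q - X (insert e Q)\<bar> \<le> \<epsilon> * real (card V) ^ card I"
        unfolding step
        by (rule swap_one_factor[OF V I \<sigma> _ _ _ uv _ cc \<epsilon>])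
           (use P e insert.prems w w' in \<open>auto simp: W_def\<close>)
      moreover have "\<bar>X {} - X Q\<bar> \<le> real (card Q) * \<epsilon> * real (card V) ^ card I"
        using insert by simp
      ultimately show ?case using insert.hyps by (simp add: algebra_simps)
    qed
  qed
  from this[of P] show ?thesis by (simp add: X_def cong: prod.cong)
qed

definition threshold :: "real \<Rightarrow> real \<Rightarrow> colour" where
  "threshold \<eta> r = (if r < \<eta> then White else if r > 1 - \<eta> then Black else Gray)"

definition adj :: "graph \<Rightarrow> nat \<Rightarrow> nat \<Rightarrow> real" where
  "adj G x y = of_bool ({x, y} \<in> edges G)"

text \<open>
  Templates have no vertex colours. Hence the map has to be injective, in contrast to \<open>embeds\<close>,
  where several vertices of \<open>F\<close> may share an image if its colour permits.
\<close>

definition has_copy :: "graph \<Rightarrow> nat set \<Rightarrow> (nat \<Rightarrow> nat \<Rightarrow> colour) \<Rightarrow> (nat \<Rightarrow> nat) \<Rightarrow> bool" where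
  "has_copy F I \<tau> \<sigma> \<longleftrightarrow> \<sigma> ` verts F \<subseteq> I \<and> inj_on \<sigma> (verts F) \<and>
     (\<forall>u\<in>verts F. \<forall>v\<in>verts F. u < v \<longrightarrow> fits (\<tau> (\<sigma> u) (\<sigma> v)) ({u, v} \<in> edges F))"

definition template_cost :: "real \<Rightarrow> nat \<Rightarrow> (nat \<Rightarrow> nat \<Rightarrow> colour) \<Rightarrow> real" where
  "template_cost p m \<tau> = (\<Sum>i<m. \<Sum>j\<in>{..<m} - {i}. cost p (\<tau> i j))"

lemma induced_copy:
  assumes F: "is_graph F" and H: "is_graph H"
    and f: "f ` verts F \<subseteq> verts H" "inj_on f (verts F)"
    and e: "\<And>u v. u \<in> verts F \<Longrightarrow> v \<in> verts F \<Longrightarrow> u < v \<Longrightarrow> {f u, f v} \<in> edges H \<longleftrightarrow> {u, v} \<in> edges F"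
  shows "contains_induced H F"
  unfolding contains_induced_def
proof (intro exI[of _ "f ` verts F"] conjI)
  have e': "{f u, f v} \<in> edges H \<longleftrightarrow> {u, v} \<in> edges F" if "u \<in> verts F" "v \<in> verts F" "u \<noteq> v" for u v
    using e[of u v] e[of v u] that by (cases "u < v") (auto simp: insert_commute)
  show "graph_iso F (induced H (f ` verts F))"
    unfolding graph_iso_def induced_def graph.simps
  proof (intro exI[of _ f] conjI)
    show "bij_betw f (verts F) (f ` verts F)" using f(2) by (simp add: bij_betw_def)
    show "{e \<in> edges H. e \<subseteq> f ` verts F} = (`) f ` edges F"
    proof (intro equalityI subsetI)
      fix a assume a: "a \<in> {e \<in> edges H. e \<subseteq> f ` verts F}"
      then obtain x y where xy: "a = {x, y}" "x \<noteq> y" using H by (auto simp: is_graph_def all_pairs_def)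
      then obtain u v where uv: "u \<in> verts F" "v \<in> verts F" "x = f u" "y = f v" using a by auto
      then have "u \<noteq> v" using xy by auto
      then have "{u, v} \<in> edges F" using e'[OF uv(1,2)] a xy uv by simp
      then show "a \<in> (`) f ` edges F" using xy uv by (intro image_eqI[of _ _ "{u, v}"]) auto
    next
      fix a assume "a \<in> (`) f ` edges F"
      then obtain b where b: "b \<in> edges F" "a = f ` b" by blast
      then obtain u v where uv: "b = {u, v}" "u \<in> verts F" "v \<in> verts F" "u \<noteq> v"
        using F by (auto simp: is_graph_def all_pairs_def)
      then show "a \<in> {e \<in> edges H. e \<subseteq> f ` verts F}" using e'[OF uv(2-4)] b by simp
    qed
  qed
qed (use f in auto)

lemma sum_coincidence:
  assumes V: "finite V" and I: "finite I" and ab: "a \<in> I" "b \<in> I" "a \<noteq> b" and V0: "V \<noteq> {}"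
  shows "(\<Sum>z\<in>I \<rightarrow>\<^sub>E V. of_bool (z a = z b)) = real (card V) ^ card I / real (card V)"
proof -
  have n: "real (card V) > 0" using V V0 by (simp add: card_gt_0_iff)
  have "real (card V) * (\<Sum>z\<in>I \<rightarrow>\<^sub>E V. of_bool (z a = z b)) =
      (\<Sum>z\<in>I \<rightarrow>\<^sub>E V. \<Sum>y\<in>V. of_bool ((z(a := y)) a = (z(a := y)) b))"
    by (rule resample[OF ab(1), symmetric])
  also have "\<dots> = (\<Sum>z\<in>I \<rightarrow>\<^sub>E V. \<Sum>y\<in>V. of_bool (y = z b))"
    using ab(3) by simp
  also have "\<dots> = (\<Sum>z\<in>I \<rightarrow>\<^sub>E V. 1)"
  proof (rule sum.cong[OF refl])
    fix z assume "z \<in> I \<rightarrow>\<^sub>E V"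
    then have "z b \<in> V" using ab by (auto simp: PiE_iff)
    then show "(\<Sum>y\<in>V. of_bool (y = z b)) = (1 :: real)" using V by (simp add: of_bool_def)
  qed
  also have "\<dots> = real (card V) ^ card I" using I by (simp add: card_PiE)
  finally show ?thesis using n by (simp add: field_simps)
qed

text \<open>
  The product over all pairs of \<open>F\<close> of \<open>a\<close> or \<open>1 - a\<close>, \<open>a\<close> the adjacency of \<open>H\<close>, vanishes on
  injective tuples, since \<open>H\<close> has no induced \<open>F\<close>; tuples with a repetition are a fraction
  \<open>O(1/n)\<close>. With \<open>h\<close> in place of \<open>a\<close> the average changes little, while each copy of \<open>F\<close> in the
  template contributes at least \<open>\<eta>\<close> per factor.
\<close>

lemma few_template_copies:
  assumes F: "is_graph F" and H: "H \<in> Forb F" "verts H = V" and V0: "V \<noteq> {}" and I: "finite I"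
    and h: "\<And>x y. x \<in> V \<Longrightarrow> y \<in> V \<Longrightarrow> h x y \<in> {0..1}"
    and cc: "cut_close V \<epsilon> (adj H) h" and \<epsilon>: "\<epsilon> \<ge> 0" and \<eta>: "0 < \<eta>" "\<eta> \<le> 1/2"
    and \<sigma>: "\<sigma> ` verts F \<subseteq> I" "inj_on \<sigma> (verts F)"
  shows "(\<Sum>z\<in>I \<rightarrow>\<^sub>E V. of_bool (has_copy F I (\<lambda>i j. threshold \<eta> (h (z i) (z j))) \<sigma>)) \<le>
     (real (card (verts F)))\<^sup>2 * (1 / real (card V) + \<epsilon>) / \<eta> ^ ((card (verts F))\<^sup>2) * real (card V) ^ card I"
proof -
  define U where "U = verts F"
  define P where "P = {(u, v). u \<in> U \<and> v \<in> U \<and> u < v}"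
  let ?n = "real (card V)"
  have fU: "finite U" using F by (simp add: U_def is_graph_def)
  have PU: "P \<subseteq> U \<times> U" by (auto simp: P_def)
  have fP: "finite P" using PU fU by (meson finite_SigmaI finite_subset)
  have cP: "card P \<le> (card U)\<^sup>2" using card_mono[OF _ PU] fU by (simp add: card_cartesian_product power2_eq_square)
  have HG: "is_graph H" "\<not> contains_induced H F" using H(1) by (auto simp: Forb_def)
  have V: "finite V" using HG(1) H(2) by (auto simp: is_graph_def)
  have n: "?n > 0" using V V0 by (simp add: card_gt_0_iff)
  define w where "w e x y = (if {fst e, snd e} \<in> edges F then adj H x y else 1 - adj H x y)" for e x y
  define w' where "w' e x y = (if {fst e, snd e} \<in> edges F then h x y else 1 - h x y)" for e x y
  have w: "w e x y \<in> {0..1}" for e x y by (simp add: w_def adj_def)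
  have w': "w' e x y \<in> {0..1}" if "x \<in> V" "y \<in> V" for e x y using h[OF that] by (simp add: w'_def)
  have ccw: "cut_close V \<epsilon> (w e) (w' e)" for e
  proof (cases "{fst e, snd e} \<in> edges F")
    case True
    then show ?thesis using cc by (simp add: cut_close_def w_def w'_def)
  next
    case False
    have "(\<Sum>x\<in>S. \<Sum>y\<in>T. w e x y - w' e x y) = - (\<Sum>x\<in>S. \<Sum>y\<in>T. adj H x y - h x y)" for S T
      using False by (simp add: w_def w'_def sum_negf[symmetric])
    then show ?thesis using cc by (simp add: cut_close_def)
  qed
  have \<sigma>I: "\<sigma> u \<in> I" if "u \<in> U" for u using \<sigma> that by (auto simp: U_def)
  have "(\<Sum>z\<in>I \<rightarrow>\<^sub>E V. \<Prod>e\<in>P. w e (z (\<sigma> (fst e))) (z (\<sigma> (snd e)))) \<le>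
     (\<Sum>z\<in>I \<rightarrow>\<^sub>E V. \<Sum>e\<in>P. of_bool (z (\<sigma> (fst e)) = z (\<sigma> (snd e))))"
  proof (rule sum_mono)
    fix z assume z: "z \<in> I \<rightarrow>\<^sub>E V"
    have zV: "z (\<sigma> u) \<in> V" if "u \<in> U" for u using z \<sigma>I[OF that] by (auto simp: PiE_iff)
    show "(\<Prod>e\<in>P. w e (z (\<sigma> (fst e))) (z (\<sigma> (snd e)))) \<le> (\<Sum>e\<in>P. of_bool (z (\<sigma> (fst e)) = z (\<sigma> (snd e))))"
    proof (cases "\<exists>e\<in>P. z (\<sigma> (fst e)) = z (\<sigma> (snd e))")
      case True
      then obtain e where e: "e \<in> P" "z (\<sigma> (fst e)) = z (\<sigma> (snd e))" by blast
      have "(\<Prod>e\<in>P. w e (z (\<sigma> (fst e))) (z (\<sigma> (snd e)))) \<le> 1" using w by (intro prod_le_1) auto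
      also have "1 = (of_bool (z (\<sigma> (fst e)) = z (\<sigma> (snd e))) :: real)" using e by simp
      also have "\<dots> \<le> (\<Sum>e\<in>P. of_bool (z (\<sigma> (fst e)) = z (\<sigma> (snd e))))"
        by (rule member_le_sum[OF e(1) _ fP]) simp
      finally show ?thesis .
    next
      case False
      have inj: "inj_on (z \<circ> \<sigma>) U"
      proof (rule linorder_inj_onI)
        fix u v assume "u < v" "u \<in> U" "v \<in> U"
        then have "(u, v) \<in> P" by (simp add: P_def)
        then show "(z \<circ> \<sigma>) u \<noteq> (z \<circ> \<sigma>) v" using False by force
      qed auto
      have "(\<Prod>e\<in>P. w e (z (\<sigma> (fst e))) (z (\<sigma> (snd e)))) = 0"
      proof (rule ccontr)
        assume nz: "(\<Prod>e\<in>P. w e (z (\<sigma> (fst e))) (z (\<sigma> (snd e)))) \<noteq> 0"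
        have "contains_induced H F"
        proof (rule induced_copy[OF F HG(1)])
          show "(z \<circ> \<sigma>) ` verts F \<subseteq> verts H" using zV H(2) by (auto simp: U_def)
          show "inj_on (z \<circ> \<sigma>) (verts F)" using inj by (simp add: U_def)
          fix u v assume "u \<in> verts F" "v \<in> verts F" "u < v"
          then have "(u, v) \<in> P" by (simp add: P_def U_def)
          then have "w (u, v) (z (\<sigma> u)) (z (\<sigma> v)) \<noteq> 0" using nz fP by (force simp: prod_zero_iff)
          then show "{(z \<circ> \<sigma>) u, (z \<circ> \<sigma>) v} \<in> edges H \<longleftrightarrow> {u, v} \<in> edges F"
            by (auto simp: w_def adj_def split: if_splits)
        qed
        with HG(2) show False ..
      qed
      then show ?thesis by (simp add: sum_nonneg)
    qed
  qed
  also have "\<dots> = (\<Sum>e\<in>P. \<Sum>z\<in>I \<rightarrow>\<^sub>E V. of_bool (z (\<sigma> (fst e)) = z (\<sigma> (snd e))))" by (rule sum.swap)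
  also have "\<dots> = (\<Sum>e\<in>P. ?n ^ card I / ?n)"
  proof (rule sum.cong[OF refl])
    fix e assume "e \<in> P"
    then have e: "fst e \<in> U" "snd e \<in> U" "fst e \<noteq> snd e" by (auto simp: P_def)
    then have "\<sigma> (fst e) \<noteq> \<sigma> (snd e)" using \<sigma>(2) by (auto simp: U_def dest: inj_onD)
    then show "(\<Sum>z\<in>I \<rightarrow>\<^sub>E V. of_bool (z (\<sigma> (fst e)) = z (\<sigma> (snd e)))) = ?n ^ card I / ?n"
      using sum_coincidence[OF V I \<sigma>I \<sigma>I _ V0] e by simp
  qed
  finally have few: "(\<Sum>z\<in>I \<rightarrow>\<^sub>E V. \<Prod>e\<in>P. w e (z (\<sigma> (fst e))) (z (\<sigma> (snd e)))) \<le> real (card P) * (1 / ?n) * ?n ^ card I"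
    by simp
  have "\<bar>(\<Sum>z\<in>I \<rightarrow>\<^sub>E V. \<Prod>e\<in>P. w e (z (\<sigma> (fst e))) (z (\<sigma> (snd e)))) -
          (\<Sum>z\<in>I \<rightarrow>\<^sub>E V. \<Prod>e\<in>P. w' e (z (\<sigma> (fst e))) (z (\<sigma> (snd e))))\<bar> \<le> real (card P) * \<epsilon> * ?n ^ card I"
    by (rule counting_lemma[OF V I _ _ fP _ w w' ccw \<epsilon>, of \<sigma> U]) (use \<sigma> in \<open>auto simp: U_def P_def\<close>)
  with few have "(\<Sum>z\<in>I \<rightarrow>\<^sub>E V. \<Prod>e\<in>P. w' e (z (\<sigma> (fst e))) (z (\<sigma> (snd e)))) \<le> real (card P) * (1 / ?n + \<epsilon>) * ?n ^ card I"
    by (simp add: algebra_simps)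
  also have "\<dots> \<le> (real (card U))\<^sup>2 * (1 / ?n + \<epsilon>) * ?n ^ card I"
    using cP n \<epsilon> by (intro mult_right_mono) (auto simp flip: of_nat_power)
  finally have up: "(\<Sum>z\<in>I \<rightarrow>\<^sub>E V. \<Prod>e\<in>P. w' e (z (\<sigma> (fst e))) (z (\<sigma> (snd e)))) \<le> (real (card U))\<^sup>2 * (1 / ?n + \<epsilon>) * ?n ^ card I" .
  have "\<eta> ^ ((card U)\<^sup>2) * (\<Sum>z\<in>I \<rightarrow>\<^sub>E V. of_bool (has_copy F I (\<lambda>i j. threshold \<eta> (h (z i) (z j))) \<sigma>))
      \<le> (\<Sum>z\<in>I \<rightarrow>\<^sub>E V. \<Prod>e\<in>P. w' e (z (\<sigma> (fst e))) (z (\<sigma> (snd e))))"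
    unfolding sum_distrib_left
  proof (rule sum_mono)
    fix z assume z: "z \<in> I \<rightarrow>\<^sub>E V"
    have zV: "z (\<sigma> u) \<in> V" if "u \<in> U" for u using z \<sigma>I[OF that] by (auto simp: PiE_iff)
    show "\<eta> ^ ((card U)\<^sup>2) * of_bool (has_copy F I (\<lambda>i j. threshold \<eta> (h (z i) (z j))) \<sigma>)
      \<le> (\<Prod>e\<in>P. w' e (z (\<sigma> (fst e))) (z (\<sigma> (snd e))))"
    proof (cases "has_copy F I (\<lambda>i j. threshold \<eta> (h (z i) (z j))) \<sigma>")
      case True
      have "\<eta> ^ ((card U)\<^sup>2) \<le> \<eta> ^ card P" using cP \<eta> by (intro power_decreasing) auto
      also have "\<dots> = (\<Prod>e\<in>P. \<eta>)" by simp
      also have "\<dots> \<le> (\<Prod>e\<in>P. w' e (z (\<sigma> (fst e))) (z (\<sigma> (snd e))))"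
      proof (rule prod_mono)
        fix e assume "e \<in> P"
        then have "fst e \<in> verts F" "snd e \<in> verts F" "fst e < snd e" by (auto simp: P_def U_def)
        then have "fits (threshold \<eta> (h (z (\<sigma> (fst e))) (z (\<sigma> (snd e))))) ({fst e, snd e} \<in> edges F)"
          using True by (simp add: has_copy_def)
        then show "0 \<le> \<eta> \<and> \<eta> \<le> w' e (z (\<sigma> (fst e))) (z (\<sigma> (snd e)))"
          using \<eta> unfolding fits_def threshold_def w'_def by (auto split: if_splits)
      qed
      finally show ?thesis using True by simp
    next
      case False
      have "0 \<le> (\<Prod>e\<in>P. w' e (z (\<sigma> (fst e))) (z (\<sigma> (snd e))))"
      proof (rule prod_nonneg)
        fix e assume "e \<in> P"
        then show "0 \<le> w' e (z (\<sigma> (fst e))) (z (\<sigma> (snd e)))"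
          using w'[OF zV zV, of "fst e" "snd e" e] by (auto simp: P_def)
      qed
      then show ?thesis using False by simp
    qed
  qed
  with up have "\<eta> ^ ((card U)\<^sup>2) * (\<Sum>z\<in>I \<rightarrow>\<^sub>E V. of_bool (has_copy F I (\<lambda>i j. threshold \<eta> (h (z i) (z j))) \<sigma>))
     \<le> (real (card U))\<^sup>2 * (1 / ?n + \<epsilon>) * ?n ^ card I" by linarith
  then show ?thesis using \<eta> by (simp add: U_def field_simps)
qed

text \<open>
  A random \<open>m\<close>-tuple has the average cost of the template in expectation, and hardly any copies
  of \<open>F\<close>.
\<close>

lemma sample_template:
  assumes F: "is_graph F" and \<gamma>: "0 < \<gamma>" "\<gamma> < 1" and \<eta>: "0 < \<eta>" "\<eta> \<le> 1/2" and m: "m > 0"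
  shows "\<exists>\<epsilon>>0. \<exists>n0. \<forall>V H h p. H \<in> Forb F \<longrightarrow> verts H = V \<longrightarrow> card V \<ge> n0 \<longrightarrow>
     (\<forall>x\<in>V. \<forall>y\<in>V. h x y \<in> {0..1}) \<longrightarrow> cut_close V \<epsilon> (adj H) h \<longrightarrow> p \<in> {0..1} \<longrightarrow>
     (\<exists>z\<in>{..<m} \<rightarrow>\<^sub>E V.
        (\<forall>\<sigma>. \<not> has_copy F {..<m} (\<lambda>i j. threshold \<eta> (h (z i) (z j))) \<sigma>) \<and>
        template_cost p m (\<lambda>i j. threshold \<eta> (h (z i) (z j))) \<le>
          (real m)\<^sup>2 * ((\<Sum>x\<in>V. \<Sum>y\<in>V. cost p (threshold \<eta> (h x y))) / (real (card V))\<^sup>2 + \<gamma>))"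
proof -
  define f where "f = card (verts F)"
  define D where "D = 2 * real m ^ f * ((real f)\<^sup>2 + 1) / \<eta> ^ (f\<^sup>2)"
  have D: "D > 0" using m \<eta> by (simp add: D_def add_nonneg_pos)
  define \<epsilon> where "\<epsilon> = \<gamma> / (2 * D)"
  have \<epsilon>: "\<epsilon> > 0" using D \<gamma> by (simp add: \<epsilon>_def)
  obtain n0 :: nat where n0: "1 / \<epsilon> < real n0" using reals_Archimedean2 by blast
  have n0p: "n0 > 0" using n0 \<epsilon> by (metis divide_pos_pos gr0I less_asym of_nat_0 zero_less_one)
  show ?thesis
  proof (intro exI[of _ \<epsilon>] conjI exI[of _ n0] allI impI)
    fix V H h p
    assume H: "H \<in> Forb F" "verts H = V" and n: "card V \<ge> n0"
      and h: "\<forall>x\<in>V. \<forall>y\<in>V. h x y \<in> {0..1}" and cc: "cut_close V \<epsilon> (adj H) h" and p: "p \<in> {0..1::real}"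
    let ?n = "real (card V)" and ?I = "{..<m}"
    have V0: "V \<noteq> {}" and V: "finite V" using n n0p by (auto intro: card_ge_0_finite)
    have np: "?n > 0" using n n0p by simp
    have n1: "1 / ?n \<le> \<epsilon>"
    proof -
      have "1 / \<epsilon> \<le> ?n" using n0 n by linarith
      then show ?thesis using \<epsilon> np by (simp add: field_simps)
    qed
    define \<tau> where "\<tau> z i j = threshold \<eta> (h (z i) (z j))" for z :: "nat \<Rightarrow> nat" and i j
    define C where "C = (\<Sum>x\<in>V. \<Sum>y\<in>V. cost p (threshold \<eta> (h x y))) / ?n\<^sup>2"
    define \<Phi> where "\<Phi> = {\<sigma> \<in> verts F \<rightarrow>\<^sub>E ?I. inj_on \<sigma> (verts F)}"
    have fF: "finite (verts F)" using F by (simp add: is_graph_def)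
    have fin: "finite (verts F \<rightarrow>\<^sub>E ?I)" using fF by (intro finite_PiE) auto
    have \<Phi>: "finite \<Phi>" "card \<Phi> \<le> m ^ f"
      using fin card_mono[OF fin, of \<Phi>] fF by (auto simp: \<Phi>_def card_PiE f_def)
    define cs where "cs z = template_cost p m (\<tau> z) / (real m)\<^sup>2" for z
    define cp where "cp z = (\<Sum>\<sigma>\<in>\<Phi>. of_bool (has_copy F ?I (\<tau> z) \<sigma>) :: real)" for z
    let ?Z = "?I \<rightarrow>\<^sub>E V"
    have Z: "finite ?Z" "?Z \<noteq> {}" "real (card ?Z) = ?n ^ m"
      using V V0 by (auto simp: finite_PiE PiE_eq_empty_iff card_PiE)
    have C1: "C \<le> 1"
    proof -
      have "(\<Sum>x\<in>V. \<Sum>y\<in>V. cost p (threshold \<eta> (h x y))) \<le> (\<Sum>x\<in>V. \<Sum>y\<in>V. 1)"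
        by (intro sum_mono cost_bounds[OF p])
      also have "\<dots> = ?n\<^sup>2" by (simp add: power2_eq_square)
      finally show ?thesis using np by (simp add: C_def)
    qed
    have C0: "0 \<le> C" unfolding C_def by (intro divide_nonneg_nonneg sum_nonneg cost_bounds[OF p]) auto
    have "(\<Sum>z\<in>?Z. cs z) = (\<Sum>i<m. \<Sum>j\<in>?I - {i}. \<Sum>z\<in>?Z. cost p (\<tau> z i j)) / (real m)\<^sup>2"
      unfolding cs_def template_cost_def sum_divide_distrib[symmetric]
      by (subst sum.swap, subst (2) sum.swap) (rule refl)
    also have "\<dots> = (\<Sum>i<m. \<Sum>j\<in>?I - {i}. ?n ^ m * C) / (real m)\<^sup>2"
    proof (intro arg_cong2[where f="(/)"] sum.cong refl)
      fix i j assume ij: "i \<in> ?I" "j \<in> ?I - {i}"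
      have "?n\<^sup>2 * (\<Sum>z\<in>?Z. cost p (\<tau> z i j)) = (\<Sum>z\<in>?Z. \<Sum>x\<in>V. \<Sum>y\<in>V. cost p (threshold \<eta> (h x y)))"
        using resample_two[of i ?I j, where V = V and g = "\<lambda>z. cost p (\<tau> z i j)"] ij by (simp add: \<tau>_def)
      also have "\<dots> = ?n ^ m * (\<Sum>x\<in>V. \<Sum>y\<in>V. cost p (threshold \<eta> (h x y)))" using Z(3) by simp
      finally show "(\<Sum>z\<in>?Z. cost p (\<tau> z i j)) = ?n ^ m * C" using np by (simp add: C_def field_simps)
    qed
    also have "\<dots> = ?n ^ m * C * (real m * real (m - 1) / (real m)\<^sup>2)"
      using m by (simp add: field_simps)
    also have "\<dots> \<le> ?n ^ m * C * 1"
      using m C0 by (intro mult_left_mono) (auto simp: power2_eq_square field_simps of_nat_diff)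
    finally have S1: "(\<Sum>z\<in>?Z. cs z) \<le> ?n ^ m * C" by simp
    have "(\<Sum>z\<in>?Z. cp z) = (\<Sum>\<sigma>\<in>\<Phi>. \<Sum>z\<in>?Z. of_bool (has_copy F ?I (\<tau> z) \<sigma>))"
      unfolding cp_def by (rule sum.swap)
    also have "\<dots> \<le> (\<Sum>\<sigma>\<in>\<Phi>. (real f)\<^sup>2 * (1 / ?n + \<epsilon>) / \<eta> ^ (f\<^sup>2) * ?n ^ m)"
    proof (rule sum_mono)
      fix \<sigma> assume "\<sigma> \<in> \<Phi>"
      then have \<sigma>: "\<sigma> ` verts F \<subseteq> ?I" "inj_on \<sigma> (verts F)" by (auto simp: \<Phi>_def PiE_iff)
      show "(\<Sum>z\<in>?Z. of_bool (has_copy F ?I (\<tau> z) \<sigma>)) \<le> (real f)\<^sup>2 * (1 / ?n + \<epsilon>) / \<eta> ^ (f\<^sup>2) * ?n ^ m"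
        using few_template_copies[OF F H V0 finite_lessThan _ cc _ \<eta> \<sigma>] h \<epsilon>
        unfolding f_def \<tau>_def[abs_def] by simp
    qed
    also have "\<dots> = real (card \<Phi>) * ((real f)\<^sup>2 * (1 / ?n + \<epsilon>) / \<eta> ^ (f\<^sup>2) * ?n ^ m)" by simp
    also have "\<dots> \<le> real m ^ f * (((real f)\<^sup>2 + 1) * (2 * \<epsilon>) / \<eta> ^ (f\<^sup>2) * ?n ^ m)"
      using \<Phi>(2) n1 \<eta> \<epsilon> np
      by (intro mult_mono mult_right_mono divide_right_mono) (auto simp flip: of_nat_power)
    also have "\<dots> = D * \<epsilon> * ?n ^ m" by (simp add: D_def)
    also have "\<dots> = \<gamma> / 2 * ?n ^ m" using D by (simp add: \<epsilon>_def)
    finally have S2: "(\<Sum>z\<in>?Z. cp z) \<le> \<gamma> / 2 * ?n ^ m" .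
    \<comment> \<open>Since \<open>C + \<gamma> < 2\<close>, the weight 2 forces a sample with this property to have no copy at all.\<close>
    have "\<exists>z\<in>?Z. cs z + 2 * cp z \<le> C + \<gamma>"
    proof (rule ccontr)
      assume "\<not> ?thesis"
      then have "\<And>z. z \<in> ?Z \<Longrightarrow> C + \<gamma> < cs z + 2 * cp z" by force
      then have "(\<Sum>z\<in>?Z. C + \<gamma>) < (\<Sum>z\<in>?Z. cs z + 2 * cp z)" using Z by (intro sum_strict_mono) auto
      also have "\<dots> \<le> ?n ^ m * C + 2 * (\<gamma> / 2 * ?n ^ m)" using S1 S2 by (simp add: sum.distrib sum_distrib_left[symmetric])
      finally show False using Z by (simp add: algebra_simps)
    qed
    then obtain z where z: "z \<in> ?Z" "cs z + 2 * cp z \<le> C + \<gamma>" by blast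
    have cs0: "0 \<le> cs z" unfolding cs_def template_cost_def by (intro divide_nonneg_nonneg sum_nonneg cost_bounds[OF p]) auto
    have no: "\<not> has_copy F ?I (\<tau> z) \<sigma>" for \<sigma>
    proof
      assume a: "has_copy F ?I (\<tau> z) \<sigma>"
      define \<sigma>' where "\<sigma>' = restrict \<sigma> (verts F)"
      have a': "has_copy F ?I (\<tau> z) \<sigma>'"
        using a unfolding has_copy_def \<sigma>'_def by (auto simp: inj_on_def)
      then have "\<sigma>' \<in> \<Phi>" unfolding \<Phi>_def has_copy_def \<sigma>'_def by (auto simp: PiE_iff)
      then have "1 \<le> cp z"
        unfolding cp_def using member_le_sum[of \<sigma>' \<Phi> "\<lambda>\<sigma>. of_bool (has_copy F ?I (\<tau> z) \<sigma>) :: real"] a' \<Phi>(1) by simp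
      then show False using z(2) cs0 C1 \<gamma> by linarith
    qed
    have "0 \<le> cp z" unfolding cp_def by (intro sum_nonneg) auto
    then have "cs z \<le> C + \<gamma>" using z(2) by linarith
    then have "template_cost p m (\<tau> z) \<le> (real m)\<^sup>2 * (C + \<gamma>)"
      using m by (simp add: cs_def field_simps)
    then show "\<exists>z\<in>?Z. (\<forall>\<sigma>. \<not> has_copy F ?I (\<lambda>i j. threshold \<eta> (h (z i) (z j))) \<sigma>) \<and>
        template_cost p m (\<lambda>i j. threshold \<eta> (h (z i) (z j))) \<le>
          (real m)\<^sup>2 * ((\<Sum>x\<in>V. \<Sum>y\<in>V. cost p (threshold \<eta> (h x y))) / ?n\<^sup>2 + \<gamma>)"
      using no z(1) unfolding \<tau>_def[abs_def] C_def by (intro bexI[of _ z]) auto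
  qed (rule \<epsilon>)
qed

section \<open>From templates to CRGs\<close>

lemma card_as_sum: "finite Y \<Longrightarrow> real (card {y \<in> Y. P y}) = (\<Sum>y\<in>Y. of_bool (P y))"
  by (simp add: sum_of_bool_eq Int_def)

lemma double_count:
  assumes "finite X" "finite Y"
  shows "(\<Sum>x\<in>X. real (card {y \<in> Y. R x y})) = (\<Sum>y\<in>Y. real (card {x \<in> X. R x y}))"
  by (simp only: card_as_sum assms) (rule sum.swap)

lemma many_large_values:
  fixes g :: "'a \<Rightarrow> real"
  assumes Y: "finite Y" and g: "\<And>y. y \<in> Y \<Longrightarrow> g y \<le> M" and \<beta>: "\<beta> \<ge> 0" and M: "M > 0"
    and tot: "(\<Sum>y\<in>Y. g y) \<ge> \<beta> * M * real (card Y)"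
  shows "real (card {y \<in> Y. g y \<ge> \<beta> / 2 * M}) \<ge> \<beta> / 2 * real (card Y)"
proof -
  have "\<beta> * M * real (card Y) \<le> (\<Sum>y\<in>Y. g y)" by (rule tot)
  also have "\<dots> \<le> (\<Sum>y\<in>Y. \<beta> / 2 * M + M * of_bool (g y \<ge> \<beta> / 2 * M))"
  proof (rule sum_mono)
    fix y assume "y \<in> Y"
    then have gM: "g y \<le> M" by (rule g)
    have "0 \<le> \<beta> / 2 * M" using \<beta> M by simp
    then show "g y \<le> \<beta> / 2 * M + M * of_bool (g y \<ge> \<beta> / 2 * M)"
      using gM by (simp only: of_bool_def split: if_split) linarith
  qed
  also have "\<dots> = \<beta> / 2 * M * real (card Y) + M * real (card {y \<in> Y. g y \<ge> \<beta> / 2 * M})"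
    using Y by (simp add: sum.distrib card_as_sum sum_distrib_left)
  finally have "M * (\<beta> / 2 * real (card Y)) \<le> M * real (card {y \<in> Y. g y \<ge> \<beta> / 2 * M})"
    by (simp add: algebra_simps)
  then show ?thesis using M by simp
qed

text \<open>
  Erdos's theorem on complete multipartite hypergraphs: a dense set \<open>A\<close> of tuples contains a box
  with sides of size \<open>r\<close>. For the induction, choose a bounded number \<open>s\<close> of values \<open>x\<close> of the
  new coordinate whose fibres are dense. A positive fraction of the remaining tuples lies in
  many of these fibres, and by pigeonhole a positive fraction lies in the same \<open>r\<close> of them.
\<close>

lemma box_theorem:
  assumes "finite (I :: 'a set)"
  shows "0 < \<alpha> \<Longrightarrow> \<exists>m0. \<forall>(V :: 'b set) (A :: ('a \<Rightarrow> 'b) set). finite V \<longrightarrow> card V \<ge> m0 \<longrightarrow> A \<subseteq> I \<rightarrow>\<^sub>E V \<longrightarrow>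
     \<alpha> * real (card V) ^ card I \<le> real (card A) \<longrightarrow>
     (\<exists>U. (\<forall>i\<in>I. U i \<subseteq> V \<and> card (U i) = r) \<and> PiE I U \<subseteq> A)"
  using assms
proof (induction I arbitrary: \<alpha> rule: finite_induct)
  case empty
  show ?case
  proof (intro exI[of _ 0] allI impI)
    fix V :: "'b set" and A :: "('a \<Rightarrow> 'b) set"
    assume "A \<subseteq> {} \<rightarrow>\<^sub>E V" "\<alpha> * real (card V) ^ card ({} :: 'a set) \<le> real (card A)"
    then have "card A \<noteq> 0" "A \<subseteq> {\<lambda>x. undefined}" using empty.prems by (auto simp: PiE_def extensional_def)
    then have "A = {\<lambda>x. undefined}" using subset_singletonD by fastforce
    then show "\<exists>U. (\<forall>i\<in>{}. U i \<subseteq> V \<and> card (U i) = r) \<and> PiE {} U \<subseteq> A"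
      by (auto simp: PiE_def extensional_def)
  qed
next
  case (insert i I)
  \<comment> \<open>With this many fibres, a quarter of \<open>\<alpha> s\<close> is still more than \<open>r\<close>.\<close>
  obtain s :: nat where s: "4 * real r / \<alpha> + 1 < real s" using reals_Archimedean2 by blast
  have s0: "real s > 0" using s insert.prems by (smt (verit) divide_nonneg_pos of_nat_0_le_iff)
  have sr: "real r < real s * \<alpha> / 4"
  proof -
    have "4 * real r / \<alpha> < real s" using s by linarith
    then show ?thesis using insert.prems by (simp add: field_simps)
  qed
  define \<alpha>' where "\<alpha>' = \<alpha> / 4 / 2 ^ s"
  have \<alpha>': "0 < \<alpha>'" using insert.prems by (simp add: \<alpha>'_def)
  from insert.IH[OF \<alpha>'] obtain m0 where m0: "\<forall>(V :: 'b set) (A :: ('a \<Rightarrow> 'b) set). finite V \<longrightarrow> card V \<ge> m0 \<longrightarrow> A \<subseteq> I \<rightarrow>\<^sub>E V \<longrightarrow>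
     \<alpha>' * real (card V) ^ card I \<le> real (card A) \<longrightarrow>
     (\<exists>U. (\<forall>i\<in>I. U i \<subseteq> V \<and> card (U i) = r) \<and> PiE I U \<subseteq> A)"
    ..
  obtain m1 :: nat where m1: "2 * real s / \<alpha> < real m1" using reals_Archimedean2 by blast
  show ?case
  proof (intro exI[of _ "max (max m0 m1) 1"] allI impI)
    fix V :: "'b set" and A :: "('a \<Rightarrow> 'b) set"
    assume V: "finite V" and n: "card V \<ge> max (max m0 m1) 1" and A: "A \<subseteq> insert i I \<rightarrow>\<^sub>E V"
      and cA: "\<alpha> * real (card V) ^ card (insert i I) \<le> real (card A)"
    let ?n = "real (card V)"
    define Y where "Y = I \<rightarrow>\<^sub>E V"
    define N where "N = ?n ^ card I"
    have n1: "?n \<ge> 1" using n by simp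
    have Np: "N > 0" using n1 by (simp add: N_def)
    have Y: "finite Y" "real (card Y) = N" using V insert.hyps by (auto simp: Y_def N_def card_PiE finite_PiE)
    define Ax where "Ax x = {y \<in> Y. y(i := x) \<in> A}" for x
    have AxY: "real (card (Ax x)) \<le> N" for x
      using card_mono[OF Y(1), of "Ax x"] Y(2) by (auto simp: Ax_def)
    have finA: "finite A" using A V insert.hyps by (meson finite_PiE finite_insert finite_subset)
    have "card {f \<in> A. f i = x} = card (Ax x)" if "x \<in> V" for x
    proof (rule bij_betw_same_card[of "\<lambda>f. f(i := undefined)"], rule bij_betw_byWitness[of _ "\<lambda>y. y(i := x)"])
      show "\<forall>f\<in>{f \<in> A. f i = x}. (f(i := undefined))(i := x) = f" by auto
      show "\<forall>y\<in>Ax x. (y(i := x))(i := undefined) = y"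
        using insert.hyps by (auto simp: Ax_def Y_def PiE_def extensional_def)
      show "(\<lambda>f. f(i := undefined)) ` {f \<in> A. f i = x} \<subseteq> Ax x"
        using A insert.hyps unfolding Ax_def Y_def by (force simp: PiE_iff extensional_def fun_upd_idem)
      show "(\<lambda>y. y(i := x)) ` Ax x \<subseteq> {f \<in> A. f i = x}" by (auto simp: Ax_def)
    qed
    then have "(\<Sum>x\<in>V. real (card (Ax x))) = (\<Sum>x\<in>V. real (card {f \<in> A. f i = x}))" by simp
    also have "\<dots> = (\<Sum>f\<in>A. real (card {x \<in> V. f i = x}))" by (rule double_count[OF V finA])
    also have "\<dots> = (\<Sum>f\<in>A. 1)"
    proof (rule sum.cong[OF refl])
      fix f assume "f \<in> A"
      then have "f i \<in> V" using A by (auto simp: PiE_iff)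
      then have "{x \<in> V. f i = x} = {f i}" by auto
      then show "real (card {x \<in> V. f i = x}) = 1" by simp
    qed
    finally have "\<alpha> * N * ?n \<le> (\<Sum>x\<in>V. real (card (Ax x)))"
      using cA insert.hyps by (simp add: N_def mult_ac)
    then have heavy: "real (card {x \<in> V. real (card (Ax x)) \<ge> \<alpha> / 2 * N}) \<ge> \<alpha> / 2 * ?n"
      by (intro many_large_values[OF V AxY _ Np]) (use insert.prems in auto)
    have "real s \<le> \<alpha> / 2 * ?n"
    proof -
      have "2 * real s / \<alpha> \<le> ?n" using m1 n by linarith
      then show ?thesis using insert.prems by (simp add: field_simps)
    qed
    then have "s \<le> card {x \<in> V. real (card (Ax x)) \<ge> \<alpha> / 2 * N}" using heavy by linarith
    then obtain X where X: "X \<subseteq> {x \<in> V. real (card (Ax x)) \<ge> \<alpha> / 2 * N}" "card X = s" "finite X"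
      by (rule obtain_subset_with_card_n)
    define D where "D y = {x \<in> X. y(i := x) \<in> A}" for y
    have DX: "real (card (D y)) \<le> real s" for y
      using card_mono[OF X(3), of "D y"] X(2) by (auto simp: D_def)
    have "\<alpha> / 2 * real s * real (card Y) = (\<Sum>x\<in>X. \<alpha> / 2 * N)" using X Y by simp
    also have "\<dots> \<le> (\<Sum>x\<in>X. real (card (Ax x)))" using X(1) by (intro sum_mono) auto
    also have "\<dots> = (\<Sum>y\<in>Y. real (card (D y)))" unfolding Ax_def D_def by (rule double_count[OF X(3) Y(1)])
    finally have "real (card {y \<in> Y. real (card (D y)) \<ge> \<alpha> / 2 / 2 * real s}) \<ge> \<alpha> / 2 / 2 * real (card Y)"
      by (intro many_large_values[OF Y(1) DX _ s0]) (use insert.prems in auto)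
    moreover define Y' where "Y' = {y \<in> Y. real (card (D y)) \<ge> \<alpha> / 2 / 2 * real s}"
    ultimately have Y': "real (card Y') \<ge> \<alpha> / 4 * N" using Y by simp
    have finY': "finite Y'" using Y by (simp add: Y'_def)
    have "\<exists>Z\<in>Pow X. card (D -` {Z} \<inter> Y') * card (Pow X) \<ge> card Y'"
      by (rule pigeonhole_card) (use finY' X in \<open>auto simp: D_def\<close>)
    then obtain Z where Z: "Z \<subseteq> X" "card (D -` {Z} \<inter> Y') * 2 ^ s \<ge> card Y'"
      using X by (auto simp: card_Pow)
    define A' where "A' = D -` {Z} \<inter> Y'"
    have "real (card Y') \<le> real (card A') * 2 ^ s"
      using Z(2) unfolding A'_def by (metis of_nat_le_iff of_nat_mult of_nat_numeral of_nat_power)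
    then have cA': "\<alpha>' * N \<le> real (card A')" using Y' by (simp add: \<alpha>'_def field_simps)
    then have "card A' \<noteq> 0" using \<alpha>' Np by (smt (verit) mult_pos_pos of_nat_0)
    then obtain y0 where "y0 \<in> A'" by (metis card.empty ex_in_conv)
    then have "real (card Z) \<ge> \<alpha> / 4 * real s" by (auto simp: A'_def Y'_def)
    then have "r \<le> card Z" using sr by (simp add: mult.commute)
    then obtain R where R: "R \<subseteq> Z" "card R = r" "finite R" by (rule obtain_subset_with_card_n)
    have "A' \<subseteq> I \<rightarrow>\<^sub>E V" by (auto simp: A'_def Y'_def Y_def)
    then obtain U where U: "\<And>j. j \<in> I \<Longrightarrow> U j \<subseteq> V \<and> card (U j) = r"
      "PiE I U \<subseteq> A'"
    proof -
      have "card V \<ge> m0" using n by simp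
      with m0 V \<open>A' \<subseteq> I \<rightarrow>\<^sub>E V\<close> cA'[unfolded N_def]
      have "\<exists>U. (\<forall>i\<in>I. U i \<subseteq> V \<and> card (U i) = r) \<and> PiE I U \<subseteq> A'" by simp
      then show ?thesis using that by auto
    qed
    define U' where "U' = U(i := R)"
    show "\<exists>U. (\<forall>j\<in>insert i I. U j \<subseteq> V \<and> card (U j) = r) \<and>
       PiE (insert i I) U \<subseteq> A"
    proof (intro exI[of _ U'] conjI ballI)
      fix j assume "j \<in> insert i I"
      then show "U' j \<subseteq> V" "card (U' j) = r" using U(1) R Z X insert.hyps by (auto simp: U'_def)
    next
      show "PiE (insert i I) U' \<subseteq> A"
      proof
        fix g assume g: "g \<in> PiE (insert i I) U'"
        define y where "y = g(i := undefined)"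
        have "y \<in> PiE I U"
        proof (rule PiE_I)
          fix j assume "j \<in> I"
          moreover from this have "j \<noteq> i" using insert.hyps by auto
          ultimately show "y j \<in> U j" using g by (auto simp: y_def U'_def PiE_iff)
        next
          fix j assume "j \<notin> I"
          then show "y j = undefined" using g by (auto simp: y_def PiE_iff extensional_def)
        qed
        then have "y \<in> A'" using U(2) by blast
        then have "D y = Z" by (simp add: A'_def)
        moreover have "g i \<in> R" using g by (auto simp: U'_def PiE_iff)
        ultimately have "y(i := g i) \<in> A" using R unfolding D_def by blast
        then show "g \<in> A" by (simp add: y_def)
      qed
    qed
  qed
qed

instance colour :: finite
proof
  have "(UNIV :: colour set) \<subseteq> {White, Black, Gray}" using colour.exhaust by blast
  then show "finite (UNIV :: colour set)" by (rule finite_subset) simp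
qed

lemma off_diagonal_sum_le:
  assumes "\<And>i j. i < l \<Longrightarrow> j < l \<Longrightarrow> i \<noteq> j \<Longrightarrow> g i j \<le> c" "0 \<le> c"
  shows "(\<Sum>i<l. \<Sum>j\<in>{..<l} - {i}. g i j) \<le> (real l)\<^sup>2 * c"
proof -
  have "(\<Sum>i<l. \<Sum>j\<in>{..<l} - {i}. g i j) \<le> (\<Sum>i<l. \<Sum>j\<in>{..<l} - {i}. c)"
    using assms(1) by (intro sum_mono) auto
  also have "\<dots> \<le> (\<Sum>i<l. \<Sum>j<l. c)" using assms(2) by (intro sum_mono sum_mono2) auto
  finally show ?thesis by (simp add: power2_eq_square)
qed

text \<open>
  By Markov's inequality a fraction of at least about \<open>\<gamma>/3\<close> of the \<open>l\<close>-tuples is cheap; only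
  \<open>O(1/m)\<close> of them have repeated entries, and the others show boundedly many patterns.
\<close>

lemma frequent_pattern:
  fixes \<gamma> :: real
  assumes l: "l > 0" and \<gamma>: "0 < \<gamma>" "\<gamma> \<le> 1"
  shows "\<exists>\<alpha>>0. \<exists>m1. \<forall>m\<ge>m1. \<forall>\<tau> p B. p \<in> {0..1} \<longrightarrow> 0 \<le> B \<longrightarrow> B \<le> 2 \<longrightarrow>
     template_cost p m \<tau> \<le> (real m)\<^sup>2 * B \<longrightarrow>
     (\<exists>S A. A \<subseteq> {..<l} \<rightarrow>\<^sub>E {..<m} \<and> \<alpha> * real m ^ l \<le> real (card A) \<and>
        (\<forall>y\<in>A. inj_on y {..<l} \<and> (\<forall>i<l. \<forall>j<l. i \<noteq> j \<longrightarrow> \<tau> (y i) (y j) = S i j)) \<and>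
        template_cost p l S \<le> (real l)\<^sup>2 * (B + \<gamma>))"
proof -
  define PT where "PT = ({..<l} \<times> {..<l}) \<rightarrow>\<^sub>E (UNIV :: colour set)"
  have PT: "finite PT" "PT \<noteq> {}" unfolding PT_def by (auto simp: PiE_eq_empty_iff intro!: finite_PiE)
  then have PT0: "real (card PT) > 0" by (simp add: card_gt_0_iff)
  define \<alpha> where "\<alpha> = \<gamma> / 6 / real (card PT)"
  obtain m1 :: nat where m1: "6 * (real l)\<^sup>2 / \<gamma> < real m1" using reals_Archimedean2 by blast
  show ?thesis
  proof (rule exI[of _ \<alpha>], intro conjI)
    show "0 < \<alpha>" using \<gamma> PT0 by (simp add: \<alpha>_def)
    show "\<exists>m1. \<forall>m\<ge>m1. \<forall>\<tau> p B. p \<in> {0..1} \<longrightarrow> 0 \<le> B \<longrightarrow> B \<le> 2 \<longrightarrow>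
     template_cost p m \<tau> \<le> (real m)\<^sup>2 * B \<longrightarrow>
     (\<exists>S A. A \<subseteq> {..<l} \<rightarrow>\<^sub>E {..<m} \<and> \<alpha> * real m ^ l \<le> real (card A) \<and>
        (\<forall>y\<in>A. inj_on y {..<l} \<and> (\<forall>i<l. \<forall>j<l. i \<noteq> j \<longrightarrow> \<tau> (y i) (y j) = S i j)) \<and>
        template_cost p l S \<le> (real l)\<^sup>2 * (B + \<gamma>))"
    proof (rule exI[of _ "max m1 1"], intro allI impI)
      fix m :: nat and \<tau> :: "nat \<Rightarrow> nat \<Rightarrow> colour" and p B :: real
      assume m: "max m1 1 \<le> m" and p: "p \<in> {0..1}" and B: "0 \<le> B" "B \<le> 2"
        and c: "template_cost p m \<tau> \<le> (real m)\<^sup>2 * B"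
      let ?Y = "{..<l} \<rightarrow>\<^sub>E {..<m}"
      have mp: "real m > 0" using m by simp
      have Y: "finite ?Y" "real (card ?Y) = real m ^ l" by (auto simp: card_PiE intro!: finite_PiE)
      define k where "k x x' = (if x = x' then 0 else cost p (\<tau> x x'))" for x x'
      have k0: "0 \<le> k x x'" for x x' using cost_bounds[OF p] by (simp add: k_def)
      have ksum: "(\<Sum>x<m. \<Sum>x'<m. k x x') \<le> (real m)\<^sup>2 * B"
      proof -
        have "(\<Sum>x'<m. k x x') = (\<Sum>j\<in>{..<m} - {x}. cost p (\<tau> x j))" if "x < m" for x
        proof -
          have "(\<Sum>x'<m. k x x') = k x x + (\<Sum>j\<in>{..<m} - {x}. k x j)"
            using that by (intro sum.remove) auto
          also have "\<dots> = (\<Sum>j\<in>{..<m} - {x}. cost p (\<tau> x j))"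
            by (auto simp: k_def intro!: sum.cong)
          finally show ?thesis .
        qed
        then show ?thesis using c by (simp add: template_cost_def)
      qed
      define g where "g y = (\<Sum>i<l. \<Sum>j\<in>{..<l} - {i}. k (y i) (y j))" for y
      have g0: "0 \<le> g y" for y unfolding g_def by (intro sum_nonneg k0)
      have swap3: "(\<Sum>y\<in>?Y. \<Sum>i<l. \<Sum>j\<in>{..<l} - {i}. q y i j) = (\<Sum>i<l. \<Sum>j\<in>{..<l} - {i}. \<Sum>y\<in>?Y. q y i j)"
        for q :: "(nat \<Rightarrow> nat) \<Rightarrow> nat \<Rightarrow> nat \<Rightarrow> real"
        by (subst sum.swap, rule sum.cong[OF refl], rule sum.swap)
      have G1: "(\<Sum>y\<in>?Y. g y) \<le> (real l)\<^sup>2 * (real m ^ l * B)"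
        unfolding g_def swap3
      proof (rule off_diagonal_sum_le)
        fix i j assume ij: "i < l" "j < l" "i \<noteq> j"
        have "(real m)\<^sup>2 * (\<Sum>y\<in>?Y. k (y i) (y j)) = (\<Sum>y\<in>?Y. \<Sum>x<m. \<Sum>x'<m. k x x')"
          using resample_two[of i "{..<l}" j, where V = "{..<m}" and g = "\<lambda>y. k (y i) (y j)"] ij by simp
        also have "\<dots> \<le> (\<Sum>y\<in>?Y. (real m)\<^sup>2 * B)" using ksum by (intro sum_mono)
        also have "\<dots> = (real m)\<^sup>2 * (real m ^ l * B)" using Y by simp
        finally show "(\<Sum>y\<in>?Y. k (y i) (y j)) \<le> real m ^ l * B" using mp by simp
      qed (use B in simp)
      define q where "q y = (\<Sum>i<l. \<Sum>j\<in>{..<l} - {i}. of_bool (y i = y j) :: real)" for y :: "nat \<Rightarrow> nat"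
      have q0: "0 \<le> q y" for y unfolding q_def by (intro sum_nonneg) simp
      have G2: "(\<Sum>y\<in>?Y. q y) \<le> (real l)\<^sup>2 * (real m ^ l / real m)"
        unfolding q_def swap3
      proof (rule off_diagonal_sum_le)
        fix i j assume ij: "i < l" "j < l" "i \<noteq> j"
        have "{..<m} \<noteq> {}" using mp by auto
        then show "(\<Sum>y\<in>?Y. of_bool (y i = y j)) \<le> real m ^ l / real m"
          using sum_coincidence[of "{..<m}" "{..<l}" i j] ij by simp
      qed simp
      define G where "G = {y \<in> ?Y. g y \<le> (real l)\<^sup>2 * (B + \<gamma>) \<and> inj_on y {..<l}}"
      have l2: "(real l)\<^sup>2 > 0" using l by simp
      have Bg: "B + \<gamma> > 0" using B \<gamma> by linarith
      have ptw: "1 \<le> of_bool (y \<in> G) + g y / ((real l)\<^sup>2 * (B + \<gamma>)) + q y" if y: "y \<in> ?Y" for y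
      proof (cases "y \<in> G")
        case True
        then show ?thesis using g0[of y] q0[of y] Bg by simp
      next
        case False
        have "\<not> (g y \<le> (real l)\<^sup>2 * (B + \<gamma>) \<and> inj_on y {..<l})" using False y unfolding G_def by blast
        then consider "g y > (real l)\<^sup>2 * (B + \<gamma>)" | "\<not> inj_on y {..<l}" by (meson not_le)
        then show ?thesis
        proof cases
          case 1
          then have "1 \<le> g y / ((real l)\<^sup>2 * (B + \<gamma>))" using l2 Bg by (simp add: le_divide_eq)
          then show ?thesis using q0[of y] by simp
        next
          case 2
          then obtain i j where ij: "i < l" "j < l" "i \<noteq> j" "y i = y j" by (auto simp: inj_on_def)
          have "1 = (of_bool (y i = y j) :: real)" using ij by simp
          also have "\<dots> \<le> (\<Sum>j\<in>{..<l} - {i}. of_bool (y i = y j))"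
            using ij by (intro member_le_sum) auto
          also have "\<dots> \<le> q y" unfolding q_def
            using ij by (intro member_le_sum[of i "{..<l}" "\<lambda>i. \<Sum>j\<in>{..<l} - {i}. of_bool (y i = y j)"] sum_nonneg) auto
          finally have "1 \<le> q y" .
          moreover have "0 \<le> g y / ((real l)\<^sup>2 * (B + \<gamma>))" using g0[of y] Bg by simp
          ultimately show ?thesis using False by simp
        qed
      qed
      have "real m ^ l = (\<Sum>y\<in>?Y. 1)" using Y by simp
      also have "\<dots> \<le> (\<Sum>y\<in>?Y. of_bool (y \<in> G) + g y / ((real l)\<^sup>2 * (B + \<gamma>)) + q y)"
        by (intro sum_mono ptw)
      also have "\<dots> = real (card G) + (\<Sum>y\<in>?Y. g y) / ((real l)\<^sup>2 * (B + \<gamma>)) + (\<Sum>y\<in>?Y. q y)"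
      proof -
        have "(\<Sum>y\<in>?Y. of_bool (y \<in> G)) = real (card G)"
          using card_as_sum[OF Y(1), of "\<lambda>y. y \<in> G"] by (simp add: G_def)
        then show ?thesis by (simp add: sum.distrib sum_divide_distrib)
      qed
      also have "\<dots> \<le> real (card G) + ((real l)\<^sup>2 * (real m ^ l * B)) / ((real l)\<^sup>2 * (B + \<gamma>)) + (real l)\<^sup>2 * (real m ^ l / real m)"
        using G1 G2 Bg by (intro add_mono divide_right_mono order_refl) auto
      also have "((real l)\<^sup>2 * (real m ^ l * B)) / ((real l)\<^sup>2 * (B + \<gamma>)) = real m ^ l * (B / (B + \<gamma>))"
        using l2 by simp
      also have "\<dots> \<le> real m ^ l * (1 - \<gamma> / 3)"
      proof (rule mult_left_mono)
        have "B * 3 \<le> (3 - \<gamma>) * (B + \<gamma>)"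
        proof -
          have "\<gamma> * B + \<gamma> * \<gamma> \<le> \<gamma> * 2 + \<gamma> * 1" using B \<gamma> by (intro add_mono mult_left_mono) auto
          then show ?thesis by (simp add: algebra_simps)
        qed
        then show "B / (B + \<gamma>) \<le> 1 - \<gamma> / 3" using Bg by (simp add: field_simps)
      qed (use mp in simp)
      also have "(real l)\<^sup>2 * (real m ^ l / real m) \<le> real m ^ l * (\<gamma> / 6)"
      proof -
        have "6 * (real l)\<^sup>2 / \<gamma> \<le> real m" using m1 m by linarith
        then have "(real l)\<^sup>2 / real m \<le> \<gamma> / 6" using \<gamma> mp by (simp add: field_simps)
        then have "real m ^ l * ((real l)\<^sup>2 / real m) \<le> real m ^ l * (\<gamma> / 6)" by (intro mult_left_mono) auto
        then show ?thesis by (simp add: mult_ac)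
      qed
      finally have cG: "real m ^ l * (\<gamma> / 6) \<le> real (card G)" by (simp add: algebra_simps)
      have finG: "finite G" using Y by (simp add: G_def)
      define pat where "pat y = (\<lambda>e\<in>{..<l} \<times> {..<l}. \<tau> (y (fst e)) (y (snd e)))" for y
      have "\<exists>P\<in>PT. card (pat -` {P} \<inter> G) * card PT \<ge> card G"
        by (rule pigeonhole_card[OF _ finG PT]) (auto simp: pat_def PT_def)
      then obtain P where P: "card (pat -` {P} \<inter> G) * card PT \<ge> card G" by blast
      define A where "A = pat -` {P} \<inter> G"
      define S where "S i j = P (i, j)" for i j
      have "real (card G) \<le> real (card A) * real (card PT)"
        using P unfolding A_def by (metis of_nat_le_iff of_nat_mult)
      with cG have cA: "\<alpha> * real m ^ l \<le> real (card A)"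
        using PT0 by (simp add: \<alpha>_def field_simps)
      have AS: "\<tau> (y i) (y j) = S i j" if "y \<in> A" "i < l" "j < l" for y i j
      proof -
        have "pat y = P" using that by (simp add: A_def)
        then have "pat y (i, j) = P (i, j)" by simp
        then show ?thesis using that by (simp add: pat_def S_def)
      qed
      have "0 < \<alpha> * real m ^ l" using \<gamma> PT0 mp by (simp add: \<alpha>_def)
      then have "card A \<noteq> 0" using cA by linarith
      then obtain y where y: "y \<in> A" by (metis card.empty ex_in_conv)
      then have yG: "y \<in> G" by (simp add: A_def)
      have "template_cost p l S = g y"
        unfolding g_def template_cost_def
      proof (intro sum.cong refl)
        fix i j assume "i \<in> {..<l}" "j \<in> {..<l} - {i}"
        then have ij: "i < l" "j < l" "i \<noteq> j" by auto
        then have "y i \<noteq> y j" using yG by (auto simp: G_def dest: inj_onD)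
        then show "cost p (S i j) = k (y i) (y j)" using AS[OF y ij(1,2)] by (simp add: k_def)
      qed
      then have cS: "template_cost p l S \<le> (real l)\<^sup>2 * (B + \<gamma>)"
        using yG by (simp add: G_def)
      show "\<exists>S A. A \<subseteq> ?Y \<and> \<alpha> * real m ^ l \<le> real (card A) \<and>
        (\<forall>y\<in>A. inj_on y {..<l} \<and> (\<forall>i<l. \<forall>j<l. i \<noteq> j \<longrightarrow> \<tau> (y i) (y j) = S i j)) \<and>
        template_cost p l S \<le> (real l)\<^sup>2 * (B + \<gamma>)"
      proof (intro exI[of _ S] exI[of _ A] conjI ballI allI impI)
        show "A \<subseteq> ?Y" by (auto simp: A_def G_def)
        show "inj_on y {..<l}" if "y \<in> A" for y using that by (simp add: A_def G_def)
      qed (use cA cS AS in auto)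
    qed
  qed
qed

text \<open>
  A frequent cheap pattern \<open>S\<close> occurs in a box with large sides \<open>U i\<close>. By Ramsey's theorem, each
  side contains a set \<open>R i\<close>, as large as \<open>F\<close>, whose pairs are all white or all black or gray;
  this decides the colour of vertex \<open>i\<close>. A map of \<open>F\<close> to the resulting CRG could be made
  injective by spreading the vertices sent to \<open>i\<close> over \<open>R i\<close>, giving a copy of \<open>F\<close> in the
  template. The diagonal costs at most \<open>1/l\<close> under uniform mass.
\<close>

lemma crg_from_template:
  fixes \<gamma> :: real
  assumes F: "is_graph F" and l: "l > 0" and \<gamma>: "0 < \<gamma>" "\<gamma> \<le> 1"
  shows "\<exists>m0. \<forall>m\<ge>m0. \<forall>\<tau> p B. (\<forall>i j. \<tau> i j = \<tau> j i) \<longrightarrow> p \<in> {0..1} \<longrightarrow> 0 \<le> B \<longrightarrow> B \<le> 2 \<longrightarrow>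
     template_cost p m \<tau> \<le> (real m)\<^sup>2 * B \<longrightarrow>
     (\<forall>\<sigma>. \<not> has_copy F {..<m} \<tau> \<sigma>) \<longrightarrow>
     (\<exists>K\<in>crg_class (Forb F). crg_g K p \<le> B + \<gamma> + 1 / real l)"
proof -
  define f where "f = card (verts F)"
  obtain r where r: "\<And>(V :: nat set) E. finite V \<Longrightarrow> card V \<ge> r \<Longrightarrow>
      \<exists>R\<subseteq>V. card R = f \<and> clique R E \<or> card R = f \<and> indep R E"
    using ramsey2[of f f, where ?'a = nat] by blast
  obtain \<alpha> m1 where \<alpha>: "\<alpha> > 0" and m1: "\<forall>m\<ge>m1. \<forall>\<tau> p B. p \<in> {0..1} \<longrightarrow> 0 \<le> B \<longrightarrow> B \<le> 2 \<longrightarrow>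
     template_cost p m \<tau> \<le> (real m)\<^sup>2 * B \<longrightarrow>
     (\<exists>S A. A \<subseteq> {..<l} \<rightarrow>\<^sub>E {..<m} \<and> \<alpha> * real m ^ l \<le> real (card A) \<and>
        (\<forall>y\<in>A. inj_on y {..<l} \<and> (\<forall>i<l. \<forall>j<l. i \<noteq> j \<longrightarrow> \<tau> (y i) (y j) = S i j)) \<and>
        template_cost p l S \<le> (real l)\<^sup>2 * (B + \<gamma>))"
    using frequent_pattern[OF l \<gamma>] by auto
  have "\<exists>m0. \<forall>(V :: nat set) (A :: (nat \<Rightarrow> nat) set). finite V \<longrightarrow> card V \<ge> m0 \<longrightarrow> A \<subseteq> {..<l} \<rightarrow>\<^sub>E V \<longrightarrow>
     \<alpha> * real (card V) ^ card {..<l} \<le> real (card A) \<longrightarrow>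
     (\<exists>U. (\<forall>i\<in>{..<l}. U i \<subseteq> V \<and> card (U i) = r) \<and> PiE {..<l} U \<subseteq> A)"
    by (rule box_theorem[OF finite_lessThan \<alpha>])
  then obtain m0 where m0: "\<forall>(V :: nat set) (A :: (nat \<Rightarrow> nat) set). finite V \<longrightarrow> card V \<ge> m0 \<longrightarrow> A \<subseteq> {..<l} \<rightarrow>\<^sub>E V \<longrightarrow>
     \<alpha> * real (card V) ^ card {..<l} \<le> real (card A) \<longrightarrow>
     (\<exists>U. (\<forall>i\<in>{..<l}. U i \<subseteq> V \<and> card (U i) = r) \<and> PiE {..<l} U \<subseteq> A)" ..
  show ?thesis
  proof (rule exI[of _ "max m0 m1"], intro allI impI)
    fix m :: nat and \<tau> :: "nat \<Rightarrow> nat \<Rightarrow> colour" and p B :: real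
    assume m: "max m0 m1 \<le> m" and sym: "\<forall>i j. \<tau> i j = \<tau> j i" and p: "p \<in> {0..1}" and B: "0 \<le> B" "B \<le> 2"
      and c: "template_cost p m \<tau> \<le> (real m)\<^sup>2 * B"
      and no: "\<forall>\<sigma>. \<not> has_copy F {..<m} \<tau> \<sigma>"
    have "m1 \<le> m" using m by simp
    from m1[rule_format, OF this p B c]
    obtain S A where A: "A \<subseteq> {..<l} \<rightarrow>\<^sub>E {..<m}" "\<alpha> * real m ^ l \<le> real (card A)"
      and pat: "\<forall>y\<in>A. inj_on y {..<l} \<and> (\<forall>i<l. \<forall>j<l. i \<noteq> j \<longrightarrow> \<tau> (y i) (y j) = S i j)"
      and cS: "template_cost p l S \<le> (real l)\<^sup>2 * (B + \<gamma>)"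
      by (elim exE conjE)
    have inj: "\<And>y. y \<in> A \<Longrightarrow> inj_on y {..<l}"
      and S: "\<And>y i j. y \<in> A \<Longrightarrow> i < l \<Longrightarrow> j < l \<Longrightarrow> i \<noteq> j \<Longrightarrow> \<tau> (y i) (y j) = S i j"
      using pat by blast+
    have "\<exists>U. (\<forall>i\<in>{..<l}. U i \<subseteq> {..<m} \<and> card (U i) = r) \<and> PiE {..<l} U \<subseteq> A"
      using m0 A m by simp
    then obtain U where U: "\<And>i. i < l \<Longrightarrow> U i \<subseteq> {..<m}" "\<And>i. i < l \<Longrightarrow> card (U i) = r" "PiE {..<l} U \<subseteq> A"
      by auto
    define E where "E = {{x, y} | x y. \<tau> x y = White}"
    have E: "{x, y} \<in> E \<longleftrightarrow> \<tau> x y = White" for x y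
      using sym unfolding E_def by (auto simp: doubleton_eq_iff)
    have "\<exists>R. R \<subseteq> U i \<and> (card R = f \<and> clique R E \<or> card R = f \<and> indep R E)" if "i < l" for i
      using r[of "U i" E] U(1,2)[OF that] finite_subset[OF U(1)[OF that]] by auto
    then obtain R where R: "\<And>i. i < l \<Longrightarrow> R i \<subseteq> U i" "\<And>i. i < l \<Longrightarrow> card (R i) = f"
      "\<And>i. i < l \<Longrightarrow> clique (R i) E \<or> indep (R i) E"
      by metis
    have fF: "finite (verts F)" using F by (simp add: is_graph_def)
    have nf: "f > 0"
    proof (rule ccontr)
      assume "\<not> f > 0"
      then have "verts F = {}" using fF by (simp add: f_def)
      then show False using no by (auto simp: has_copy_def)
    qed
    have finR: "finite (R i)" if "i < l" for i using R(2)[OF that] nf by (metis card.infinite less_irrefl)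
    have SU: "\<tau> x y = S i j \<and> x \<noteq> y" if "i < l" "j < l" "i \<noteq> j" "x \<in> U i" "y \<in> U j" for i j x y
    proof -
      have ne: "\<exists>w. w \<in> U k" if "k < l" for k using R(1)[OF that] R(2)[OF that] nf by (metis card.empty ex_in_conv less_irrefl subsetD)
      define z where "z = (\<lambda>k\<in>{..<l}. if k = i then x else if k = j then y else (SOME w. w \<in> U k))"
      have "z \<in> PiE {..<l} U"
      proof (rule PiE_I)
        fix k assume k: "k \<in> {..<l}"
        then have "(SOME w. w \<in> U k) \<in> U k" using someI_ex[OF ne] by simp
        then show "z k \<in> U k" using k that(4,5) by (simp add: z_def)
      qed (simp add: z_def)
      then have zA: "z \<in> A" using U(3) by blast
      have "z i = x" "z j = y" using that by (auto simp: z_def)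
      moreover have "z i \<noteq> z j" using inj_on_eq_iff[OF inj[OF zA], of i j] that by simp
      ultimately show ?thesis using S[OF zA that(1-3)] by simp
    qed
    define k where "k i j = (if i = j then (if clique (R i) E then White else Black) else S i j)" for i j
    have neU: "U i \<noteq> {}" if "i < l" for i using R(1,2)[OF that] nf by auto
    have Ssym: "S i j = S j i" if "i < l" "j < l" "i \<noteq> j" for i j
    proof -
      obtain x y where xy: "x \<in> U i" "y \<in> U j" using neU[OF \<open>i < l\<close>] neU[OF \<open>j < l\<close>] by blast
      have "j \<noteq> i" using \<open>i \<noteq> j\<close> by simp
      then show ?thesis
        using SU[OF \<open>i < l\<close> \<open>j < l\<close> \<open>i \<noteq> j\<close> xy] SU[OF \<open>j < l\<close> \<open>i < l\<close> _ xy(2,1)] sym by metis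
    qed
    have k: "is_colouring {..<l} k"
      unfolding is_colouring_def using l Ssym by (auto simp: k_def)
    have notemb: "\<not> embeds F {..<l} k"
    proof
      assume "embeds F {..<l} k"
      then obtain \<phi> where \<phi>: "\<And>u. u \<in> verts F \<Longrightarrow> \<phi> u < l"
        and fit: "\<And>u v. u \<in> verts F \<Longrightarrow> v \<in> verts F \<Longrightarrow> u \<noteq> v \<Longrightarrow> fits (k (\<phi> u) (\<phi> v)) ({u, v} \<in> edges F)"
        unfolding embeds_def by auto
      have "\<exists>e. bij_betw e (verts F) (R i)" if "i < l" for i
        using finite_same_card_bij[OF fF finR[OF that]] R(2)[OF that] by (simp add: f_def)
      then obtain e where e: "\<And>i. i < l \<Longrightarrow> bij_betw (e i) (verts F) (R i)" by metis
      define \<sigma> where "\<sigma> u = e (\<phi> u) u" for u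
      have \<sigma>R: "\<sigma> u \<in> R (\<phi> u)" if "u \<in> verts F" for u
        using e[OF \<phi>[OF that]] that unfolding \<sigma>_def by (auto simp: bij_betw_def)
      have \<sigma>ne: "\<sigma> u \<noteq> \<sigma> v" if uv: "u \<in> verts F" "v \<in> verts F" "u \<noteq> v" for u v
      proof (cases "\<phi> u = \<phi> v")
        case True
        then show ?thesis using e[OF \<phi>[OF uv(1)]] uv unfolding \<sigma>_def by (auto simp: bij_betw_def dest: inj_onD)
      next
        case False
        then show ?thesis using SU[OF \<phi>[OF uv(1)] \<phi>[OF uv(2)] False] \<sigma>R uv R(1) \<phi> by blast
      qed
      have "has_copy F {..<m} \<tau> \<sigma>"
        unfolding has_copy_def
      proof (intro conjI ballI impI)
        show "\<sigma> ` verts F \<subseteq> {..<m}" using \<sigma>R R(1) U(1) \<phi> by blast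
        show "inj_on \<sigma> (verts F)" using \<sigma>ne by (auto simp: inj_on_def)
        fix u v assume uv: "u \<in> verts F" "v \<in> verts F" "u < v"
        then have ne: "u \<noteq> v" by simp
        note ft = fit[OF uv(1,2) ne]
        show "fits (\<tau> (\<sigma> u) (\<sigma> v)) ({u, v} \<in> edges F)"
        proof (cases "\<phi> u = \<phi> v")
          case True
          have m2: "\<sigma> u \<in> R (\<phi> u)" "\<sigma> v \<in> R (\<phi> u)" using \<sigma>R[OF uv(1)] \<sigma>R[OF uv(2)] True by auto
          show ?thesis
          proof (cases "clique (R (\<phi> u)) E")
            case cl: True
            then have "\<tau> (\<sigma> u) (\<sigma> v) = White"
              using m2 \<sigma>ne[OF uv(1,2) ne] E unfolding clique_def by auto
            then show ?thesis using ft True cl by (simp add: k_def)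
          next
            case cl: False
            then have "\<tau> (\<sigma> u) (\<sigma> v) \<noteq> White"
              using R(3)[OF \<phi>[OF uv(1)]] m2 \<sigma>ne[OF uv(1,2) ne] E unfolding indep_def by auto
            then show ?thesis using ft True cl by (auto simp: k_def fits_def split: if_splits)
          qed
        next
          case False
          then have "\<tau> (\<sigma> u) (\<sigma> v) = S (\<phi> u) (\<phi> v)"
            using SU[OF \<phi>[OF uv(1)] \<phi>[OF uv(2)] False] \<sigma>R uv R(1) \<phi> by blast
          then show ?thesis using ft False by (simp add: k_def)
        qed
      qed
      with no show False by blast
    qed
    define \<mu> where "\<mu> x = (if x < l then 1 / real l else 0)" for x :: nat
    have \<mu>: "\<mu> \<in> prob_masses {..<l}" using l by (simp add: prob_masses_def \<mu>_def)
    have "qform k p {..<l} \<mu> = (\<Sum>i<l. \<Sum>j<l. cost p (k i j)) / (real l)\<^sup>2"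
      unfolding qform_def \<mu>_def by (simp add: sum_divide_distrib power2_eq_square)
    also have "(\<Sum>i<l. \<Sum>j<l. cost p (k i j)) = (\<Sum>i<l. cost p (k i i) + (\<Sum>j\<in>{..<l} - {i}. cost p (S i j)))"
    proof (rule sum.cong[OF refl])
      fix i assume "i \<in> {..<l}"
      then have "(\<Sum>j<l. cost p (k i j)) = cost p (k i i) + (\<Sum>j\<in>{..<l} - {i}. cost p (k i j))"
        by (intro sum.remove) auto
      also have "(\<Sum>j\<in>{..<l} - {i}. cost p (k i j)) = (\<Sum>j\<in>{..<l} - {i}. cost p (S i j))"
        by (rule sum.cong) (auto simp: k_def)
      finally show "(\<Sum>j<l. cost p (k i j)) = cost p (k i i) + (\<Sum>j\<in>{..<l} - {i}. cost p (S i j))" .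
    qed
    also have "\<dots> \<le> (\<Sum>i<l. 1) + (real l)\<^sup>2 * (B + \<gamma>)"
      unfolding sum.distrib using cS[unfolded template_cost_def] cost_bounds[OF p] by (intro add_mono sum_mono) auto
    finally have "qform k p {..<l} \<mu> \<le> (real l + (real l)\<^sup>2 * (B + \<gamma>)) / (real l)\<^sup>2"
      by (simp add: divide_right_mono)
    also have "\<dots> = B + \<gamma> + 1 / real l" using l by (simp add: field_simps power2_eq_square)
    finally have "crg_g (crg_of {..<l} k) p \<le> B + \<gamma> + 1 / real l"
      using crg_g_crg_of[OF k, of p] INF_qform_le[OF p \<mu>, of k] by simp
    then show "\<exists>K\<in>crg_class (Forb F). crg_g K p \<le> B + \<gamma> + 1 / real l"
      using crg_of_class[OF k F notemb] by blast
  qed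
qed

section \<open>A quasirandom graph\<close>

text \<open>
  With \<open>x = (a, b)\<close> and \<open>y = (c, d)\<close> read off in base \<open>q\<close>, this is the value \<open>a c + b + d\<close>
  modulo \<open>q\<close>. For \<open>a \<noteq> a'\<close> the map \<open>(c, d) \<mapsto> (a c + b + d, a' c + b' + d)\<close> is a bijection modulo
  a prime \<open>q\<close>, so the rows of \<open>x\<close> and \<open>x'\<close> are exactly independent.
\<close>

definition hash :: "nat \<Rightarrow> nat \<Rightarrow> nat \<Rightarrow> nat" where
  "hash q x y = ((x div q) * (y div q) + x mod q + y mod q) mod q"

lemma hash_sym: "hash q x y = hash q y x"
  by (simp add: hash_def mult.commute add_ac)

lemma hash_pair_inj:
  assumes q: "prime q" and x: "x < q * q" "x' < q * q" "x div q \<noteq> x' div q"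
  shows "inj_on (\<lambda>y. (hash q x y, hash q x' y)) {..<q * q}"
proof (rule inj_onI)
  fix y z assume yz: "y \<in> {..<q * q}" "z \<in> {..<q * q}" and e: "(hash q x y, hash q x' y) = (hash q x z, hash q x' z)"
  have q0: "q > 0" using q by (rule prime_gt_0_nat)
  define a a' b b' c d c2 d2 where defs: "a = int (x div q)" "a' = int (x' div q)" "b = int (x mod q)" "b' = int (x' mod q)"
    "c = int (y div q)" "d = int (y mod q)" "c2 = int (z div q)" "d2 = int (z mod q)"
  have dv: "u div q < q" if "u < q * q" for u using that by (simp add: less_mult_imp_div_less)
  have r: "0 \<le> a" "a < int q" "0 \<le> a'" "a' < int q" "0 \<le> c" "c < int q" "0 \<le> c2" "c2 < int q"
     "0 \<le> d" "d < int q" "0 \<le> d2" "d2 < int q"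
    using dv[OF x(1)] dv[OF x(2)] dv[of y] dv[of z] yz q0 by (auto simp: defs)
  have abs_r: "\<bar>a - a'\<bar> < int q" "\<bar>c - c2\<bar> < int q" "\<bar>d - d2\<bar> < int q" using r by linarith+
  have "int (hash q x y) = int (hash q x z)" "int (hash q x' y) = int (hash q x' z)" using e by auto
  then have m: "(a * c + b + d) mod int q = (a * c2 + b + d2) mod int q"
     "(a' * c + b' + d) mod int q = (a' * c2 + b' + d2) mod int q"
    by (simp_all add: hash_def defs zmod_int)
  have "int q dvd (a * c + b + d) - (a * c2 + b + d2)" "int q dvd (a' * c + b' + d) - (a' * c2 + b' + d2)"
    using m by (simp_all add: mod_eq_dvd_iff)
  then have "int q dvd ((a * c + b + d) - (a * c2 + b + d2)) - ((a' * c + b' + d) - (a' * c2 + b' + d2))"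
    by (rule dvd_diff)
  also have "((a * c + b + d) - (a * c2 + b + d2)) - ((a' * c + b' + d) - (a' * c2 + b' + d2)) = (a - a') * (c - c2)"
    by (simp add: algebra_simps)
  finally have "int q dvd (a - a') * (c - c2)" .
  then have "int q dvd a - a' \<or> int q dvd c - c2"
    using q by (simp add: prime_dvd_mult_iff)
  moreover have small: "u = 0" if "int q dvd u" "\<bar>u\<bar> < int q" for u
    using that zdvd_not_zless[of "\<bar>u\<bar>" "int q"] by (cases "u = 0") auto
  have "a \<noteq> a'" using x(3) by (simp add: defs)
  then have "\<not> int q dvd a - a'" using small[of "a - a'"] abs_r(1) by auto
  ultimately have "int q dvd c - c2" by blast
  then have c: "c = c2" using small[of "c - c2"] abs_r(2) by auto
  have "int q dvd d - d2"
    using \<open>int q dvd (a * c + b + d) - (a * c2 + b + d2)\<close> c by simp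
  then have "d = d2" using small[of "d - d2"] abs_r(3) by auto
  then have "y div q = z div q" "y mod q = z mod q" using c by (auto simp: defs)
  then show "y = z" by (metis div_mult_mod_eq)
qed

lemma hash_orthogonal:
  fixes B :: "nat \<Rightarrow> real"
  assumes q: "prime q" and x: "x < q * q" "x' < q * q" "x div q \<noteq> x' div q" and B: "(\<Sum>u<q. B u) = 0"
  shows "(\<Sum>y<q * q. B (hash q x y) * B (hash q x' y)) = 0"
proof -
  let ?f = "\<lambda>y. (hash q x y, hash q x' y)"
  have q0: "q > 0" using q by (rule prime_gt_0_nat)
  have inj: "inj_on ?f {..<q * q}" by (rule hash_pair_inj[OF q x])
  have sub: "?f ` {..<q * q} \<subseteq> {..<q} \<times> {..<q}" using q0 by (auto simp: hash_def)
  have im: "?f ` {..<q * q} = {..<q} \<times> {..<q}"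
    by (rule card_subset_eq[OF _ sub]) (simp_all add: card_image[OF inj] card_cartesian_product)
  have "(\<Sum>y<q * q. B (hash q x y) * B (hash q x' y)) = (\<Sum>(u, v)\<in>?f ` {..<q * q}. B u * B v)"
    by (subst sum.reindex[OF inj]) simp
  also have "\<dots> = (\<Sum>u<q. \<Sum>v<q. B u * B v)" unfolding im by (simp add: sum.cartesian_product)
  also have "\<dots> = (\<Sum>u<q. B u) * (\<Sum>v<q. B v)" by (simp add: sum_product)
  finally show ?thesis using B by simp
qed

text \<open>
  By Cauchy--Schwarz in \<open>y\<close>, only pairs of rows that are not orthogonal count, and these share
  the high digit. This gives \<open>|V|\<^sup>3 q = q\<^sup>7\<close>, to be compared with the trivial bound
  \<open>|V|\<^sup>4 = q\<^sup>8\<close>.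
\<close>

lemma hash_discrepancy:
  fixes B :: "nat \<Rightarrow> real"
  assumes q: "prime q" and B: "(\<Sum>u<q. B u) = 0" "\<And>u. \<bar>B u\<bar> \<le> 1"
    and ST: "S \<subseteq> {..<q * q}" "T \<subseteq> {..<q * q}"
  shows "(\<Sum>x\<in>S. \<Sum>y\<in>T. B (hash q x y))\<^sup>2 \<le> real q ^ 7"
proof -
  let ?n = "real (q * q)"
  have q0: "q > 0" using q by (rule prime_gt_0_nat)
  have fS: "finite S" "finite T" using ST finite_subset by auto
  have cS: "real (card S) \<le> ?n" "real (card T) \<le> ?n"
    using card_mono[OF finite_lessThan ST(1)] card_mono[OF finite_lessThan ST(2)] by (simp_all flip: of_nat_mult)
  have "(\<Sum>x\<in>S. \<Sum>y\<in>T. B (hash q x y)) = (\<Sum>y\<in>T. 1 * (\<Sum>x\<in>S. B (hash q x y)))"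
    by (subst sum.swap) simp
  then have "(\<Sum>x\<in>S. \<Sum>y\<in>T. B (hash q x y))\<^sup>2 \<le> (\<Sum>y\<in>T. 1\<^sup>2) * (\<Sum>y\<in>T. (\<Sum>x\<in>S. B (hash q x y))\<^sup>2)"
    using Cauchy_Schwarz_ineq_sum[of "\<lambda>_. 1" "\<lambda>y. \<Sum>x\<in>S. B (hash q x y)" T] by simp
  also have "\<dots> \<le> ?n * (\<Sum>y<q * q. (\<Sum>x\<in>S. B (hash q x y))\<^sup>2)"
    using cS ST(2) by (intro mult_mono sum_mono2) (auto intro!: sum_nonneg)
  also have "(\<Sum>y<q * q. (\<Sum>x\<in>S. B (hash q x y))\<^sup>2) = (\<Sum>y<q * q. \<Sum>x\<in>S. \<Sum>x'\<in>S. B (hash q x y) * B (hash q x' y))"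
    by (simp add: power2_eq_square sum_product)
  also have "\<dots> = (\<Sum>x\<in>S. \<Sum>x'\<in>S. \<Sum>y<q * q. B (hash q x y) * B (hash q x' y))"
    by (subst sum.swap, rule sum.cong[OF refl], rule sum.swap)
  also have "\<dots> \<le> (\<Sum>x\<in>S. \<Sum>x'\<in>S. ?n * of_bool (x' div q = x div q))"
  proof (intro sum_mono)
    fix x x' assume xx: "x \<in> S" "x' \<in> S"
    show "(\<Sum>y<q * q. B (hash q x y) * B (hash q x' y)) \<le> ?n * of_bool (x' div q = x div q)"
    proof (cases "x' div q = x div q")
      case True
      have "(\<Sum>y<q * q. B (hash q x y) * B (hash q x' y)) \<le> (\<Sum>y<q * q. 1)"
      proof (rule sum_mono)
        fix y
        have "\<bar>B (hash q x y) * B (hash q x' y)\<bar> \<le> 1 * 1"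
          unfolding abs_mult by (intro mult_mono B(2)) auto
        then show "B (hash q x y) * B (hash q x' y) \<le> 1" by linarith
      qed
      then show ?thesis using True by simp
    next
      case False
      then show ?thesis using hash_orthogonal[OF q _ _ _ B(1), of x x'] xx ST(1) by force
    qed
  qed
  also have "\<dots> \<le> (\<Sum>x\<in>S. ?n * real q)"
  proof (rule sum_mono)
    fix x assume "x \<in> S"
    have "{x' \<in> S. x' div q = x div q} \<subseteq> {(x div q) * q..<(x div q) * q + q}"
    proof
      fix x' assume "x' \<in> {x' \<in> S. x' div q = x div q}"
      then have "x' = (x div q) * q + x' mod q" by (metis (mono_tags) div_mult_mod_eq mem_Collect_eq)
      moreover have "x' mod q < q" using q0 by simp
      ultimately show "x' \<in> {(x div q) * q..<(x div q) * q + q}" by (metis atLeastLessThan_iff le_add1 nat_add_left_cancel_less)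
    qed
    then have "card {x' \<in> S. x' div q = x div q} \<le> card {(x div q) * q..<(x div q) * q + q}"
      by (rule card_mono[rotated]) simp
    then have "real (card {x' \<in> S. x' div q = x div q}) \<le> real q" by simp
    then have "(\<Sum>x'\<in>S. of_bool (x' div q = x div q)) \<le> real q" using card_as_sum[OF fS(1)] by metis
    then show "(\<Sum>x'\<in>S. ?n * of_bool (x' div q = x div q)) \<le> ?n * real q"
      unfolding sum_distrib_left[symmetric] by (rule mult_left_mono) simp
  qed
  also have "\<dots> = real (card S) * (?n * real q)" by simp
  also have "\<dots> \<le> ?n * (?n * real q)" using cS by (intro mult_right_mono) auto
  finally have "(\<Sum>x\<in>S. \<Sum>y\<in>T. B (hash q x y))\<^sup>2 \<le> ?n * (?n * (?n * real q))" by (simp add: mult_left_mono)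
  also have "\<dots> = real q ^ 7" by (simp add: eval_nat_numeral)
  finally show ?thesis .
qed

lemma exists_edge_set_near:
  assumes P: "finite P" and E0: "E0 \<subseteq> P" and e: "e \<le> card P"
  shows "\<exists>E\<subseteq>P. card E = e \<and> (E \<subseteq> E0 \<or> E0 \<subseteq> E)"
proof (cases "e \<le> card E0")
  case True
  then obtain E where "E \<subseteq> E0" "card E = e" by (rule obtain_subset_with_card_n)
  then show ?thesis using E0 by blast
next
  case False
  have fE0: "finite E0" using E0 P finite_subset by blast
  have "e - card E0 \<le> card (P - E0)" using e card_Diff_subset[OF fE0 E0] by simp
  then obtain E1 where E1: "E1 \<subseteq> P - E0" "card E1 = e - card E0" by (rule obtain_subset_with_card_n)
  have "card (E0 \<union> E1) = e"
    using card_Un_disjoint[OF fE0, of E1] E1 False P by (auto intro: finite_subset)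
  then show ?thesis using E0 E1 by (intro exI[of _ "E0 \<union> E1"]) auto
qed

text \<open>
  Join \<open>x\<close> and \<open>y\<close> if their hash lies below \<open>p q\<close>. Taking both sets to be everything, small
  discrepancy already says that the number of edges is nearly right, so few edges have to be
  added or removed to make it exact.
\<close>

lemma quasirandom_graph:
  assumes p: "p \<in> {0..1::real}" and \<epsilon>: "\<epsilon> > 0"
  shows "\<exists>n\<ge>n0. \<exists>G. is_graph G \<and> verts G = {..<n} \<and> int (card (edges G)) = \<lfloor>p * real (n choose 2)\<rfloor> \<and>
     cut_close {..<n} \<epsilon> (adj G) (\<lambda>_ _. p)"
proof -
  \<comment> \<open>The first term brings the discrepancy down to \<open>\<epsilon>/8\<close>; the second one absorbs the rounding of \<open>p q\<close>
    and the diagonal.\<close>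
  obtain q1 :: nat where q1: "64 / \<epsilon>\<^sup>2 + 16 / \<epsilon> + real n0 + 2 < real q1" using reals_Archimedean2 by blast
  obtain q where q: "prime q" "q1 < q" using bigger_prime by blast
  define n where "n = q * q"
  let ?V = "{..<n}" and ?q = "real q" and ?n = "real n"
  have pos: "0 \<le> 64 / \<epsilon>\<^sup>2" "0 \<le> 16 / \<epsilon>" using \<epsilon> by auto
  have ql: "64 / \<epsilon>\<^sup>2 \<le> ?q" "16 / \<epsilon> \<le> ?q" "real n0 \<le> ?q" "2 \<le> ?q" using q1 q(2) pos by linarith+
  have q0: "?q > 0" using ql by linarith
  have nq: "?n = ?q\<^sup>2" by (simp add: n_def power2_eq_square)
  have nge: "?q \<le> ?n" unfolding nq power2_eq_square using ql(4) by simp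
  have n2: "2 \<le> ?n" using nge ql by linarith
  define s where "s = nat \<lfloor>p * ?q\<rfloor>"
  have sb: "real s \<le> p * ?q" "p * ?q < real s + 1" "s \<le> q"
  proof -
    have "0 \<le> p * ?q" using p by simp
    then have "real s = of_int \<lfloor>p * ?q\<rfloor>" by (simp add: s_def)
    then show 1: "real s \<le> p * ?q" "p * ?q < real s + 1" by linarith+
    have "p * ?q \<le> ?q" using p by (intro mult_left_le_one_le) auto
    with 1 show "s \<le> q" by linarith
  qed
  define B where "B u = of_bool (u < s) - real s / ?q" for u
  have Bs: "(\<Sum>u<q. B u) = 0"
  proof -
    have "(\<Sum>u<q. of_bool (u < s)) = real (card {u \<in> {..<q}. u < s})" using card_as_sum[of "{..<q}" "\<lambda>u. u < s"] by simp
    also have "{u \<in> {..<q}. u < s} = {..<s}" using sb by auto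
    finally show ?thesis using q0 by (simp add: B_def sum_subtractf)
  qed
  have Bb: "\<bar>B u\<bar> \<le> 1" for u
  proof -
    have "0 \<le> real s / ?q" "real s / ?q \<le> 1" using sb q0 by auto
    moreover have "0 \<le> (of_bool (u < s) :: real)" "(of_bool (u < s) :: real) \<le> 1" by simp_all
    ultimately show ?thesis unfolding B_def by linarith
  qed
  define E0 where "E0 = {{x, y} | x y. x \<in> ?V \<and> y \<in> ?V \<and> x \<noteq> y \<and> hash q x y < s}"
  define G0 where "G0 = \<lparr>verts = ?V, edges = E0\<rparr>"
  have E0: "E0 \<subseteq> all_pairs ?V" by (auto simp: E0_def all_pairs_def)
  have E0m: "{x, y} \<in> E0 \<longleftrightarrow> x \<noteq> y \<and> hash q x y < s" if "x \<in> ?V" "y \<in> ?V" for x y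
    using that hash_sym[of q] unfolding E0_def by (auto simp: doubleton_eq_iff)
  define \<delta> where "\<delta> = \<epsilon> / 8 + 1 / ?q + 1 / ?n"
  have cut0: "\<bar>\<Sum>x\<in>S. \<Sum>y\<in>T. adj G0 x y - p\<bar> \<le> \<delta> * ?n\<^sup>2" if ST: "S \<subseteq> ?V" "T \<subseteq> ?V" for S T
  proof -
    have fST: "finite S" "finite T" using ST finite_subset by auto
    have cST: "real (card S) \<le> ?n" "real (card T) \<le> ?n"
      using card_mono[OF finite_lessThan ST(1)] card_mono[OF finite_lessThan ST(2)] by simp_all
    have "adj G0 x y - p = B (hash q x y) + ((real s / ?q - p) - of_bool (x = y) * of_bool (hash q x y < s))"
      if "x \<in> S" "y \<in> T" for x y
      using E0m[of x y] that ST by (auto simp: adj_def G0_def B_def)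
    then have "(\<Sum>x\<in>S. \<Sum>y\<in>T. adj G0 x y - p) =
      (\<Sum>x\<in>S. \<Sum>y\<in>T. B (hash q x y)) + ((\<Sum>x\<in>S. \<Sum>y\<in>T. real s / ?q - p) - (\<Sum>x\<in>S. \<Sum>y\<in>T. of_bool (x = y) * of_bool (hash q x y < s)))"
      by (simp add: sum.distrib sum_subtractf right_diff_distrib cong: sum.cong)
    moreover have "\<bar>\<Sum>x\<in>S. \<Sum>y\<in>T. B (hash q x y)\<bar> \<le> \<epsilon> / 8 * ?n\<^sup>2"
    proof (rule power2_le_imp_le)
      have "64 \<le> ?q * \<epsilon>\<^sup>2" using ql(1) \<epsilon> by (simp add: field_simps)
      then have "?q ^ 7 * 64 \<le> ?q ^ 7 * (?q * \<epsilon>\<^sup>2)" by (intro mult_left_mono) auto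
      moreover have "(\<epsilon> / 8 * ?n\<^sup>2)\<^sup>2 * 64 = ?q ^ 7 * (?q * \<epsilon>\<^sup>2)"
        unfolding nq by (simp add: power2_eq_square eval_nat_numeral)
      ultimately have "?q ^ 7 \<le> (\<epsilon> / 8 * ?n\<^sup>2)\<^sup>2" by linarith
      moreover have "(\<Sum>x\<in>S. \<Sum>y\<in>T. B (hash q x y))\<^sup>2 \<le> ?q ^ 7"
        using hash_discrepancy[OF q(1) Bs Bb, of S T] ST by (simp add: n_def)
      ultimately show "\<bar>\<Sum>x\<in>S. \<Sum>y\<in>T. B (hash q x y)\<bar>\<^sup>2 \<le> (\<epsilon> / 8 * ?n\<^sup>2)\<^sup>2" by simp
    qed (use \<epsilon> in simp)
    moreover have "\<bar>\<Sum>x\<in>S. \<Sum>y\<in>T. real s / ?q - p\<bar> \<le> 1 / ?q * ?n\<^sup>2"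
    proof -
      have "real s / ?q \<le> p" "p \<le> (real s + 1) / ?q"
        using sb q0 by (simp_all add: pos_divide_le_eq pos_le_divide_eq)
      then have "\<bar>real s / ?q - p\<bar> \<le> 1 / ?q" unfolding add_divide_distrib by linarith
      then have "real (card S) * (real (card T) * \<bar>real s / ?q - p\<bar>) \<le> ?n * (?n * (1 / ?q))"
        using cST by (intro mult_mono) auto
      then show ?thesis by (simp add: abs_mult power2_eq_square mult_ac)
    qed
    moreover have "\<bar>\<Sum>x\<in>S. \<Sum>y\<in>T. of_bool (x = y) * of_bool (hash q x y < s)\<bar> \<le> 1 / ?n * ?n\<^sup>2"
    proof -
      have "(\<Sum>x\<in>S. \<Sum>y\<in>T. of_bool (x = y) * of_bool (hash q x y < s)) \<le> (\<Sum>x\<in>S. 1 :: real)"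
      proof (rule sum_mono)
        fix x
        have "(\<Sum>y\<in>T. of_bool (x = y) * of_bool (hash q x y < s)) \<le> (\<Sum>y\<in>T. if x = y then 1 else 0 :: real)"
          by (intro sum_mono) auto
        also have "\<dots> \<le> 1" using fST by simp
        finally show "(\<Sum>y\<in>T. of_bool (x = y) * of_bool (hash q x y < s)) \<le> (1 :: real)" .
      qed
      then have "(\<Sum>x\<in>S. \<Sum>y\<in>T. of_bool (x = y) * of_bool (hash q x y < s)) \<le> ?n" using cST by simp
      moreover have "0 \<le> (\<Sum>x\<in>S. \<Sum>y\<in>T. of_bool (x = y) * of_bool (hash q x y < s) :: real)"
        by (intro sum_nonneg) simp
      ultimately show ?thesis using n2 by (simp add: power2_eq_square)
    qed
    ultimately show ?thesis by (simp add: \<delta>_def distrib_right)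
  qed
  obtain e where e: "e \<le> n choose 2" "int e = \<lfloor>p * real (n choose 2)\<rfloor>" using exists_edge_count[OF p] by blast
  have fP: "finite (all_pairs ?V)" by (rule finite_all_pairs) simp
  obtain E where E: "E \<subseteq> all_pairs ?V" "card E = e" "E \<subseteq> E0 \<or> E0 \<subseteq> E"
    using exists_edge_set_near[OF fP E0, of e] e card_all_pairs[of ?V] by auto
  define G where "G = \<lparr>verts = ?V, edges = E\<rparr>"
  have adjsum: "(\<Sum>x\<in>?V. \<Sum>y\<in>?V. adj G x y) = 2 * real e" "(\<Sum>x\<in>?V. \<Sum>y\<in>?V. adj G0 x y) = 2 * real (card E0)"
    using sum_adjacency[OF _ E(1)] sum_adjacency[OF _ E0] E(2) by (simp_all add: adj_def G_def G0_def)
  have "\<bar>2 * real (card E0) - p * ?n\<^sup>2\<bar> \<le> \<delta> * ?n\<^sup>2"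
    using cut0[of ?V ?V] adjsum(2) by (simp add: sum_subtractf power2_eq_square mult_ac)
  moreover have "\<bar>2 * real e - p * ?n\<^sup>2\<bar> \<le> ?n + 2"
  proof -
    have "real e = of_int \<lfloor>p * real (n choose 2)\<rfloor>" using e(2) by (metis of_int_of_nat_eq)
    then have f: "real e \<le> p * real (n choose 2)" "p * real (n choose 2) < real e + 1" by linarith+
    have N: "2 * (p * real (n choose 2)) = p * ?n\<^sup>2 - p * ?n" by (simp add: real_choose_two power2_eq_square field_simps)
    have "0 \<le> p * ?n" "p * ?n \<le> ?n" using p by (auto intro: mult_left_le_one_le)
    then show ?thesis using f N by linarith
  qed
  ultimately have diff: "\<bar>2 * real e - 2 * real (card E0)\<bar> \<le> \<delta> * ?n\<^sup>2 + ?n + 2" by linarith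
  have move: "\<bar>\<Sum>x\<in>S. \<Sum>y\<in>T. adj G x y - adj G0 x y\<bar> \<le> \<bar>2 * real e - 2 * real (card E0)\<bar>"
    if ST: "S \<subseteq> ?V" "T \<subseteq> ?V" for S T
  proof -
    have key: "\<bar>\<Sum>x\<in>S. \<Sum>y\<in>T. g x y\<bar> \<le> \<bar>\<Sum>x\<in>?V. \<Sum>y\<in>?V. g x y\<bar>"
      if "\<And>x y. g x y \<ge> 0" for g :: "nat \<Rightarrow> nat \<Rightarrow> real"
    proof -
      have "(\<Sum>x\<in>S. \<Sum>y\<in>T. g x y) \<le> (\<Sum>x\<in>?V. \<Sum>y\<in>?V. g x y)"
        using ST that by (intro order_trans[OF sum_mono[OF sum_mono2] sum_mono2]) (auto intro: sum_nonneg)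
      moreover have "0 \<le> (\<Sum>x\<in>S. \<Sum>y\<in>T. g x y)" using that by (intro sum_nonneg)
      ultimately show ?thesis by simp
    qed
    show ?thesis
    proof (cases "E0 \<subseteq> E")
      case True
      then have "0 \<le> adj G x y - adj G0 x y" for x y by (auto simp: adj_def G_def G0_def)
      from key[of "\<lambda>x y. adj G x y - adj G0 x y", OF this] show ?thesis using adjsum by (simp add: sum_subtractf)
    next
      case False
      then have "E \<subseteq> E0" using E(3) by blast
      then have "0 \<le> adj G0 x y - adj G x y" for x y by (auto simp: adj_def G_def G0_def)
      from key[of "\<lambda>x y. adj G0 x y - adj G x y", OF this] show ?thesis
        using adjsum by (simp add: sum_subtractf abs_minus_commute)
    qed
  qed
  have "cut_close ?V \<epsilon> (adj G) (\<lambda>_ _. p)"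
    unfolding cut_close_def
  proof (intro allI impI)
    fix S T assume ST: "S \<subseteq> ?V" "T \<subseteq> ?V"
    have "(\<Sum>x\<in>S. \<Sum>y\<in>T. adj G x y - p) = (\<Sum>x\<in>S. \<Sum>y\<in>T. adj G x y - adj G0 x y) + (\<Sum>x\<in>S. \<Sum>y\<in>T. adj G0 x y - p)"
      by (simp add: sum.distrib[symmetric])
    then have "\<bar>\<Sum>x\<in>S. \<Sum>y\<in>T. adj G x y - p\<bar> \<le> (\<delta> * ?n\<^sup>2 + ?n + 2) + \<delta> * ?n\<^sup>2"
      using move[OF ST] cut0[OF ST] diff by linarith
    also have "\<dots> \<le> 2 * \<delta> * ?n\<^sup>2 + 2 * ?n" using n2 by simp
    also have "\<dots> \<le> \<epsilon> * ?n\<^sup>2"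
    proof -
      have iq: "1 / ?q \<le> \<epsilon> / 16" using ql(2) q0 \<epsilon> by (simp add: field_simps)
      have "1 / ?n \<le> 1 / ?q" using nge q0 by (simp add: frac_le)
      then have "\<delta> \<le> \<epsilon> / 4" "2 / ?n \<le> \<epsilon> / 8" unfolding \<delta>_def using iq by linarith+
      then have "2 * \<delta> + 2 / ?n \<le> \<epsilon>" using \<epsilon> by linarith
      then have "(2 * \<delta> + 2 / ?n) * ?n\<^sup>2 \<le> \<epsilon> * ?n\<^sup>2" by (intro mult_right_mono) auto
      then show ?thesis using n2 by (simp add: distrib_right power2_eq_square)
    qed
    finally show "\<bar>\<Sum>x\<in>S. \<Sum>y\<in>T. adj G x y - p\<bar> \<le> \<epsilon> * (real (card ?V))\<^sup>2" by simp
  qed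
  moreover have "is_graph G" "verts G = ?V" "int (card (edges G)) = \<lfloor>p * real (n choose 2)\<rfloor>"
    using E e by (simp_all add: G_def is_graph_def)
  moreover have "n \<ge> n0" using ql(3) nge by linarith
  ultimately show ?thesis by blast
qed

section \<open>CRGs bound the edit distance from below\<close>

text \<open>
  The direction of the edits that a colour demands: on white pairs of \<open>G\<close> edges have to be
  deleted, on black pairs they have to be added.
\<close>

definition colour_sign :: "colour \<Rightarrow> real" where
  "colour_sign c = (case c of White \<Rightarrow> 1 | Black \<Rightarrow> -1 | Gray \<Rightarrow> 0)"

text \<open>
  Test the edits \<open>G - H\<close> against the colour signs \<open>\<phi>\<close>, which are constant on blocks: there \<open>H\<close>
  may be replaced by its block means, and \<open>G\<close> by \<open>p\<close> at the price of \<open>\<epsilon>\<close> per block. What remains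
  is the cost of the colours, up to \<open>\<eta>\<close>.
\<close>

lemma template_cost_le_edits:
  fixes V :: "nat set"
  assumes V: "finite V" and p: "p \<in> {0..1}" and c: "\<And>x. c x < (k :: nat)"
    and qr: "cut_close V \<epsilon> (adj G) (\<lambda>_ _. p)" and \<epsilon>: "\<epsilon> \<ge> 0" and \<eta>: "\<eta> \<ge> 0"
  shows "(\<Sum>x\<in>V. \<Sum>y\<in>V. cost p (threshold \<eta> (block_mean V c (adj H) x y))) \<le>
     (\<Sum>x\<in>V. \<Sum>y\<in>V. \<bar>adj G x y - adj H x y\<bar>) + (\<eta> + (real k)\<^sup>2 * \<epsilon>) * (real (card V))\<^sup>2"
proof -
  define h where "h = block_mean V c (adj H)"
  define \<phi> where "\<phi> x y = colour_sign (threshold \<eta> (h x y))" for x y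
  let ?n = "real (card V)"
  let ?\<Sigma> = "\<lambda>g. \<Sum>x\<in>V. \<Sum>y\<in>V. (g x y :: real)"
  have \<phi>lab: "\<phi> x y = \<phi> x' y'" if "c x = c x'" "c y = c y'" for x y x' y'
    using block_mean_label_cong[of c x x' y y' V "adj H"] that by (simp add: \<phi>_def h_def)
  have \<phi>1: "\<bar>\<phi> x y\<bar> \<le> 1" for x y
    unfolding \<phi>_def colour_sign_def by (cases "threshold \<eta> (h x y)") auto
  have h01: "h x y \<in> {0..1}" if "x \<in> V" "y \<in> V" for x y
    unfolding h_def by (rule block_mean_bounds[OF V _ that]) (simp add: adj_def)
  have pt: "cost p (threshold \<eta> (h x y)) - \<eta> \<le> \<phi> x y * (p - h x y)" if "x \<in> V" "y \<in> V" for x y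
    using h01[OF that] p \<eta> unfolding \<phi>_def threshold_def colour_sign_def by auto
  have proj: "?\<Sigma> (\<lambda>x y. h x y * \<phi> x y) = ?\<Sigma> (\<lambda>x y. adj H x y * \<phi> x y)"
    unfolding h_def by (rule block_mean_projection[OF V]) (rule \<phi>lab)
  have blocks: "?\<Sigma> (\<lambda>x y. \<phi> x y * (adj G x y - p)) \<ge> - ((real k)\<^sup>2 * \<epsilon> * ?n\<^sup>2)"
  proof -
    let ?P = "\<lambda>i. {x \<in> V. c x = i}"
    have grp: "(\<Sum>x\<in>V. f x) = (\<Sum>i<k. \<Sum>x\<in>?P i. f x)" for f :: "nat \<Rightarrow> real"
      by (rule sum.group[symmetric, OF V]) (use c in auto)
    have "?\<Sigma> (\<lambda>x y. \<phi> x y * (adj G x y - p)) = (\<Sum>i<k. \<Sum>x\<in>?P i. \<Sum>j<k. \<Sum>y\<in>?P j. \<phi> x y * (adj G x y - p))"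
      by (subst grp, rule sum.cong[OF refl], rule sum.cong[OF refl], rule grp)
    also have "\<dots> = (\<Sum>i<k. \<Sum>j<k. \<Sum>x\<in>?P i. \<Sum>y\<in>?P j. \<phi> x y * (adj G x y - p))"
      by (rule sum.cong[OF refl], rule sum.swap)
    finally have eq: "?\<Sigma> (\<lambda>x y. \<phi> x y * (adj G x y - p)) = (\<Sum>i<k. \<Sum>j<k. \<Sum>x\<in>?P i. \<Sum>y\<in>?P j. \<phi> x y * (adj G x y - p))" .
    have "(\<Sum>i<k. \<Sum>j<k. - (\<epsilon> * ?n\<^sup>2)) \<le> (\<Sum>i<k. \<Sum>j<k. \<Sum>x\<in>?P i. \<Sum>y\<in>?P j. \<phi> x y * (adj G x y - p))"
    proof (intro sum_mono)
      fix i j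
      show "- (\<epsilon> * ?n\<^sup>2) \<le> (\<Sum>x\<in>?P i. \<Sum>y\<in>?P j. \<phi> x y * (adj G x y - p))"
      proof (cases "?P i = {} \<or> ?P j = {}")
        case True
        have "(\<Sum>x\<in>?P i. \<Sum>y\<in>?P j. \<phi> x y * (adj G x y - p)) = 0"
        proof (cases "?P i = {}")
          case False
          then have "?P j = {}" using True by blast
          then show ?thesis by (simp only: sum.empty sum.neutral_const)
        qed (simp only: sum.empty)
        then show ?thesis using \<epsilon> by simp
      next
        case False
        then obtain x0 y0 where xy0: "x0 \<in> ?P i" "y0 \<in> ?P j" by blast
        have "(\<Sum>x\<in>?P i. \<Sum>y\<in>?P j. \<phi> x y * (adj G x y - p)) = (\<Sum>x\<in>?P i. \<Sum>y\<in>?P j. \<phi> x0 y0 * (adj G x y - p))"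
        proof (rule sum.cong[OF refl], rule sum.cong[OF refl])
          fix x y assume "x \<in> ?P i" "y \<in> ?P j"
          then have "\<phi> x y = \<phi> x0 y0" using xy0 by (intro \<phi>lab) auto
          then show "\<phi> x y * (adj G x y - p) = \<phi> x0 y0 * (adj G x y - p)" by simp
        qed
        then have "\<bar>\<Sum>x\<in>?P i. \<Sum>y\<in>?P j. \<phi> x y * (adj G x y - p)\<bar> = \<bar>\<phi> x0 y0\<bar> * \<bar>\<Sum>x\<in>?P i. \<Sum>y\<in>?P j. adj G x y - p\<bar>"
          by (simp only: sum_distrib_left[symmetric] abs_mult)
        also have "\<dots> \<le> 1 * \<bar>\<Sum>x\<in>?P i. \<Sum>y\<in>?P j. adj G x y - p\<bar>" by (intro mult_right_mono \<phi>1) simp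
        also have "\<dots> \<le> \<epsilon> * ?n\<^sup>2"
        proof -
          have "?P i \<subseteq> V" "?P j \<subseteq> V" by auto
          with qr show ?thesis unfolding cut_close_def by simp
        qed
        finally show ?thesis by linarith
      qed
    qed
    moreover have "(\<Sum>i<k. \<Sum>j<k. - (\<epsilon> * ?n\<^sup>2)) = - ((real k)\<^sup>2 * \<epsilon> * ?n\<^sup>2)"
      by (simp add: power2_eq_square)
    ultimately show ?thesis unfolding eq by linarith
  qed
  have "?\<Sigma> (\<lambda>x y. cost p (threshold \<eta> (h x y)) - \<eta>) \<le> ?\<Sigma> (\<lambda>x y. \<phi> x y * (p - h x y))"
    by (intro sum_mono pt)
  also have "\<dots> = ?\<Sigma> (\<lambda>x y. \<phi> x y * (adj G x y - adj H x y)) - ?\<Sigma> (\<lambda>x y. \<phi> x y * (adj G x y - p))"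
    using proj by (simp add: right_diff_distrib sum_subtractf mult.commute)
  also have "\<dots> \<le> ?\<Sigma> (\<lambda>x y. \<bar>adj G x y - adj H x y\<bar>) + (real k)\<^sup>2 * \<epsilon> * ?n\<^sup>2"
  proof -
    have "?\<Sigma> (\<lambda>x y. \<phi> x y * (adj G x y - adj H x y)) \<le> ?\<Sigma> (\<lambda>x y. \<bar>adj G x y - adj H x y\<bar>)"
    proof (intro sum_mono)
      fix x y
      have "\<bar>\<phi> x y * (adj G x y - adj H x y)\<bar> \<le> 1 * \<bar>adj G x y - adj H x y\<bar>"
        unfolding abs_mult by (intro mult_right_mono \<phi>1) simp
      then show "\<phi> x y * (adj G x y - adj H x y) \<le> \<bar>adj G x y - adj H x y\<bar>"
        using order_trans[OF abs_ge_self] by simp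
    qed
    then show ?thesis using blocks by linarith
  qed
  finally have "?\<Sigma> (\<lambda>x y. cost p (threshold \<eta> (h x y)) - \<eta>) \<le> ?\<Sigma> (\<lambda>x y. \<bar>adj G x y - adj H x y\<bar>) + (real k)\<^sup>2 * \<epsilon> * ?n\<^sup>2" .
  moreover have "?\<Sigma> (\<lambda>x y. cost p (threshold \<eta> (h x y)) - \<eta>) = ?\<Sigma> (\<lambda>x y. cost p (threshold \<eta> (h x y))) - \<eta> * ?n\<^sup>2"
    by (simp add: sum_subtractf power2_eq_square)
  ultimately show ?thesis unfolding h_def by (simp add: distrib_right)
qed

lemma sum_edits:
  assumes G: "is_graph G" and H: "is_graph H" "verts H = verts G" and n: "card (verts G) = n" "n \<ge> 2"
  shows "(\<Sum>x\<in>verts G. \<Sum>y\<in>verts G. \<bar>adj G x y - adj H x y\<bar>) \<le> graph_dist G H * (real n)\<^sup>2"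
proof -
  let ?V = "verts G"
  define Q where "Q = edges G - edges H \<union> (edges H - edges G)"
  have V: "finite ?V" using G by (simp add: is_graph_def)
  have Q: "Q \<subseteq> all_pairs ?V" unfolding Q_def by (rule symmetric_difference_subset[OF G H])
  have "(\<Sum>x\<in>?V. \<Sum>y\<in>?V. \<bar>adj G x y - adj H x y\<bar>) = (\<Sum>x\<in>?V. \<Sum>y\<in>?V. of_bool ({x, y} \<in> Q))"
    by (intro sum.cong refl) (auto simp: adj_def Q_def)
  also have "\<dots> = 2 * real (card Q)" by (rule sum_adjacency[OF V Q])
  also have "\<dots> = graph_dist G H * (real n * (real n - 1))"
  proof -
    have "real (n choose 2) > 0" using n(2) by (simp add: real_choose_two)
    then show ?thesis using n by (simp add: graph_dist_def Q_def real_choose_two)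
  qed
  also have "\<dots> \<le> graph_dist G H * (real n)\<^sup>2"
    using graph_dist_bounds(1)[OF G H] by (intro mult_left_mono) (auto simp: power2_eq_square algebra_simps)
  finally show ?thesis .
qed

text \<open>
  The parameters are chosen in the order \<open>\<gamma>\<close>, \<open>l\<close>, \<open>m\<close>, \<open>\<epsilon>\<close>, \<open>k\<close>, \<open>\<epsilon>'\<close>, \<open>n\<close>, each in terms of
  the earlier ones: the size of the CRG, the size of the sample, the accuracy and the number of
  parts of the regularity partition, and the quasirandomness and order of \<open>G\<close>.
\<close>

lemma crg_below_max_dist:
  assumes F: "is_graph F" and s: "spans_all (Forb F)" and p: "p \<in> {0..1}" and \<gamma>: "\<gamma> > 0"
  shows "\<exists>n\<ge>n0. \<exists>K\<in>crg_class (Forb F). crg_g K p \<le> max_dist (Forb F) p n + \<gamma>"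
proof -
  \<comment> \<open>The errors add up to \<open>5 g\<close>, and \<open>8 g \<le> 1\<close> keeps the bound on the cost of the sample below 2.\<close>
  define g where "g = min \<gamma> 1 / 8"
  have g: "0 < g" "g < 1" "g \<le> 1" "g \<le> 1 / 2" "5 * g \<le> \<gamma>" "8 * g \<le> 1" using \<gamma> by (auto simp: g_def)
  obtain l :: nat where l0: "1 / g < real l" using reals_Archimedean2 by blast
  have "real l > 0" using l0 g(1) by (smt (verit) divide_pos_pos)
  then have l: "l > 0" "1 / real l \<le> g" using l0 g(1) by (auto simp: field_simps)
  from crg_from_template[OF F l(1) g(1) g(3)] obtain m0 where
    m0: "\<forall>m\<ge>m0. \<forall>\<tau> p B. (\<forall>i j. \<tau> i j = \<tau> j i) \<longrightarrow> p \<in> {0..1} \<longrightarrow> 0 \<le> B \<longrightarrow> B \<le> 2 \<longrightarrow>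
     template_cost p m \<tau> \<le> (real m)\<^sup>2 * B \<longrightarrow>
     (\<forall>\<sigma>. \<not> has_copy F {..<m} \<tau> \<sigma>) \<longrightarrow>
     (\<exists>K\<in>crg_class (Forb F). crg_g K p \<le> B + g + 1 / real l)" ..
  define m where "m = max m0 1"
  have m: "m \<ge> m0" "m > 0" by (auto simp: m_def)
  from sample_template[OF F g(1) g(2) g(1) g(4) m(2)] obtain \<epsilon> n1 where \<epsilon>: "\<epsilon> > 0" and
    n1: "\<forall>V H h p. H \<in> Forb F \<longrightarrow> verts H = V \<longrightarrow> card V \<ge> n1 \<longrightarrow>
     (\<forall>x\<in>V. \<forall>y\<in>V. h x y \<in> {0..1}) \<longrightarrow> cut_close V \<epsilon> (adj H) h \<longrightarrow> p \<in> {0..1} \<longrightarrow>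
     (\<exists>z\<in>{..<m} \<rightarrow>\<^sub>E V.
        (\<forall>\<sigma>. \<not> has_copy F {..<m} (\<lambda>i j. threshold g (h (z i) (z j))) \<sigma>) \<and>
        template_cost p m (\<lambda>i j. threshold g (h (z i) (z j))) \<le>
          (real m)\<^sup>2 * ((\<Sum>x\<in>V. \<Sum>y\<in>V. cost p (threshold g (h x y))) / (real (card V))\<^sup>2 + g))"
    by (elim exE conjE)
  from weak_regularity[OF \<epsilon>] obtain k where
    k: "\<forall>V a. finite V \<longrightarrow> (\<forall>x\<in>V. \<forall>y\<in>V. a x y \<in> {0..1}) \<longrightarrow>
     (\<exists>c. (\<forall>x. c x < k) \<and> cut_close V \<epsilon> a (block_mean V c a))" ..
  define \<epsilon>' where "\<epsilon>' = g / ((real k)\<^sup>2 + 1)"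
  have \<epsilon>': "\<epsilon>' > 0" "(real k)\<^sup>2 * \<epsilon>' \<le> g"
  proof -
    have "(real k)\<^sup>2 + 1 > 0" by (simp add: add_nonneg_pos)
    then show "\<epsilon>' > 0" "(real k)\<^sup>2 * \<epsilon>' \<le> g" using g(1) by (simp_all add: \<epsilon>'_def field_simps)
  qed
  from quasirandom_graph[OF p \<epsilon>'(1), of "max (max n0 n1) 2"] obtain n G where
    n: "max (max n0 n1) 2 \<le> n" and G: "is_graph G" "verts G = {..<n}" "int (card (edges G)) = \<lfloor>p * real (n choose 2)\<rfloor>"
    and qr: "cut_close {..<n} \<epsilon>' (adj G) (\<lambda>_ _. p)" by (elim exE conjE)
  let ?V = "{..<n}"
  obtain H where H: "H \<in> Forb F" "verts H = verts G" "dist_to G (Forb F) = graph_dist G H"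
    using dist_to_attained[OF s G(1)] by blast
  have Hg: "is_graph H" using H(1) by (simp add: Forb_def)
  have HV: "verts H = ?V" using H(2) G(2) by simp
  have "\<forall>x\<in>?V. \<forall>y\<in>?V. adj H x y \<in> {0..1}" by (simp add: adj_def)
  from k[rule_format, OF finite_lessThan, of n "adj H"] this
  obtain c where c: "\<And>x. c x < k" and cc: "cut_close ?V \<epsilon> (adj H) (block_mean ?V c (adj H))" by blast
  define h where "h = block_mean ?V c (adj H)"
  have h01: "\<forall>x\<in>?V. \<forall>y\<in>?V. h x y \<in> {0..1}"
    unfolding h_def using block_mean_bounds[of ?V "adj H"] by (simp add: adj_def)
  have hsym: "h x y = h y x" for x y
    unfolding h_def by (rule block_mean_sym) (simp add: adj_def insert_commute)
  define C where "C = (\<Sum>x\<in>?V. \<Sum>y\<in>?V. cost p (threshold g (h x y))) / (real n)\<^sup>2"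
  have n2: "n \<ge> 2" "n1 \<le> card ?V" "n \<ge> n0" using n by auto
  have np: "(real n)\<^sup>2 > 0" using n2 by simp
  from n1[rule_format, OF H(1) HV n2(2) h01[rule_format] cc[folded h_def] p]
  obtain z where noc: "\<forall>\<sigma>. \<not> has_copy F {..<m} (\<lambda>i j. threshold g (h (z i) (z j))) \<sigma>"
    and zc: "template_cost p m (\<lambda>i j. threshold g (h (z i) (z j))) \<le> (real m)\<^sup>2 * (C + g)"
    unfolding C_def by auto
  have C0: "0 \<le> C" unfolding C_def by (intro divide_nonneg_nonneg sum_nonneg cost_bounds[OF p]) auto
  have C1: "C \<le> graph_dist G H + 2 * g"
  proof -
    have "C * (real n)\<^sup>2 = (\<Sum>x\<in>?V. \<Sum>y\<in>?V. cost p (threshold g (h x y)))" using np by (simp add: C_def)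
    also have "\<dots> \<le> (\<Sum>x\<in>?V. \<Sum>y\<in>?V. \<bar>adj G x y - adj H x y\<bar>) + (g + (real k)\<^sup>2 * \<epsilon>') * (real (card ?V))\<^sup>2"
      unfolding h_def by (rule template_cost_le_edits[OF finite_lessThan p c qr]) (use \<epsilon>' g in auto)
    also have "\<dots> \<le> graph_dist G H * (real n)\<^sup>2 + (g + g) * (real n)\<^sup>2"
    proof (rule add_mono)
      show "(\<Sum>x\<in>?V. \<Sum>y\<in>?V. \<bar>adj G x y - adj H x y\<bar>) \<le> graph_dist G H * (real n)\<^sup>2"
        using sum_edits[OF G(1) Hg H(2) _ n2(1)] G(2) by simp
      show "(g + (real k)\<^sup>2 * \<epsilon>') * (real (card ?V))\<^sup>2 \<le> (g + g) * (real n)\<^sup>2"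
        using \<epsilon>' by (intro mult_mono) (use g in auto)
    qed
    finally have "C * (real n)\<^sup>2 \<le> (graph_dist G H + 2 * g) * (real n)\<^sup>2" by (simp add: distrib_right)
    then show ?thesis using np by simp
  qed
  have "C + g \<le> 2" using C1 graph_dist_bounds(2)[OF G(1) Hg H(2)] g(6) by linarith
  moreover have "\<forall>i j. threshold g (h (z i) (z j)) = threshold g (h (z j) (z i))" using hsym by metis
  moreover have "0 \<le> C + g" using C0 g by linarith
  ultimately have "\<exists>K\<in>crg_class (Forb F). crg_g K p \<le> (C + g) + g + 1 / real l"
    using m0[rule_format, OF m(1), of "\<lambda>i j. threshold g (h (z i) (z j))" p "C + g"] p zc noc by blast
  then obtain K where K: "K \<in> crg_class (Forb F)" "crg_g K p \<le> (C + g) + g + 1 / real l" ..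
  have "graph_dist G H \<le> max_dist (Forb F) p n"
    using max_dist_ge[OF s p G(1) _ G(3)] G(2) H(3) by simp
  then have "crg_g K p \<le> max_dist (Forb F) p n + \<gamma>" using K(2) C1 l(2) g(5) by linarith
  then show ?thesis using K(1) n2(3) by blast
qed

section \<open>CRGs with a minimal number of vertices\<close>

lemma compact_prob_masses:
  assumes I: "finite I"
  shows "compact (prob_masses I)"
proof -
  define C where "C = PiE UNIV (\<lambda>x. if x \<in> I then {0..1::real} else {0})"
  have "compactin (product_topology (\<lambda>_. euclidean) UNIV) C"
    unfolding C_def by (auto simp: compactin_PiE)
  then have C: "compact C" by (simp add: euclidean_product_topology)
  have "prob_masses I = C \<inter> {\<mu>. (\<Sum>x\<in>I. \<mu> x) = 1}"
  proof (intro equalityI subsetI)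
    fix \<mu> assume \<mu>: "\<mu> \<in> prob_masses I"
    have "\<mu> x \<in> (if x \<in> I then {0..1} else {0})" for x
    proof (cases "x \<in> I")
      case True
      have "\<mu> x \<le> (\<Sum>x\<in>I. \<mu> x)" using True \<mu> I by (intro member_le_sum) (auto simp: prob_masses_def)
      then show ?thesis using True \<mu> by (simp add: prob_masses_def)
    next
      case False
      then show ?thesis using \<mu> by (simp add: prob_masses_def)
    qed
    then show "\<mu> \<in> C \<inter> {\<mu>. (\<Sum>x\<in>I. \<mu> x) = 1}" using \<mu> unfolding C_def by (simp add: PiE_iff prob_masses_def)
  next
    fix \<mu> assume a: "\<mu> \<in> C \<inter> {\<mu>. (\<Sum>x\<in>I. \<mu> x) = 1}"
    then have "\<mu> x \<in> (if x \<in> I then {0..1} else {0})" for x unfolding C_def by (auto simp only: PiE_iff Int_iff UNIV_I)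
    then have "0 \<le> \<mu> x" "x \<notin> I \<longrightarrow> \<mu> x = 0" for x by (metis atLeastAtMost_iff order_refl singletonD)+
    then show "\<mu> \<in> prob_masses I" using a by (simp add: prob_masses_def)
  qed
  moreover have "closed {\<mu> :: nat \<Rightarrow> real. (\<Sum>x\<in>I. \<mu> x) = 1}"
    by (intro closed_Collect_eq continuous_intros continuous_on_product_coordinates)
  ultimately show ?thesis using C compact_Int_closed by simp
qed

lemma qform_attained:
  assumes I: "finite I" "I \<noteq> {}"
  shows "\<exists>\<mu>\<in>prob_masses I. \<forall>\<nu>\<in>prob_masses I. qform c p I \<mu> \<le> qform c p I \<nu>"
proof (rule continuous_attains_inf[OF compact_prob_masses[OF I(1)]])
  obtain k where k: "k \<in> I" using I by blast
  have "(\<lambda>x. if x = k then 1 else 0) \<in> prob_masses I" using I k by (simp add: prob_masses_def)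
  then show "prob_masses I \<noteq> {}" by blast
  show "continuous_on (prob_masses I) (qform c p I)"
    unfolding qform_def
    by (intro continuous_intros continuous_on_subset[OF continuous_on_product_coordinates] subset_UNIV)
qed

text \<open>
  This brings all CRGs with a given number of vertices to one common vertex set, so that there
  are finitely many.
\<close>

lemma relabel:
  assumes J: "is_colouring J c" and n: "\<not> embeds F J c" and \<nu>: "\<nu> \<in> prob_masses J"
  shows "\<exists>c' \<nu>'. is_colouring {..<card J} c' \<and> \<not> embeds F {..<card J} c' \<and> \<nu>' \<in> prob_masses {..<card J} \<and>
     qform c' p {..<card J} \<nu>' = qform c p J \<nu>"
proof -
  have fJ: "finite J" "J \<noteq> {}" using J by (auto simp: is_colouring_def)
  obtain h where h: "bij_betw h {..<card J} J"
    using ex_bij_betw_nat_finite[OF fJ(1)] by (auto simp: atLeast0LessThan)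
  have hJ: "h i \<in> J" if "i < card J" for i using h that by (auto simp: bij_betw_def)
  define c' where "c' i j = c (h i) (h j)" for i j
  define \<nu>' where "\<nu>' i = (if i < card J then \<nu> (h i) else 0)" for i
  have "is_colouring {..<card J} c'"
  proof -
    have "0 < card J" using fJ by (simp add: card_gt_0_iff)
    then have "{..<card J} \<noteq> {}" by blast
    then show ?thesis using J hJ unfolding is_colouring_def c'_def by simp
  qed
  moreover have "\<not> embeds F {..<card J} c'"
  proof
    assume "embeds F {..<card J} c'"
    then obtain \<phi> where "\<forall>u\<in>verts F. \<phi> u \<in> {..<card J}"
      "\<forall>u\<in>verts F. \<forall>v\<in>verts F. u \<noteq> v \<longrightarrow> fits (c' (\<phi> u) (\<phi> v)) ({u, v} \<in> edges F)"
      unfolding embeds_def by blast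
    then have "embeds F J c" unfolding embeds_def c'_def using hJ by (intro exI[of _ "h \<circ> \<phi>"]) auto
    with n show False ..
  qed
  moreover have sumJ: "(\<Sum>i<card J. f (h i)) = (\<Sum>x\<in>J. f x)" for f :: "nat \<Rightarrow> real"
    by (rule sum.reindex_bij_betw[OF h])
  have "(\<Sum>i<card J. \<nu>' i) = (\<Sum>i<card J. \<nu> (h i))" by (rule sum.cong) (auto simp: \<nu>'_def)
  then have "\<nu>' \<in> prob_masses {..<card J}"
    using \<nu> sumJ[of \<nu>] by (simp add: prob_masses_def \<nu>'_def)
  moreover have "qform c' p {..<card J} \<nu>' = qform c p J \<nu>"
  proof -
    have "qform c' p {..<card J} \<nu>' = (\<Sum>i<card J. \<nu> (h i) * (\<Sum>j<card J. cost p (c (h i) (h j)) * \<nu> (h j)))"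
      unfolding qform_def by (intro sum.cong refl arg_cong2[where f = "(*)"]) (auto simp: \<nu>'_def c'_def)
    also have "\<dots> = qform c p J \<nu>"
      unfolding qform_def sumJ[of "\<lambda>y. cost p (c (h _) y) * \<nu> y"] by (rule sumJ)
    finally show ?thesis .
  qed
  ultimately show ?thesis by blast
qed

text \<open>
  Choose the number \<open>n\<close> of vertices least possible for some mass to have value at most \<open>g\<^sub>K(p)\<close>.
  A mass of such value that vanished at a vertex would allow this vertex to be deleted.
\<close>

lemma minimal_colouring:
  assumes F: "is_graph F" and p: "p \<in> {0..1}" and K: "K \<in> crg_class (Forb F)"
  shows "\<exists>n c \<mu>. is_colouring {..<n} c \<and> \<not> embeds F {..<n} c \<and> \<mu> \<in> prob_masses {..<n} \<and>
    qform c p {..<n} \<mu> \<le> crg_g K p \<and>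
    (\<forall>\<nu>\<in>prob_masses {..<n}. qform c p {..<n} \<mu> \<le> qform c p {..<n} \<nu>) \<and>
    (\<forall>\<nu>\<in>prob_masses {..<n}. qform c p {..<n} \<nu> \<le> qform c p {..<n} \<mu> \<longrightarrow> (\<forall>x<n. 0 < \<nu> x)) \<and>
    (\<forall>m<n. \<forall>c' \<nu>. is_colouring {..<m} c' \<longrightarrow> \<not> embeds F {..<m} c' \<longrightarrow> \<nu> \<in> prob_masses {..<m} \<longrightarrow>
       qform c p {..<n} \<mu> < qform c' p {..<m} \<nu>)"
proof -
  define g where "g = crg_g K p"
  define P where "P n \<longleftrightarrow> (\<exists>c \<mu>. is_colouring {..<n} c \<and> \<not> embeds F {..<n} c \<and> \<mu> \<in> prob_masses {..<n} \<and>
     qform c p {..<n} \<mu> \<le> g)" for n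
  have Kc: "is_crg K" "\<not> embeds F (crg_verts K) (kcol K)" using K crg_class_Forb[OF F] by auto
  have KV: "finite (crg_verts K)" "crg_verts K \<noteq> {}" using Kc(1) by (auto simp: is_crg_def)
  obtain \<mu>0 where \<mu>0: "\<mu>0 \<in> prob_masses (crg_verts K)"
    "\<And>\<nu>. \<nu> \<in> prob_masses (crg_verts K) \<Longrightarrow> qform (kcol K) p (crg_verts K) \<mu>0 \<le> qform (kcol K) p (crg_verts K) \<nu>"
    using qform_attained[OF KV] by blast
  have "qform (kcol K) p (crg_verts K) \<mu>0 \<le> g"
    unfolding g_def crg_g_qform by (rule cINF_greatest) (use \<mu>0 in auto)
  then have "P (card (crg_verts K))"
    using relabel[OF is_colouring_kcol[OF Kc(1)] Kc(2) \<mu>0(1), of p] unfolding P_def by metis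
  define n where "n = (LEAST n. P n)"
  have Pn: "P n" unfolding n_def by (rule LeastI) fact
  have notP: "\<not> P m" if "m < n" for m using that unfolding n_def by (rule not_less_Least)
  obtain c \<mu>1 where c: "is_colouring {..<n} c" "\<not> embeds F {..<n} c" and \<mu>1: "\<mu>1 \<in> prob_masses {..<n}" "qform c p {..<n} \<mu>1 \<le> g"
    using Pn unfolding P_def by blast
  have nV: "{..<n} \<noteq> {}" using c(1) unfolding is_colouring_def by blast
  obtain \<mu> where \<mu>: "\<mu> \<in> prob_masses {..<n}"
    "\<And>\<nu>. \<nu> \<in> prob_masses {..<n} \<Longrightarrow> qform c p {..<n} \<mu> \<le> qform c p {..<n} \<nu>"
    using qform_attained[OF finite_lessThan nV] by blast
  have le: "qform c p {..<n} \<mu> \<le> g" using \<mu>(2)[OF \<mu>1(1)] \<mu>1(2) by linarith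
  show ?thesis
  proof (intro exI[of _ n] exI[of _ c] exI[of _ \<mu>] conjI c \<mu>(1) ballI allI impI)
    show "qform c p {..<n} \<mu> \<le> crg_g K p" using le by (simp add: g_def)
    show "qform c p {..<n} \<mu> \<le> qform c p {..<n} \<nu>" if "\<nu> \<in> prob_masses {..<n}" for \<nu> using \<mu>(2) that .
    show "0 < \<nu> x" if \<nu>: "\<nu> \<in> prob_masses {..<n}" "qform c p {..<n} \<nu> \<le> qform c p {..<n} \<mu>" and x: "x < n" for \<nu> x
    proof (rule ccontr)
      assume "\<not> 0 < \<nu> x"
      moreover have "0 \<le> \<nu> x" using \<nu>(1) by (simp add: prob_masses_def)
      ultimately have x0: "\<nu> x = 0" by simp
      define J where "J = {y \<in> {..<n}. y \<noteq> x}"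
      have one: "(\<Sum>y<n. \<nu> y) = 1" using \<nu>(1) by (simp add: prob_masses_def)
      have J: "finite J" "J \<subseteq> {..<n}" by (auto simp: J_def)
      have restr: "(\<Sum>y<n. f y) = (\<Sum>y\<in>J. f y)" if "f x = 0" for f :: "nat \<Rightarrow> real"
        by (rule sum.mono_neutral_right) (use that in \<open>auto simp: J_def\<close>)
      have oneJ: "(\<Sum>y\<in>J. \<nu> y) = 1" using one restr[of \<nu>] x0 by simp
      have J0: "J \<noteq> {}" using oneJ by auto
      have cJ: "card J < n"
      proof -
        have "J \<subset> {..<n}" using x by (auto simp: J_def)
        then show ?thesis using psubset_card_mono[of "{..<n}" J] by simp
      qed
      have icJ: "is_colouring J c" using c(1) J J0 unfolding is_colouring_def by blast
      have nJ: "\<not> embeds F J c" using c(2) J(2) unfolding embeds_def by blast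
      have \<nu>J: "\<nu> \<in> prob_masses J" using \<nu>(1) oneJ x0 by (auto simp: prob_masses_def J_def)
      have "qform c p {..<n} \<nu> = qform c p J \<nu>"
        unfolding qform_def using x0 restr by simp
      then have "qform c p J \<nu> \<le> g" using \<nu>(2) le by simp
      then have "P (card J)" using relabel[OF icJ nJ \<nu>J, of p] unfolding P_def by metis
      then show False using notP cJ by blast
    qed
    show "qform c p {..<n} \<mu> < qform c' p {..<m} \<nu>"
      if "m < n" "is_colouring {..<m} c'" "\<not> embeds F {..<m} c'" "\<nu> \<in> prob_masses {..<m}" for m c' \<nu>
    proof (rule ccontr)
      assume "\<not> qform c p {..<n} \<mu> < qform c' p {..<m} \<nu>"
      then have "P m" using that le unfolding P_def by fastforce
      then show False using notP that by blast
    qed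
  qed
qed

definition row_value :: "(nat \<Rightarrow> nat \<Rightarrow> colour) \<Rightarrow> real \<Rightarrow> nat set \<Rightarrow> (nat \<Rightarrow> real) \<Rightarrow> nat \<Rightarrow> real" where
  "row_value c p I \<mu> x = (\<Sum>y\<in>I. cost p (c x y) * \<mu> y)"

lemma qform_row: "qform c p I \<mu> = (\<Sum>x\<in>I. \<mu> x * row_value c p I \<mu> x)"
  by (simp add: qform_def row_value_def)

lemma qform_shift:
  assumes "is_colouring I c"
  shows "qform c p I (\<lambda>x. \<mu> x + s * z x) = qform c p I \<mu> + 2 * s * (\<Sum>x\<in>I. z x * row_value c p I \<mu> x) + s\<^sup>2 * qform c p I z"
proof -
  have sym: "(\<Sum>x\<in>I. \<mu> x * row_value c p I z x) = (\<Sum>x\<in>I. z x * row_value c p I \<mu> x)"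
  proof -
    have "(\<Sum>x\<in>I. \<mu> x * row_value c p I z x) = (\<Sum>x\<in>I. \<Sum>y\<in>I. z y * (cost p (c x y) * \<mu> x))"
      unfolding row_value_def sum_distrib_left by (intro sum.cong refl) (simp add: mult_ac)
    also have "\<dots> = (\<Sum>y\<in>I. \<Sum>x\<in>I. z y * (cost p (c x y) * \<mu> x))" by (rule sum.swap)
    also have "\<dots> = (\<Sum>y\<in>I. \<Sum>x\<in>I. z y * (cost p (c y x) * \<mu> x))"
    proof (rule sum.cong[OF refl], rule sum.cong[OF refl])
      fix y x assume "y \<in> I" "x \<in> I"
      then have "c x y = c y x" using assms by (simp add: is_colouring_def)
      then show "z y * (cost p (c x y) * \<mu> x) = z y * (cost p (c y x) * \<mu> x)" by simp
    qed
    finally show ?thesis unfolding row_value_def sum_distrib_left .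
  qed
  have r: "row_value c p I (\<lambda>x. \<mu> x + s * z x) x = row_value c p I \<mu> x + s * row_value c p I z x" for x
    unfolding row_value_def by (simp add: distrib_left sum.distrib sum_distrib_left mult_ac)
  have "qform c p I (\<lambda>x. \<mu> x + s * z x) = (\<Sum>x\<in>I. \<mu> x * row_value c p I \<mu> x + s * (\<mu> x * row_value c p I z x) + s * (z x * row_value c p I \<mu> x) + s\<^sup>2 * (z x * row_value c p I z x))"
    unfolding qform_row r by (intro sum.cong refl) (simp add: algebra_simps power2_eq_square)
  also have "\<dots> = qform c p I \<mu> + s * (\<Sum>x\<in>I. \<mu> x * row_value c p I z x) + s * (\<Sum>x\<in>I. z x * row_value c p I \<mu> x) + s\<^sup>2 * qform c p I z"
    by (simp add: sum.distrib qform_row sum_distrib_left)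
  finally show ?thesis unfolding sym by simp
qed

text \<open>
  The first-order condition at the optimum: moving a little mass towards any vertex does not
  decrease the form, and the rows average to its value.
\<close>

lemma row_optimal:
  assumes c: "is_colouring I c" and \<mu>: "\<mu> \<in> prob_masses I"
    and opt: "\<And>\<nu>. \<nu> \<in> prob_masses I \<Longrightarrow> qform c p I \<mu> \<le> qform c p I \<nu>"
    and x: "x \<in> I" "0 < \<mu> x"
  shows "row_value c p I \<mu> x = qform c p I \<mu>"
proof -
  define g where "g = qform c p I \<mu>"
  have I: "finite I" using c by (simp add: is_colouring_def)
  have one: "(\<Sum>y\<in>I. \<mu> y) = 1" and mu0: "\<And>y. 0 \<le> \<mu> y" using \<mu> by (auto simp: prob_masses_def)
  have ge: "g \<le> row_value c p I \<mu> y" if y: "y \<in> I" for y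
  proof (rule ccontr)
    assume "\<not> g \<le> row_value c p I \<mu> y"
    then have gap: "0 < g - row_value c p I \<mu> y" by simp
    define z where "z w = of_bool (w = y) - \<mu> w" for w
    have zsum: "(\<Sum>w\<in>I. z w * row_value c p I \<mu> w) = row_value c p I \<mu> y - g"
    proof -
      have "(\<Sum>w\<in>I. z w * row_value c p I \<mu> w) = (\<Sum>w\<in>I. (if w = y then row_value c p I \<mu> w else 0) - \<mu> w * row_value c p I \<mu> w)"
        by (intro sum.cong refl) (simp add: z_def left_diff_distrib of_bool_def)
      then show ?thesis using I y by (simp add: sum_subtractf g_def qform_row)
    qed
    define q where "q = \<bar>qform c p I z\<bar> + 1"
    define s where "s = min 1 ((g - row_value c p I \<mu> y) / q)"
    have q: "q > 0" "qform c p I z \<le> q" by (simp_all add: q_def)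
    have s: "0 < s" "s \<le> 1" "s * q \<le> g - row_value c p I \<mu> y"
    proof -
      show "0 < s" "s \<le> 1" using gap q by (simp_all add: s_def)
      have "s \<le> (g - row_value c p I \<mu> y) / q" by (simp add: s_def)
      then show "s * q \<le> g - row_value c p I \<mu> y" using q by (simp add: field_simps)
    qed
    define \<nu> where "\<nu> = (\<lambda>w. \<mu> w + s * z w)"
    have "\<nu> \<in> prob_masses I"
    proof -
      have "0 \<le> \<nu> w" for w
      proof -
        have "\<nu> w = (1 - s) * \<mu> w + s * of_bool (w = y)" by (simp add: \<nu>_def z_def algebra_simps)
        then show ?thesis using s mu0[of w] by simp
      qed
      moreover have "w \<notin> I \<longrightarrow> \<nu> w = 0" for w using \<mu> y by (auto simp: \<nu>_def z_def prob_masses_def)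
      moreover have "(\<Sum>w\<in>I. \<nu> w) = 1"
        using one I y by (simp add: \<nu>_def z_def sum.distrib sum_subtractf sum_distrib_left[symmetric] of_bool_def)
      ultimately show ?thesis by (simp add: prob_masses_def)
    qed
    then have "g \<le> qform c p I \<nu>" using opt by (simp add: g_def)
    also have "\<dots> = g + 2 * s * (row_value c p I \<mu> y - g) + s\<^sup>2 * qform c p I z"
      unfolding \<nu>_def qform_shift[OF c] zsum g_def ..
    finally have "0 \<le> s * (2 * (row_value c p I \<mu> y - g) + s * qform c p I z)" by (simp add: algebra_simps power2_eq_square)
    then have "0 \<le> 2 * (row_value c p I \<mu> y - g) + s * qform c p I z" using s by (simp add: zero_le_mult_iff)
    also have "s * qform c p I z \<le> s * q" using q s by (intro mult_left_mono) auto
    also have "s * q \<le> g - row_value c p I \<mu> y" by (rule s(3))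
    finally show False using gap by simp
  qed
  have "(\<Sum>y\<in>I. \<mu> y * (row_value c p I \<mu> y - g)) = 0"
    using one by (simp add: right_diff_distrib sum_subtractf qform_row[symmetric] sum_distrib_right[symmetric] g_def)
  then have "\<mu> x * (row_value c p I \<mu> x - g) = 0"
    using sum_nonneg_eq_0_iff[OF I, of "\<lambda>y. \<mu> y * (row_value c p I \<mu> y - g)"] mu0 ge x by auto
  then show ?thesis using x by (simp add: g_def)
qed

text \<open>
  The second-order condition. All rows agree at an optimum of full support, so moving all mass
  of \<open>B\<close> to \<open>w\<close> has no first-order effect and changes the form by the quadratic form of the
  displacement. This is the displayed expression; if it were not positive, the new optimum would
  vanish on \<open>B\<close>.
\<close>

lemma move_mass_positive:
  assumes c: "is_colouring I c" and \<mu>: "\<mu> \<in> prob_masses I"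
    and opt: "\<And>\<nu>. \<nu> \<in> prob_masses I \<Longrightarrow> qform c p I \<mu> \<le> qform c p I \<nu>"
    and supp: "\<And>\<nu> x. \<nu> \<in> prob_masses I \<Longrightarrow> qform c p I \<nu> \<le> qform c p I \<mu> \<Longrightarrow> x \<in> I \<Longrightarrow> 0 < \<nu> x"
    and w: "w \<in> I" "w \<notin> B" and B: "B \<subseteq> I" "B \<noteq> {}"
  defines "\<beta> \<equiv> \<Sum>b\<in>B. \<mu> b"
  shows "0 < \<beta> * (cost p (c w w) * \<beta>) - 2 * \<beta> * (\<Sum>b\<in>B. cost p (c w b) * \<mu> b)
           + (\<Sum>b\<in>B. \<mu> b * (\<Sum>b'\<in>B. cost p (c b b') * \<mu> b'))"
proof -
  have I: "finite I" "finite B" using c B finite_subset by (auto simp: is_colouring_def)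
  have one: "(\<Sum>y\<in>I. \<mu> y) = 1" and mu0: "\<And>y. 0 \<le> \<mu> y" using \<mu> by (auto simp: prob_masses_def)
  have pos: "0 < \<mu> x" if "x \<in> I" for x using supp[OF \<mu> _ that] by simp
  define z where "z x = (if x = w then \<beta> else if x \<in> B then - \<mu> x else 0)" for x
  have zsum: "(\<Sum>x\<in>I. f x * z x) = \<beta> * f w - (\<Sum>b\<in>B. f b * \<mu> b)" for f :: "nat \<Rightarrow> real"
  proof -
    have "(\<Sum>x\<in>I. f x * z x) = (\<Sum>x\<in>insert w B. f x * z x)"
      using w B I by (intro sum.mono_neutral_right) (auto simp: z_def)
    also have "\<dots> = f w * z w + (\<Sum>x\<in>B. f x * z x)" using w I by simp
    also have "(\<Sum>x\<in>B. f x * z x) = (\<Sum>x\<in>B. - (f x * \<mu> x))" using w by (intro sum.cong refl) (auto simp: z_def)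
    finally show ?thesis by (simp add: z_def sum_negf mult.commute)
  qed
  have z0: "(\<Sum>x\<in>I. z x) = 0" using zsum[of "\<lambda>_. 1"] by (simp add: \<beta>_def)
  define \<nu> where "\<nu> = (\<lambda>x. \<mu> x + 1 * z x)"
  have "\<nu> \<in> prob_masses I"
  proof -
    have "0 \<le> \<beta>" unfolding \<beta>_def by (intro sum_nonneg mu0)
    then have "0 \<le> \<nu> x" for x using mu0[of x] mu0[of w] by (simp add: \<nu>_def z_def)
    moreover have "x \<notin> I \<longrightarrow> \<nu> x = 0" for x using \<mu> w B by (auto simp: \<nu>_def z_def prob_masses_def)
    moreover have "(\<Sum>x\<in>I. \<nu> x) = 1" using one z0 by (simp add: \<nu>_def sum.distrib)
    ultimately show ?thesis by (simp add: prob_masses_def)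
  qed
  moreover obtain b where b: "b \<in> B" using B by blast
  then have "\<nu> b = 0" using w by (auto simp: \<nu>_def z_def)
  ultimately have "\<not> qform c p I \<nu> \<le> qform c p I \<mu>" using supp[of \<nu> b] b B by force
  moreover have "qform c p I \<nu> = qform c p I \<mu> + 2 * 1 * (\<Sum>x\<in>I. z x * row_value c p I \<mu> x) + 1\<^sup>2 * qform c p I z"
    unfolding \<nu>_def by (rule qform_shift[OF c])
  moreover have "(\<Sum>x\<in>I. z x * row_value c p I \<mu> x) = (\<Sum>x\<in>I. z x * qform c p I \<mu>)"
    using row_optimal[OF c \<mu> opt _ pos] by (intro sum.cong refl) simp
  then have "(\<Sum>x\<in>I. z x * row_value c p I \<mu> x) = 0" using z0 by (simp add: sum_distrib_right[symmetric])
  ultimately have qz: "0 < qform c p I z" by simp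
  have rz: "row_value c p I z x = \<beta> * cost p (c x w) - (\<Sum>b\<in>B. cost p (c x b) * \<mu> b)" for x
    unfolding row_value_def by (rule zsum)
  have "qform c p I z = (\<Sum>x\<in>I. row_value c p I z x * z x)" by (simp add: qform_row mult.commute)
  also have "\<dots> = \<beta> * row_value c p I z w - (\<Sum>b\<in>B. row_value c p I z b * \<mu> b)" by (rule zsum)
  also have "(\<Sum>b\<in>B. row_value c p I z b * \<mu> b) = (\<Sum>b\<in>B. \<beta> * (cost p (c w b) * \<mu> b) - \<mu> b * (\<Sum>b'\<in>B. cost p (c b b') * \<mu> b'))"
  proof (rule sum.cong[OF refl])
    fix b assume "b \<in> B"
    then have "c b w = c w b" using c B w by (auto simp: is_colouring_def)
    then show "row_value c p I z b * \<mu> b = \<beta> * (cost p (c w b) * \<mu> b) - \<mu> b * (\<Sum>b'\<in>B. cost p (c b b') * \<mu> b')"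
      unfolding rz by (simp add: algebra_simps)
  qed
  also have "\<beta> * row_value c p I z w = \<beta> * (cost p (c w w) * \<beta>) - \<beta> * (\<Sum>b\<in>B. cost p (c w b) * \<mu> b)"
    unfolding rz by (simp add: algebra_simps)
  finally show ?thesis using qz by (simp add: sum_subtractf sum_distrib_left[symmetric] algebra_simps)
qed

section \<open>CRGs with many black vertices\<close>

lemma sum_masses_over_subset_le:
  fixes \<mu> :: "nat \<Rightarrow> real"
  assumes "finite S" "\<And>s. s \<in> S \<Longrightarrow> \<mu> s \<le> G" "0 \<le> G" "real (card S) \<le> k"
  shows "(\<Sum>s\<in>S. \<mu> s) \<le> k * G"
proof -
  have "(\<Sum>s\<in>S. \<mu> s) \<le> real (card S) * G" using assms sum_bounded_above[of S \<mu> G] by simp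
  also have "\<dots> \<le> k * G" using assms by (intro mult_right_mono)
  finally show ?thesis .
qed

lemma sum_filter_of_bool:
  fixes f :: "'a \<Rightarrow> real"
  assumes "finite V"
  shows "(\<Sum>y\<in>{y \<in> V. P y}. f y) = (\<Sum>y\<in>V. f y * of_bool (P y))"
  unfolding sum.inter_filter[OF assms] by (rule sum.cong) auto

text \<open>
  An optimal mass \<open>\<mu>\<close> of value \<open>g\<close> on a CRG with only black vertices and only white and gray
  edges, where \<open>A\<close> is gray adjacency: all rows equal \<open>g\<close>. The last three conditions say that \<open>g\<close>
  is below the value of the all-gray CRG with one white and \<open>t - 1\<close> black vertices, and that
  there is neither a gray \<open>K\<^bsub>t,t\<^esub>\<close> nor a gray clique of size \<open>t\<close>, as \<open>K\<^bsub>t,t\<^esub>\<close> maps to both.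
\<close>

definition black_optimum ::
    "real \<Rightarrow> nat \<Rightarrow> nat set \<Rightarrow> (nat \<Rightarrow> real) \<Rightarrow> (nat \<Rightarrow> nat \<Rightarrow> bool) \<Rightarrow> real \<Rightarrow> real \<Rightarrow> bool" where
  "black_optimum \<delta> t V \<mu> A p g \<longleftrightarrow>
     finite V \<and> (\<forall>x\<in>V. 0 \<le> \<mu> x) \<and> (\<Sum>x\<in>V. \<mu> x) = 1 \<and>
     (\<forall>x\<in>V. \<forall>y\<in>V. A x y \<longrightarrow> A y x) \<and> (\<forall>x\<in>V. \<not> A x x) \<and> \<delta> \<le> p \<and> p < 1/2 \<and>
     (\<forall>x\<in>V. (1 - p) * \<mu> x + p * (\<Sum>y\<in>{y \<in> V. y \<noteq> x \<and> \<not> A x y}. \<mu> y) = g) \<and>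
     g * (1 / p + (real t - 1) / (1 - p)) < 1 \<and>
     (\<forall>X Y. X \<subseteq> V \<longrightarrow> Y \<subseteq> V \<longrightarrow> card X = t \<longrightarrow> card Y = t \<longrightarrow> \<not> (\<forall>x\<in>X. \<forall>y\<in>Y. A x y)) \<and>
     (\<forall>X. X \<subseteq> V \<longrightarrow> card X = t \<longrightarrow> \<not> (\<forall>x\<in>X. \<forall>y\<in>X. x \<noteq> y \<longrightarrow> A x y))"

text \<open>
  The row equation gives every vertex gray neighbours of mass at least \<open>1 - g/p\<close>. Call vertices
  of mass at least \<open>\<theta>\<close> heavy. If there are very many vertices, then \<open>R\<close> light ones have the same
  set \<open>S\<close> of heavy gray neighbours. Count the gray mass between these \<open>R\<close> vertices and
  everything: a vertex with fewer than \<open>t\<close> of them as neighbours contributes at most \<open>t\<close> times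
  its mass, and there are at most \<open>D\<close> others, the popular ones, of which those that are light
  have total mass at most \<open>D \<theta> = \<epsilon>\<close>. So \<open>\<mu>(S) \<ge> 1 - g/p - 2\<epsilon>\<close>. On the other hand \<open>\<mu> s \<le> g/(1-p)\<close>
  for all \<open>s\<close>, and \<open>\<mu>(S)\<close> stays below \<open>(t-1) g/(1-p)\<close> by at least \<open>p g/(1-p)\<close>: either \<open>S\<close> has at
  most \<open>t - 2\<close> elements or two of its elements are joined by a white edge. Together with
  \<open>g (1/p + (t-1)/(1-p)) < 1\<close> this makes \<open>g\<close> of order \<open>\<epsilon>\<close>, and then \<open>1 - g/p\<close> cannot be so
  small.
\<close>

lemma few_black_vertices:
  fixes \<delta> :: real and t :: nat
  assumes \<delta>: "\<delta> > 0" and t: "t \<ge> 1"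
  shows "\<exists>n0. \<forall>V \<mu> A p g. black_optimum \<delta> t V \<mu> A p g \<longrightarrow> card V \<le> n0"
proof -
  define W where "W = 1 + 1 / \<delta>\<^sup>2 + real t / \<delta>"
  have W: "W \<ge> 1" using \<delta> by (simp add: W_def)
  define \<epsilon> where "\<epsilon> = 1 / (4 * W)"
  have \<epsilon>: "\<epsilon> > 0" "2 * \<epsilon> * W < 1" using W by (auto simp: \<epsilon>_def)
  obtain R0 :: nat where R0: "real t / \<epsilon> < real R0" using reals_Archimedean2 by blast
  \<comment> \<open>\<open>R\<close> and \<open>D\<close> depend on \<open>\<epsilon>\<close> and \<open>t\<close> only, and \<open>\<theta>\<close> on all of these: heaviness is fixed last.\<close>
  define R where "R = max R0 t"
  have R: "t \<le> R" "real R > 0" "real t / real R \<le> \<epsilon>"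
  proof -
    show "t \<le> R" "real R > 0" using t by (auto simp: R_def)
    have "real t / \<epsilon> \<le> real R" using R0 by (simp add: R_def)
    then show "real t / real R \<le> \<epsilon>" using \<epsilon>(1) \<open>real R > 0\<close> by (simp add: field_simps)
  qed
  define D where "D = t * 2 ^ R"
  have D: "real D > 0" using t by (simp add: D_def)
  define \<theta> where "\<theta> = \<epsilon> / real D"
  have \<theta>: "\<theta> > 0" "real D * \<theta> = \<epsilon>" using \<epsilon> D by (auto simp: \<theta>_def)
  obtain hm :: nat where hm: "1 / \<theta> < real hm" using reals_Archimedean2 by blast
  show ?thesis
  proof (rule exI[of _ "hm + R * 2 ^ hm"], intro allI impI)
    fix V :: "nat set" and \<mu> :: "nat \<Rightarrow> real" and A :: "nat \<Rightarrow> nat \<Rightarrow> bool" and p g :: real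
    assume "black_optimum \<delta> t V \<mu> A p g"
    then obtain V: "finite V" and mu0: "\<forall>x\<in>V. 0 \<le> \<mu> x" and mu1: "(\<Sum>x\<in>V. \<mu> x) = 1"
      and sym: "\<forall>x\<in>V. \<forall>y\<in>V. A x y \<longrightarrow> A y x" and irr: "\<forall>x\<in>V. \<not> A x x" and p: "\<delta> \<le> p" "p < 1/2"
      and row: "\<forall>x\<in>V. (1 - p) * \<mu> x + p * (\<Sum>y\<in>{y \<in> V. y \<noteq> x \<and> \<not> A x y}. \<mu> y) = g"
      and gt: "g * (1 / p + (real t - 1) / (1 - p)) < 1"
      and noK: "\<forall>X Y. X \<subseteq> V \<longrightarrow> Y \<subseteq> V \<longrightarrow> card X = t \<longrightarrow> card Y = t \<longrightarrow> \<not> (\<forall>x\<in>X. \<forall>y\<in>Y. A x y)"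
      and noC: "\<forall>X. X \<subseteq> V \<longrightarrow> card X = t \<longrightarrow> \<not> (\<forall>x\<in>X. \<forall>y\<in>X. x \<noteq> y \<longrightarrow> A x y)"
      unfolding black_optimum_def by (elim conjE)
    have pp: "0 < p" "0 < 1 - p" using p \<delta> by auto
    show "card V \<le> hm + R * 2 ^ hm"
    proof (rule ccontr)
      assume "\<not> card V \<le> hm + R * 2 ^ hm"
      then have big: "hm + R * 2 ^ hm < card V" by simp
      define Yh where "Yh = {y \<in> V. \<mu> y \<ge> \<theta>}"
      have fYh: "finite Yh" "Yh \<subseteq> V" using V by (auto simp: Yh_def)
      have "card Yh \<le> hm"
      proof -
        have "real (card Yh) * \<theta> = (\<Sum>y\<in>Yh. \<theta>)" by simp
        also have "\<dots> \<le> (\<Sum>y\<in>Yh. \<mu> y)" by (intro sum_mono) (simp add: Yh_def)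
        also have "\<dots> \<le> (\<Sum>y\<in>V. \<mu> y)" using fYh V mu0 by (intro sum_mono2) auto
        finally have "real (card Yh) \<le> 1 / \<theta>" using mu1 \<theta> by (simp add: field_simps)
        then show ?thesis using hm by linarith
      qed
      define L where "L = V - Yh"
      have fL: "finite L" using V by (simp add: L_def)
      have cL: "R * 2 ^ hm < card L"
        using big \<open>card Yh \<le> hm\<close> card_Diff_subset[OF fYh] by (simp add: L_def)
      define N where "N x = {y \<in> Yh. A x y}" for x
      have "\<exists>S\<in>Pow Yh. card (N -` {S} \<inter> L) * card (Pow Yh) \<ge> card L"
        by (rule pigeonhole_card[OF _ fL]) (use fYh in \<open>auto simp: N_def\<close>)
      then obtain S where S: "S \<subseteq> Yh" "card (N -` {S} \<inter> L) * 2 ^ card Yh \<ge> card L"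
        using fYh by (auto simp: card_Pow)
      have "R * 2 ^ card Yh \<le> R * 2 ^ hm" using \<open>card Yh \<le> hm\<close> by (simp add: power_increasing)
      then have "R * 2 ^ card Yh < card (N -` {S} \<inter> L) * 2 ^ card Yh" using S(2) cL by linarith
      then have "R \<le> card (N -` {S} \<inter> L)" by simp
      then obtain L' where L': "L' \<subseteq> N -` {S} \<inter> L" "card L' = R" "finite L'"
        by (rule obtain_subset_with_card_n)
      have L'V: "L' \<subseteq> V" and L'Y: "L' \<inter> Yh = {}" using L'(1) by (auto simp: L_def)
      have NS: "N x = S" if "x \<in> L'" for x using L'(1) that by auto
      have SV: "S \<subseteq> V" and fS: "finite S" using S fYh finite_subset by auto
      have AxS: "A x s" if "x \<in> L'" "s \<in> S" for x s using NS[OF that(1)] that by (auto simp: N_def)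
      obtain X0 where X0: "X0 \<subseteq> L'" "card X0 = t" using obtain_subset_with_card_n[of t L'] R(1) L'(2) by auto
      have cS: "card S < t"
      proof (rule ccontr)
        assume "\<not> card S < t"
        then obtain Y where Y: "Y \<subseteq> S" "card Y = t" using obtain_subset_with_card_n[of t S] by auto
        have "\<forall>x\<in>X0. \<forall>y\<in>Y. A x y"
        proof (intro ballI)
          fix x y assume "x \<in> X0" "y \<in> Y"
          then have "x \<in> L'" "y \<in> S" using X0(1) Y(1) by auto
          then show "A x y" by (rule AxS)
        qed
        moreover have "X0 \<subseteq> V" "Y \<subseteq> V" using X0(1) L'V Y(1) SV by auto
        ultimately show False using noK[rule_format, of X0 Y] X0(2) Y(2) by simp
      qed
      define d where "d x = (\<Sum>y\<in>{y \<in> V. A x y}. \<mu> y)" for x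
      have dge: "1 - g / p \<le> d x" if x: "x \<in> V" for x
      proof -
        have "V = insert x ({y \<in> V. y \<noteq> x \<and> \<not> A x y} \<union> {y \<in> V. A x y})" using x irr by auto
        then have "1 = (\<Sum>y\<in>insert x ({y \<in> V. y \<noteq> x \<and> \<not> A x y} \<union> {y \<in> V. A x y}). \<mu> y)" using mu1 by simp
        also have "\<dots> = \<mu> x + (\<Sum>y\<in>{y \<in> V. y \<noteq> x \<and> \<not> A x y} \<union> {y \<in> V. A x y}. \<mu> y)"
          using V irr x by (intro sum.insert) auto
        also have "\<dots> = \<mu> x + ((\<Sum>y\<in>{y \<in> V. y \<noteq> x \<and> \<not> A x y}. \<mu> y) + d x)"
          unfolding d_def using V by (subst sum.union_disjoint) auto
        finally have "(\<Sum>y\<in>{y \<in> V. y \<noteq> x \<and> \<not> A x y}. \<mu> y) = 1 - \<mu> x - d x" by simp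
        then have "(1 - p) * \<mu> x + p * (1 - \<mu> x - d x) = g" using row x by metis
        then have "p * d x = p - g + (1 - 2 * p) * \<mu> x" by (simp add: algebra_simps)
        moreover have "0 \<le> (1 - 2 * p) * \<mu> x" using p mu0 x by simp
        ultimately have "p - g \<le> p * d x" by linarith
        then show ?thesis using pp by (simp add: field_simps)
      qed
      define nb where "nb y = {x \<in> L'. A x y}" for y
      have nbR: "card (nb y) \<le> R" for y using card_mono[OF L'(3), of "nb y"] L'(2) by (auto simp: nb_def)
      \<comment> \<open>More than \<open>t 2\<^sup>R\<close> popular vertices: \<open>t\<close> of them would have the same \<open>t\<close> neighbours, a gray \<open>K\<^bsub>t,t\<^esub>\<close>.\<close>
      have popular: "card {y \<in> V. t \<le> card (nb y)} \<le> D"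
      proof (rule ccontr)
        let ?P = "{y \<in> V. t \<le> card (nb y)}"
        assume "\<not> card ?P \<le> D"
        have "\<exists>Z\<in>Pow L'. card (nb -` {Z} \<inter> ?P) * card (Pow L') \<ge> card ?P"
          by (rule pigeonhole_card) (use V L' in \<open>auto simp: nb_def\<close>)
        then obtain Z where Z: "Z \<subseteq> L'" "card (nb -` {Z} \<inter> ?P) * 2 ^ R \<ge> card ?P"
          using L' by (auto simp: card_Pow)
        have "t * 2 ^ R < card ?P" using \<open>\<not> card ?P \<le> D\<close> unfolding D_def not_le .
        then have "t * 2 ^ R < card (nb -` {Z} \<inter> ?P) * 2 ^ R" using Z(2) by (rule order.strict_trans2)
        then have "t \<le> card (nb -` {Z} \<inter> ?P)" by simp
        then obtain Y where Y: "Y \<subseteq> nb -` {Z} \<inter> ?P" "card Y = t" by (rule obtain_subset_with_card_n)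
        then obtain y0 where "y0 \<in> Y" using t by fastforce
        then have "nb y0 = Z" "t \<le> card (nb y0)" using Y by auto
        then obtain X where X: "X \<subseteq> Z" "card X = t" using obtain_subset_with_card_n[of t Z] by auto
        have "\<forall>x\<in>X. \<forall>y\<in>Y. A x y"
        proof (intro ballI)
          fix x y assume "x \<in> X" "y \<in> Y"
          then have "x \<in> nb y" using X Y by auto
          then show "A x y" by (simp add: nb_def)
        qed
        moreover have "X \<subseteq> V" "Y \<subseteq> V" using X Y Z L'V by auto
        ultimately show False using noK[rule_format, of X Y] X(2) Y(2) by simp
      qed
      have "real R * (1 - g / p) = (\<Sum>x\<in>L'. 1 - g / p)" using L' by simp
      also have "\<dots> \<le> (\<Sum>x\<in>L'. d x)" using dge L'V by (intro sum_mono) auto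
      also have "\<dots> = (\<Sum>x\<in>L'. \<Sum>y\<in>V. \<mu> y * of_bool (A x y))"
        unfolding d_def sum_filter_of_bool[OF V] ..
      also have "\<dots> = (\<Sum>y\<in>V. \<mu> y * real (card (nb y)))"
        unfolding nb_def card_as_sum[OF L'(3)] by (subst sum.swap) (simp add: sum_distrib_left)
      also have "\<dots> \<le> (\<Sum>y\<in>V. real R * (\<mu> y * of_bool (y \<in> S)) + (\<theta> * real R) * of_bool (t \<le> card (nb y)) + real t * \<mu> y)"
      proof (rule sum_mono)
        fix y assume y: "y \<in> V"
        then have my: "0 \<le> \<mu> y" using mu0 by simp
        have nn: "0 \<le> \<mu> y * real (card (nb y))" using my by simp
        have b: "\<mu> y * real (card (nb y)) \<le> \<mu> y * real R" using nbR[of y] my by (intro mult_left_mono) auto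
        have t2: "0 \<le> real t * \<mu> y" "0 \<le> \<theta> * real R" using my \<theta> by auto
        show "\<mu> y * real (card (nb y)) \<le> real R * (\<mu> y * of_bool (y \<in> S)) + (\<theta> * real R) * of_bool (t \<le> card (nb y)) + real t * \<mu> y"
        proof (cases "y \<in> S")
          case True
          then have "\<mu> y * real (card (nb y)) \<le> real R * (\<mu> y * of_bool (y \<in> S))" using b by (simp add: mult.commute)
          moreover have "0 \<le> (\<theta> * real R) * of_bool (t \<le> card (nb y))" using t2 by simp
          ultimately show ?thesis using t2 by linarith
        next
          case nS: False
          show ?thesis
          proof (cases "y \<in> Yh")
            case True
            have "nb y = {}"
            proof (rule ccontr)
              assume "nb y \<noteq> {}"
              then obtain x where "x \<in> L'" "A x y" by (auto simp: nb_def)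
              then have "y \<in> N x" "N x = S" using True NS by (auto simp: N_def)
              then show False using nS by simp
            qed
            then show ?thesis using nS t2 by simp
          next
            case False
            then have ly: "\<mu> y \<le> \<theta>" using y by (simp add: Yh_def)
            show ?thesis
            proof (cases "t \<le> card (nb y)")
              case True
              have "\<mu> y * real R \<le> \<theta> * real R" using ly by (intro mult_right_mono) auto
              then have "\<mu> y * real (card (nb y)) \<le> \<theta> * real R + real t * \<mu> y" using b t2 by linarith
              then show ?thesis using nS True by simp
            next
              case False
              then have "\<mu> y * real (card (nb y)) \<le> \<mu> y * real t" using my by (intro mult_left_mono) auto
              then show ?thesis using nS False by (simp add: mult.commute)
            qed
          qed
        qed
      qed
      also have "\<dots> = real R * (\<Sum>y\<in>V. \<mu> y * of_bool (y \<in> S)) + (\<theta> * real R) * real (card {y \<in> V. t \<le> card (nb y)}) + real t"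
        using mu1 by (simp add: sum.distrib card_as_sum[OF V] sum_distrib_left[symmetric])
      also have "(\<Sum>y\<in>V. \<mu> y * of_bool (y \<in> S)) = (\<Sum>y\<in>S. \<mu> y)"
      proof -
        have "{y \<in> V. y \<in> S} = S" using SV by auto
        then show ?thesis unfolding sum_filter_of_bool[OF V, symmetric] by simp
      qed
      also have "real R * (\<Sum>y\<in>S. \<mu> y) + (\<theta> * real R) * real (card {y \<in> V. t \<le> card (nb y)}) + real t \<le>
         real R * (\<Sum>y\<in>S. \<mu> y) + (\<theta> * real R) * real D + real t"
        using popular \<theta>(1) by (intro add_mono mult_left_mono order_refl) auto
      also have "\<dots> = real R * ((\<Sum>y\<in>S. \<mu> y) + \<epsilon> + real t / real R)"
        using \<theta>(2) R(2) by (simp add: field_simps)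
      finally have "1 - g / p \<le> (\<Sum>y\<in>S. \<mu> y) + \<epsilon> + real t / real R" using R(2) by simp
      then have main: "1 - g / p \<le> (\<Sum>y\<in>S. \<mu> y) + 2 * \<epsilon>" using R(3) by linarith
      define G1 where "G1 = g / (1 - p)"
      have nonneg_sum: "0 \<le> p * (\<Sum>y\<in>{y \<in> V. y \<noteq> x \<and> \<not> A x y}. \<mu> y)" for x
        using pp mu0 by (intro mult_nonneg_nonneg sum_nonneg) auto
      have m1: "(1 - p) * \<mu> x \<le> g" if "x \<in> V" for x using row that nonneg_sum[of x] by force
      have m2: "(1 - p) * \<mu> x + p * \<mu> y \<le> g" if "x \<in> V" "y \<in> V" "x \<noteq> y" "\<not> A x y" for x y
      proof -
        have "\<mu> y \<le> (\<Sum>y\<in>{y \<in> V. y \<noteq> x \<and> \<not> A x y}. \<mu> y)"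
          using that V mu0 by (intro member_le_sum) auto
        then have "p * \<mu> y \<le> p * (\<Sum>y\<in>{y \<in> V. y \<noteq> x \<and> \<not> A x y}. \<mu> y)" using pp by simp
        moreover have "(1 - p) * \<mu> x + p * (\<Sum>y\<in>{y \<in> V. y \<noteq> x \<and> \<not> A x y}. \<mu> y) = g" using row that by blast
        ultimately show ?thesis by linarith
      qed
      have muG: "\<mu> x \<le> G1" if "x \<in> V" for x using m1[OF that] pp by (simp add: G1_def field_simps)
      obtain x0 where x0: "x0 \<in> X0" using X0(2) t by fastforce
      have x0V: "x0 \<in> V" "x0 \<in> L'" using x0 X0 L'V by auto
      have G0: "0 \<le> G1" using muG[OF x0V(1)] mu0 x0V by force
      have gG: "g = G1 * (1 - p)" using pp by (simp add: G1_def)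
      have muS: "(\<Sum>y\<in>S. \<mu> y) \<le> (real t - 1) * G1 - p * G1"
      proof (cases "\<forall>x\<in>S. \<forall>y\<in>S. x \<noteq> y \<longrightarrow> A x y")
        case True
        have "card S \<noteq> t - 1"
        proof
          assume c: "card S = t - 1"
          have xS: "x0 \<notin> S" using x0V L'Y S(1) by auto
          have "card (insert x0 S) = t" using c xS fS t by simp
          moreover have "\<forall>x\<in>insert x0 S. \<forall>y\<in>insert x0 S. x \<noteq> y \<longrightarrow> A x y"
          proof (intro ballI impI)
            fix x y assume xy: "x \<in> insert x0 S" "y \<in> insert x0 S" "x \<noteq> y"
            then consider "x = x0" "y \<in> S" | "x \<in> S" "y = x0" | "x \<in> S" "y \<in> S" by blast
            then show "A x y"
            proof cases
              case 1 then show ?thesis using AxS[OF x0V(2)] by simp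
            next
              case 2 then show ?thesis using AxS[OF x0V(2), of x] sym SV x0V by blast
            next
              case 3 then show ?thesis using True xy by blast
            qed
          qed
          moreover have "insert x0 S \<subseteq> V" using SV x0V by auto
          ultimately show False using noC[rule_format, of "insert x0 S"] by simp
        qed
        then have cS2: "real (card S) \<le> real t - 2" using cS by linarith
        have "(\<Sum>y\<in>S. \<mu> y) \<le> (real t - 2) * G1"
          by (rule sum_masses_over_subset_le[OF fS _ G0 cS2]) (use muG SV in auto)
        moreover have "p * G1 \<le> 1 * G1" using pp G0 by (intro mult_right_mono) auto
        ultimately show ?thesis by (simp add: algebra_simps)
      next
        case False
        then obtain x y where xy: "x \<in> S" "y \<in> S" "x \<noteq> y" "\<not> A x y" by blast
        have xyV: "x \<in> V" "y \<in> V" using xy SV by auto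
        have "\<not> A y x" using xy xyV sym by blast
        then have "\<mu> x + \<mu> y \<le> 2 * g" using m2[OF xyV xy(3,4)] m2[OF xyV(2,1)] xy(3) by (simp add: algebra_simps)
        moreover have "(\<Sum>y\<in>S - {x, y}. \<mu> y) \<le> (real t - 3) * G1"
        proof (rule sum_masses_over_subset_le[OF _ _ G0])
          have "card (S - {x, y}) = card S - 2" using xy fS by (simp add: card_Diff_subset)
          moreover have "card {x, y} \<le> card S" using xy fS by (intro card_mono) auto
          then have "2 \<le> card S" using xy by simp
          ultimately show "real (card (S - {x, y})) \<le> real t - 3" using cS by linarith
        qed (use fS muG SV in auto)
        moreover have "(\<Sum>y\<in>S. \<mu> y) = \<mu> x + \<mu> y + (\<Sum>y\<in>S - {x, y}. \<mu> y)"
          using xy fS sum.subset_diff[of "{x, y}" S \<mu>] by simp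
        ultimately have "(\<Sum>y\<in>S. \<mu> y) \<le> 2 * g + (real t - 3) * G1" by linarith
        also have "\<dots> = (real t - 1) * G1 - 2 * (p * G1)" unfolding gG by (simp add: algebra_simps)
        also have "\<dots> \<le> (real t - 1) * G1 - p * G1" using pp G0 by simp
        finally show ?thesis .
      qed
      have gt': "g / p + (real t - 1) * G1 < 1"
        using gt by (simp add: G1_def distrib_left algebra_simps)
      have pG: "p * G1 < 2 * \<epsilon>" using main muS gt' by linarith
      have "\<delta> * G1 \<le> p * G1" using p G0 by (intro mult_right_mono)
      then have G1s: "G1 \<le> 2 * \<epsilon> / \<delta>" using pG \<delta> by (simp add: field_simps)
      have "g / p \<le> G1 / \<delta>"
      proof -
        have "g / p \<le> G1 / p" unfolding gG using pp G0 by (intro divide_right_mono) (auto simp: mult_left_le)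
        also have "\<dots> \<le> G1 / \<delta>" using p \<delta> G0 pp by (intro divide_left_mono) auto
        finally show ?thesis .
      qed
      also have "\<dots> \<le> (2 * \<epsilon> / \<delta>) / \<delta>" using G1s \<delta> by (intro divide_right_mono) auto
      finally have gp: "g / p \<le> 2 * \<epsilon> / \<delta>\<^sup>2" by (simp add: power2_eq_square)
      have "(real t - 1) * G1 \<le> real t * (2 * \<epsilon> / \<delta>)"
        using G1s G0 t by (intro mult_mono) auto
      moreover have "0 \<le> p * G1" using pp G0 by simp
      ultimately have "1 \<le> 2 * \<epsilon> / \<delta>\<^sup>2 + real t * (2 * \<epsilon> / \<delta>) + 2 * \<epsilon>" using main muS gp by linarith
      also have "\<dots> = 2 * \<epsilon> * W" using \<delta> by (simp add: W_def algebra_simps)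
      finally show False using \<epsilon>(2) by linarith
    qed
  qed
qed

section \<open>CRGs that a balanced complete bipartite graph does not map to\<close>

abbreviation Ktt :: "nat \<Rightarrow> graph" where "Ktt t \<equiv> complete_bipartite t t"

lemma Ktt_edges: "{u, v} \<in> edges (Ktt t) \<longleftrightarrow> (u < t \<and> t \<le> v \<and> v < 2 * t) \<or> (v < t \<and> t \<le> u \<and> u < 2 * t)"
  by (simp add: complete_bipartite_def doubleton_eq_iff mult_2) blast

text \<open>
  The two sides may be mapped with repetitions and may share images; only the diagonal colours
  restrict this.
\<close>

lemma embeds_Ktt:
  assumes a: "\<And>i. i < t \<Longrightarrow> a i \<in> I" and b: "\<And>i. i < t \<Longrightarrow> b i \<in> I"
    and ab: "\<And>i j. i < t \<Longrightarrow> j < t \<Longrightarrow> c (a i) (b j) \<noteq> White \<and> c (b j) (a i) \<noteq> White"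
    and aa: "\<And>i j. i < t \<Longrightarrow> j < t \<Longrightarrow> i \<noteq> j \<Longrightarrow> c (a i) (a j) \<noteq> Black"
    and bb: "\<And>i j. i < t \<Longrightarrow> j < t \<Longrightarrow> i \<noteq> j \<Longrightarrow> c (b i) (b j) \<noteq> Black"
  shows "embeds (Ktt t) I c"
proof -
  define \<phi> where "\<phi> u = (if u < t then a u else b (u - t))" for u
  have V: "u < 2 * t" if "u \<in> verts (Ktt t)" for u using that by (simp add: complete_bipartite_def)
  have "fits (c (\<phi> u) (\<phi> v)) ({u, v} \<in> edges (Ktt t))" if uv: "u \<in> verts (Ktt t)" "v \<in> verts (Ktt t)" "u \<noteq> v" for u v
  proof (cases "u < t")
    case u: True
    show ?thesis
    proof (cases "v < t")
      case True
      then show ?thesis using u aa[of u v] uv by (simp add: Ktt_edges fits_def \<phi>_def)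
    next
      case False
      then show ?thesis using u ab[of u "v - t"] V[OF uv(2)] by (simp add: Ktt_edges fits_def \<phi>_def)
    qed
  next
    case u: False
    show ?thesis
    proof (cases "v < t")
      case True
      then show ?thesis using u ab[of v "u - t"] V[OF uv(1)] by (simp add: Ktt_edges fits_def \<phi>_def)
    next
      case False
      have "u - t \<noteq> v - t" using u False uv(3) by simp
      then show ?thesis using u False bb[of "u - t" "v - t"] V[OF uv(1)] V[OF uv(2)]
        by (simp add: Ktt_edges fits_def \<phi>_def)
    qed
  qed
  moreover have "\<phi> u \<in> I" if "u \<in> verts (Ktt t)" for u using a b V[OF that] by (simp add: \<phi>_def)
  ultimately show ?thesis unfolding embeds_def by blast
qed

lemma enumerate_subset:
  assumes "finite X" "t \<le> card X"
  shows "\<exists>e. (\<forall>i<t. e i \<in> X) \<and> (\<forall>i<t. \<forall>j<t. i \<noteq> j \<longrightarrow> e i \<noteq> e j)"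
proof -
  obtain e where e: "bij_betw e {0..<card X} X" using ex_bij_betw_nat_finite[OF assms(1)] by blast
  have "e i \<in> X" if "i < t" for i using e that assms(2) by (auto simp: bij_betw_def)
  moreover have "e i \<noteq> e j" if "i < t" "j < t" "i \<noteq> j" for i j
    using inj_on_eq_iff[of e "{0..<card X}" i j] e that assms(2) by (auto simp: bij_betw_def)
  ultimately show ?thesis by blast
qed

text \<open>
  The all-gray CRG with one white vertex \<open>0\<close> and \<open>t - 1\<close> black ones. It competes with the
  all-black CRGs when \<open>p < 1/2\<close>.
\<close>

definition split_colouring :: "nat \<Rightarrow> nat \<Rightarrow> colour" where
  "split_colouring i j = (if i = j then (if i = 0 then White else Black) else Gray)"

text \<open>
  The \<open>t\<close> vertices of a side are pairwise non-adjacent, so they are sent to different black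
  vertices or to \<open>0\<close>, and with \<open>t - 1\<close> black vertices some are sent to \<open>0\<close>. This holds for both
  sides, but the white vertex cannot take both ends of an edge.
\<close>

lemma split_colouring_avoids_Ktt:
  assumes t: "t \<ge> 1"
  shows "is_colouring {..<t} split_colouring" "\<not> embeds (Ktt t) {..<t} split_colouring"
proof -
  have "{..<t} \<noteq> {}" using t by (auto simp: lessThan_empty_iff)
  then show "is_colouring {..<t} split_colouring" by (simp add: is_colouring_def split_colouring_def)
  show "\<not> embeds (Ktt t) {..<t} split_colouring"
  proof
    assume "embeds (Ktt t) {..<t} split_colouring"
    then obtain \<phi> where \<phi>: "\<And>u. u < 2 * t \<Longrightarrow> \<phi> u < t"
      and fit: "\<And>u v. u < 2 * t \<Longrightarrow> v < 2 * t \<Longrightarrow> u \<noteq> v \<Longrightarrow> fits (split_colouring (\<phi> u) (\<phi> v)) ({u, v} \<in> edges (Ktt t))"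
      unfolding embeds_def by (auto simp: complete_bipartite_def mult_2)
    have hit: "\<exists>u\<in>U. \<phi> u = 0" if U: "card U = t" "finite U" "\<And>u. u \<in> U \<Longrightarrow> u < 2 * t"
      and nadj: "\<And>u v. u \<in> U \<Longrightarrow> v \<in> U \<Longrightarrow> {u, v} \<notin> edges (Ktt t)" for U
    proof (rule ccontr)
      assume no: "\<not> (\<exists>u\<in>U. \<phi> u = 0)"
      have "inj_on \<phi> U"
      proof (rule inj_onI, rule ccontr)
        fix u v assume uv: "u \<in> U" "v \<in> U" "\<phi> u = \<phi> v" "u \<noteq> v"
        have "\<phi> u \<noteq> 0" using no uv(1) by auto
        then show False using fit[OF U(3)[OF uv(1)] U(3)[OF uv(2)] uv(4)] nadj[OF uv(1,2)] uv(3)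
          by (simp add: fits_def split_colouring_def)
      qed
      moreover have "\<phi> ` U \<subseteq> {1..<t}"
      proof
        fix i assume "i \<in> \<phi> ` U"
        then obtain u where u: "u \<in> U" "i = \<phi> u" by blast
        then have "\<phi> u \<noteq> 0" using no by auto
        then show "i \<in> {1..<t}" using \<phi>[OF U(3)[OF u(1)]] u by simp
      qed
      ultimately have "card U \<le> card {1..<t}" by (intro card_inj_on_le) auto
      then show False using U(1) t by simp
    qed
    obtain u where u: "u < t" "\<phi> u = 0" using hit[of "{..<t}"] by (auto simp: Ktt_edges)
    obtain v where v: "t \<le> v" "v < 2 * t" "\<phi> v = 0" using hit[of "{t..<2 * t}"] by (auto simp: Ktt_edges)
    have "fits (split_colouring 0 0) True"
      using fit[of u v] u v by (simp add: Ktt_edges)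
    then show False by (simp add: fits_def split_colouring_def)
  qed
qed

text \<open>
  With gray edges only the matrix is diagonal, and the optimal mass is inversely proportional to
  its entries.
\<close>

lemma split_colouring_qform:
  assumes t: "t \<ge> 1" and p: "0 < p" "p < 1"
  shows "\<exists>\<nu>\<in>prob_masses {..<t}. qform split_colouring p {..<t} \<nu> * (1 / p + (real t - 1) / (1 - p)) = 1"
proof -
  define Z where "Z = 1 / p + (real t - 1) / (1 - p)"
  have "(real t - 1) / (1 - p) \<ge> 0" using t p by simp
  then have Z: "Z > 0" using p by (simp add: Z_def add_pos_nonneg)
  define m where "m i = (if i = 0 then 1 / p else 1 / (1 - p))" for i :: nat
  define \<nu> where "\<nu> i = (if i < t then m i / Z else 0)" for i
  have m0: "0 \<le> m i" for i using p by (simp add: m_def)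
  obtain s where s: "t = Suc s" using t by (cases t) auto
  have msum: "(\<Sum>i<t. m i) = Z"
    unfolding s sum.lessThan_Suc_shift by (simp add: m_def Z_def s)
  have "(\<Sum>i<t. \<nu> i) = (\<Sum>i<t. m i / Z)" by (rule sum.cong) (auto simp: \<nu>_def)
  also have "\<dots> = 1" unfolding sum_divide_distrib[symmetric] msum using Z by simp
  finally have "\<nu> \<in> prob_masses {..<t}" using m0 Z by (simp add: prob_masses_def \<nu>_def)
  moreover have "qform split_colouring p {..<t} \<nu> = (\<Sum>i<t. m i / Z\<^sup>2)"
    unfolding qform_def
  proof (rule sum.cong[OF refl])
    fix i assume i: "i \<in> {..<t}"
    have "(\<Sum>j<t. cost p (split_colouring i j) * \<nu> j) = (\<Sum>j<t. if i = j then cost p (split_colouring i i) * \<nu> i else 0)"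
      by (rule sum.cong) (auto simp: split_colouring_def)
    also have "\<dots> = cost p (split_colouring i i) * \<nu> i" using i by simp
    also have "\<dots> = 1 / Z" using i p by (simp add: split_colouring_def \<nu>_def m_def)
    finally show "\<nu> i * (\<Sum>j<t. cost p (split_colouring i j) * \<nu> j) = m i / Z\<^sup>2"
      using i by (simp add: \<nu>_def power2_eq_square)
  qed
  then have "qform split_colouring p {..<t} \<nu> * Z = 1"
    unfolding sum_divide_distrib[symmetric] msum using Z by (simp add: power2_eq_square)
  ultimately show ?thesis unfolding Z_def by blast
qed

text \<open>
  The second-order condition for a single vertex \<open>y\<close> moved to \<open>x\<close> reads
  \<open>2 M\<^bsub>xy\<^esub> < M\<^bsub>xx\<^esub> + M\<^bsub>yy\<^esub>\<close>. It excludes black edges between black vertices and, if \<open>p \<ge> 1/2\<close>,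
  white ones; it also excludes white edges between white vertices, while any other edge between
  them lets \<open>K\<^bsub>t,t\<^esub>\<close> map to its ends. If \<open>p < 1/2\<close>, white edges at a white vertex are excluded
  by moving all its white neighbours at once.
\<close>

lemma bounded_colouring:
  fixes \<delta> :: real and t :: nat
  assumes \<delta>: "\<delta> > 0" and t: "t \<ge> 1"
  shows "\<exists>N. \<forall>p\<in>{\<delta>..1}. \<forall>K\<in>crg_class (Forb (Ktt t)). \<exists>n\<le>N. \<exists>c \<mu>. is_colouring {..<n} c \<and> \<not> embeds (Ktt t) {..<n} c \<and>
     \<mu> \<in> prob_masses {..<n} \<and> qform c p {..<n} \<mu> \<le> crg_g K p"
proof -
  have F: "is_graph (Ktt t)" by (rule is_graph_complete_bipartite)
  from few_black_vertices[OF \<delta> t] obtain n0 where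
    n0: "\<forall>V \<mu> A p g. black_optimum \<delta> t V \<mu> A p g \<longrightarrow> card V \<le> n0" ..
  show ?thesis
  proof (rule exI[of _ "max t n0"], intro ballI)
    fix p K assume p': "p \<in> {\<delta>..1}" and K: "K \<in> crg_class (Forb (Ktt t))"
    have p: "p \<in> {0..1}" "p \<ge> \<delta>" "p > 0" using p' \<delta> by auto
    from minimal_colouring[OF F p(1) K] obtain n c \<mu> where
      c: "is_colouring {..<n} c" and ne: "\<not> embeds (Ktt t) {..<n} c" and \<mu>: "\<mu> \<in> prob_masses {..<n}"
      and le: "qform c p {..<n} \<mu> \<le> crg_g K p"
      and opt': "\<forall>\<nu>\<in>prob_masses {..<n}. qform c p {..<n} \<mu> \<le> qform c p {..<n} \<nu>"
      and supp': "\<forall>\<nu>\<in>prob_masses {..<n}. qform c p {..<n} \<nu> \<le> qform c p {..<n} \<mu> \<longrightarrow> (\<forall>x<n. 0 < \<nu> x)"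
      and small': "\<forall>m<n. \<forall>c' \<nu>. is_colouring {..<m} c' \<longrightarrow> \<not> embeds (Ktt t) {..<m} c' \<longrightarrow> \<nu> \<in> prob_masses {..<m} \<longrightarrow>
        qform c p {..<n} \<mu> < qform c' p {..<m} \<nu>"
      by (elim exE conjE)
    note opt = opt'[rule_format] and supp = supp'[rule_format] and small = small'[rule_format]
    let ?I = "{..<n}"
    define g where "g = qform c p ?I \<mu>"
    have csym: "c x y = c y x" if "x < n" "y < n" for x y using c that by (auto simp: is_colouring_def)
    have cdiag: "c x x = White \<or> c x x = Black" if "x < n" for x
      using c that by (cases "c x x") (auto simp: is_colouring_def)
    have one: "(\<Sum>x<n. \<mu> x) = 1" and mu0: "\<And>x. 0 \<le> \<mu> x" using \<mu> by (auto simp: prob_masses_def)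
    have pos: "0 < \<mu> x" if "x < n" for x using supp[OF \<mu> order_refl that] .
    have rowg: "row_value c p ?I \<mu> x = g" if "x < n" for x
      using row_optimal[OF c \<mu> opt _ pos, of x] that by (simp add: g_def)
    have c0: "0 \<le> cost p k" for k by (rule cost_bounds[OF p(1)])
    have move: "0 < (\<Sum>b\<in>B. \<mu> b) * (cost p (c w w) * (\<Sum>b\<in>B. \<mu> b)) - 2 * (\<Sum>b\<in>B. \<mu> b) * (\<Sum>b\<in>B. cost p (c w b) * \<mu> b)
           + (\<Sum>b\<in>B. \<mu> b * (\<Sum>b'\<in>B. cost p (c b b') * \<mu> b'))"
      if "w < n" "w \<notin> B" "B \<subseteq> ?I" "B \<noteq> {}" for w B
      by (rule move_mass_positive[OF c \<mu> opt]) (use that supp in auto)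
    have pair: "2 * cost p (c x y) < cost p (c x x) + cost p (c y y)" if xy: "x < n" "y < n" "x \<noteq> y" for x y
    proof -
      have "0 < \<mu> y * (cost p (c x x) * \<mu> y) - 2 * \<mu> y * (cost p (c x y) * \<mu> y) + \<mu> y * (cost p (c y y) * \<mu> y)"
        using move[of x "{y}"] xy by simp
      also have "\<dots> = (\<mu> y * \<mu> y) * (cost p (c x x) + cost p (c y y) - 2 * cost p (c x y))" by (simp add: algebra_simps)
      finally show ?thesis using pos[OF xy(2)] by (simp add: zero_less_mult_iff)
    qed
    have one_white: "x = y" if xy: "x < n" "y < n" "c x x = White" "c y y = White" for x y
    proof (rule ccontr)
      assume xny: "x \<noteq> y"
      then have nW: "c x y \<noteq> White" using pair[OF xy(1,2)] xy by auto
      have "embeds (Ktt t) ?I c"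
        by (rule embeds_Ktt[of t "\<lambda>_. x" _ "\<lambda>_. y"]) (use xy nW csym[OF xy(1,2)] in auto)
      with ne show False ..
    qed
    define Bl where "Bl = {x. x < n \<and> c x x = Black}"
    have fBl: "finite Bl" by (simp add: Bl_def)
    have bb: "c x y \<noteq> Black" if "x \<in> Bl" "y \<in> Bl" "x \<noteq> y" for x y
      using pair[of x y] that by (auto simp: Bl_def)
    have noclique: "\<not> (\<forall>x\<in>X. \<forall>y\<in>X. x \<noteq> y \<longrightarrow> c x y = Gray)" if X: "X \<subseteq> Bl" "t \<le> card X" for X
    proof
      assume gray: "\<forall>x\<in>X. \<forall>y\<in>X. x \<noteq> y \<longrightarrow> c x y = Gray"
      have "finite X" using X fBl finite_subset by blast
      then obtain e where e': "\<forall>i<t. e i \<in> X" "\<forall>i<t. \<forall>j<t. i \<noteq> j \<longrightarrow> e i \<noteq> e j"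
        using enumerate_subset[OF _ X(2)] by blast
      have e: "\<And>i. i < t \<Longrightarrow> e i \<in> X" "\<And>i j. i < t \<Longrightarrow> j < t \<Longrightarrow> i \<noteq> j \<Longrightarrow> e i \<noteq> e j"
        using e' by blast+
      have eB: "e i < n" "c (e i) (e i) = Black" if "i < t" for i using e(1)[OF that] X by (auto simp: Bl_def)
      have eG: "c (e i) (e j) = Gray" if "i < t" "j < t" "i \<noteq> j" for i j using gray e that by blast
      have "embeds (Ktt t) ?I c"
      proof (rule embeds_Ktt[of t e _ e])
        fix i j assume ij: "i < t" "j < t"
        show "c (e i) (e j) \<noteq> White \<and> c (e j) (e i) \<noteq> White"
          using eB eG ij by (cases "i = j") auto
      qed (use eB eG in auto)
      with ne show False ..
    qed
    have nBl: "n \<le> Suc (card Bl)"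
    proof -
      define Wh where "Wh = {x. x < n \<and> c x x = White}"
      have "card Wh \<le> 1"
      proof (cases "Wh = {}")
        case False
        then obtain w where w: "w \<in> Wh" by blast
        then have "Wh \<subseteq> {w}" using one_white by (auto simp: Wh_def)
        then show ?thesis using card_mono[of "{w}" Wh] by simp
      qed simp
      moreover have "?I = Wh \<union> Bl" using cdiag by (auto simp: Wh_def Bl_def)
      then have "n \<le> card Wh + card Bl" using card_Un_le[of Wh Bl] by (metis card_lessThan)
      ultimately show ?thesis by linarith
    qed
    have "n \<le> max t n0"
    proof (cases "p < 1/2")
      case False
      have "c x y = Gray" if "x \<in> Bl" "y \<in> Bl" "x \<noteq> y" for x y
        using pair[of x y] bb[OF that] that False by (cases "c x y") (auto simp: Bl_def)
      then have "card Bl < t" using noclique[of Bl] by (metis not_le order_refl)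
      then show ?thesis using nBl by simp
    next
      case p2: True
      show ?thesis
      proof (cases "\<exists>w<n. c w w = White")
        case True
        then obtain w where w: "w < n" "c w w = White" by blast
        have wB: "c w b \<noteq> Black" if "b < n" "b \<noteq> w" for b
        proof
          assume "c w b = Black"
          moreover have "c b b = Black" using cdiag[OF that(1)] one_white[OF that(1) w(1) _ w(2)] that by blast
          ultimately show False using pair[OF w(1) that(1)] that w(2) p2 by auto
        qed
        define B where "B = {b. b < n \<and> b \<noteq> w \<and> c w b = White}"
        \<comment> \<open>Move all white neighbours of \<open>w\<close> to \<open>w\<close>: the row of each neighbour contains the mass of \<open>w\<close>, so by
          comparison with the row of \<open>w\<close> the form restricted to \<open>B\<close> is at most \<open>p \<beta>\<^sup>2\<close>, the gain of the move.\<close>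
        have "B = {}"
        proof (rule ccontr)
          assume B0: "B \<noteq> {}"
          define \<beta> where "\<beta> = (\<Sum>b\<in>B. \<mu> b)"
          have BI: "B \<subseteq> ?I" "w \<notin> B" by (auto simp: B_def)
          have fB: "finite B" using BI finite_subset by blast
          have cw: "(\<Sum>b\<in>B. cost p (c w b) * \<mu> b) = p * \<beta>"
            unfolding \<beta>_def sum_distrib_left by (rule sum.cong) (auto simp: B_def)
          have rw: "g = p * \<mu> w + p * \<beta>"
          proof -
            have "g = (\<Sum>y<n. cost p (c w y) * \<mu> y)" using rowg[OF w(1)] by (simp add: row_value_def)
            also have "\<dots> = (\<Sum>y\<in>insert w B. cost p (c w y) * \<mu> y)"
            proof (rule sum.mono_neutral_right)
              show "\<forall>y\<in>?I - insert w B. cost p (c w y) * \<mu> y = 0"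
              proof
                fix y assume "y \<in> ?I - insert w B"
                then have "c w y = Gray" using wB[of y] by (cases "c w y") (auto simp: B_def)
                then show "cost p (c w y) * \<mu> y = 0" by simp
              qed
            qed (use BI w in auto)
            also have "\<dots> = p * \<mu> w + p * \<beta>" using BI fB cw w by simp
            finally show ?thesis .
          qed
          have "(\<Sum>b\<in>B. \<mu> b * (\<Sum>b'\<in>B. cost p (c b b') * \<mu> b')) \<le> (\<Sum>b\<in>B. \<mu> b * (p * \<beta>))"
          proof (rule sum_mono)
            fix b assume b: "b \<in> B"
            then have bn: "b < n" and cbw: "c b w = White" using csym[OF w(1), of b] by (auto simp: B_def)
            have "p * \<mu> w + (\<Sum>b'\<in>B. cost p (c b b') * \<mu> b') = (\<Sum>y\<in>insert w B. cost p (c b y) * \<mu> y)"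
              using BI fB cbw by simp
            also have "\<dots> \<le> (\<Sum>y<n. cost p (c b y) * \<mu> y)"
              using BI w c0 mu0 by (intro sum_mono2) auto
            also have "\<dots> = g" using rowg[OF bn] by (simp add: row_value_def)
            finally have "(\<Sum>b'\<in>B. cost p (c b b') * \<mu> b') \<le> p * \<beta>" using rw by linarith
            then show "\<mu> b * (\<Sum>b'\<in>B. cost p (c b b') * \<mu> b') \<le> \<mu> b * (p * \<beta>)" using mu0 by (rule mult_left_mono)
          qed
          also have "\<dots> = \<beta> * (p * \<beta>)" by (simp add: \<beta>_def sum_distrib_right)
          finally show False using move[OF w(1) BI(2,1) B0] w(2) cw by (simp add: \<beta>_def[symmetric] mult.commute)
        qed
        then have wG: "c w b = Gray" if "b \<in> Bl" for b
        proof -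
          have b: "b < n" "b \<noteq> w" using that w(2) by (auto simp: Bl_def)
          then have "c w b \<noteq> White" using \<open>B = {}\<close> by (auto simp: B_def)
          then show ?thesis using wB[OF b] by (cases "c w b") auto
        qed
        have "card Bl < t"
        proof (rule ccontr)
          assume "\<not> card Bl < t"
          then have "t \<le> card Bl" by simp
          then obtain e where e': "\<forall>i<t. e i \<in> Bl" "\<forall>i<t. \<forall>j<t. i \<noteq> j \<longrightarrow> e i \<noteq> e j"
            using enumerate_subset[OF fBl] by blast
          have e: "\<And>i. i < t \<Longrightarrow> e i \<in> Bl" "\<And>i j. i < t \<Longrightarrow> j < t \<Longrightarrow> i \<noteq> j \<Longrightarrow> e i \<noteq> e j"
            using e' by blast+
          have en: "e i < n" if "i < t" for i using e(1)[OF that] by (simp add: Bl_def)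
          have "embeds (Ktt t) ?I c"
          proof (rule embeds_Ktt[of t e _ "\<lambda>_. w"])
            fix i j assume ij: "i < t" "j < t"
            show "c (e i) w \<noteq> White \<and> c w (e i) \<noteq> White"
              using wG[OF e(1)[OF ij(1)]] csym[OF w(1) en[OF ij(1)]] by simp
          next
            fix i j assume "i < t" "j < t" "i \<noteq> j"
            then show "c (e i) (e j) \<noteq> Black" using bb e by blast
          qed (use en w in auto)
          with ne show False ..
        qed
        then show ?thesis using nBl by simp
      next
        case False
        then have blk: "c x x = Black" if "x < n" for x using cdiag that by blast
        then have BlI: "Bl = ?I" by (auto simp: Bl_def)
        show ?thesis
        proof (cases "n \<le> t")
          case nt: False
          obtain \<nu> where \<nu>: "\<nu> \<in> prob_masses {..<t}"
            "qform split_colouring p {..<t} \<nu> * (1 / p + (real t - 1) / (1 - p)) = 1"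
            using split_colouring_qform[OF t p(3)] p2 by auto
          have Z: "0 < 1 / p + (real t - 1) / (1 - p)"
          proof -
            have "0 \<le> (real t - 1) / (1 - p)" using t p2 by simp
            moreover have "0 < 1 / p" using p(3) by simp
            ultimately show ?thesis by linarith
          qed
          have "g < qform split_colouring p {..<t} \<nu>"
            unfolding g_def by (rule small[OF _ split_colouring_avoids_Ktt[OF t] \<nu>(1)]) (use nt in simp)
          then have gZ: "g * (1 / p + (real t - 1) / (1 - p)) < 1"
            using mult_strict_right_mono[OF _ Z, of g] \<nu>(2) by metis
          define A where "A x y \<longleftrightarrow> x \<noteq> y \<and> c x y = Gray" for x y
          have "black_optimum \<delta> t ?I \<mu> A p g"
            unfolding black_optimum_def
          proof (intro conjI ballI allI impI)
            show "A y x" if "x \<in> ?I" "y \<in> ?I" "A x y" for x y using that csym[of x y] by (simp add: A_def)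
            show "\<not> A x x" for x by (simp add: A_def)
            show "(1 - p) * \<mu> x + p * (\<Sum>y\<in>{y \<in> ?I. y \<noteq> x \<and> \<not> A x y}. \<mu> y) = g" if x: "x \<in> ?I" for x
            proof -
              have "g = (\<Sum>y<n. cost p (c x y) * \<mu> y)" using rowg[of x] x by (simp add: row_value_def)
              also have "\<dots> = (\<Sum>y\<in>insert x {y \<in> ?I. y \<noteq> x \<and> \<not> A x y}. cost p (c x y) * \<mu> y)"
                by (rule sum.mono_neutral_right) (use x in \<open>auto simp: A_def\<close>)
              also have "\<dots> = cost p (c x x) * \<mu> x + (\<Sum>y\<in>{y \<in> ?I. y \<noteq> x \<and> \<not> A x y}. cost p (c x y) * \<mu> y)"
                by (rule sum.insert) auto
              also have "(\<Sum>y\<in>{y \<in> ?I. y \<noteq> x \<and> \<not> A x y}. cost p (c x y) * \<mu> y) = (\<Sum>y\<in>{y \<in> ?I. y \<noteq> x \<and> \<not> A x y}. p * \<mu> y)"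
              proof (rule sum.cong[OF refl])
                fix y assume y: "y \<in> {y \<in> ?I. y \<noteq> x \<and> \<not> A x y}"
                then have "c x y \<noteq> Black" using bb[of x y] x BlI by auto
                then have "c x y = White" using y by (cases "c x y") (auto simp: A_def)
                then show "cost p (c x y) * \<mu> y = p * \<mu> y" by simp
              qed
              finally show ?thesis using blk x by (simp add: sum_distrib_left)
            qed
            show "\<not> (\<forall>x\<in>X. \<forall>y\<in>Y. A x y)"
              if X: "X \<subseteq> ?I" "Y \<subseteq> ?I" "card X = t" "card Y = t" for X Y
            proof
              assume XY: "\<forall>x\<in>X. \<forall>y\<in>Y. A x y"
              have fXY: "finite X" "finite Y" using X finite_subset by auto
              have "t \<le> card X" using X by simp
              then obtain e where e': "\<forall>i<t. e i \<in> X" "\<forall>i<t. \<forall>j<t. i \<noteq> j \<longrightarrow> e i \<noteq> e j"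
                using enumerate_subset[OF fXY(1)] by blast
              have e: "\<And>i. i < t \<Longrightarrow> e i \<in> X" "\<And>i j. i < t \<Longrightarrow> j < t \<Longrightarrow> i \<noteq> j \<Longrightarrow> e i \<noteq> e j"
                using e' by blast+
              have "t \<le> card Y" using X by simp
              then obtain d where d': "\<forall>i<t. d i \<in> Y" "\<forall>i<t. \<forall>j<t. i \<noteq> j \<longrightarrow> d i \<noteq> d j"
                using enumerate_subset[OF fXY(2)] by blast
              have d: "\<And>i. i < t \<Longrightarrow> d i \<in> Y" "\<And>i j. i < t \<Longrightarrow> j < t \<Longrightarrow> i \<noteq> j \<Longrightarrow> d i \<noteq> d j"
                using d' by blast+
              have en: "e i < n" "d i < n" if "i < t" for i using e(1)[OF that] d(1)[OF that] X by auto
              have "embeds (Ktt t) ?I c"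
              proof (rule embeds_Ktt[of t e _ d])
                fix i j assume ij: "i < t" "j < t"
                have "c (e i) (d j) = Gray" using XY e(1)[OF ij(1)] d(1)[OF ij(2)] by (simp add: A_def)
                then show "c (e i) (d j) \<noteq> White \<and> c (d j) (e i) \<noteq> White"
                  using csym[OF en(1)[OF ij(1)] en(2)[OF ij(2)]] by simp
              next
                fix i j assume "i < t" "j < t" "i \<noteq> j"
                then show "c (e i) (e j) \<noteq> Black" "c (d i) (d j) \<noteq> Black" using bb BlI e d en by auto
              qed (use en in auto)
              with ne show False ..
            qed
            show "\<not> (\<forall>x\<in>X. \<forall>y\<in>X. x \<noteq> y \<longrightarrow> A x y)" if X: "X \<subseteq> ?I" "card X = t" for X
              using noclique[of X] X BlI by (auto simp: A_def)
          qed (use mu0 one p p2 gZ in auto)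
          then have "card ?I \<le> n0" using n0 by blast
          then show ?thesis by simp
        qed simp
      qed
    qed
    then show "\<exists>n\<le>max t n0. \<exists>c \<mu>. is_colouring {..<n} c \<and> \<not> embeds (Ktt t) {..<n} c \<and>
     \<mu> \<in> prob_masses {..<n} \<and> qform c p {..<n} \<mu> \<le> crg_g K p"
      using c ne \<mu> le by blast
  qed
qed

section \<open>No accumulation points\<close>

lemma spans_all_Forb_Ktt:
  assumes t: "t \<ge> 1"
  shows "spans_all (Forb (Ktt t))"
  unfolding spans_all_def
proof (intro conjI ballI allI impI)
  fix V :: "nat set" assume V: "finite V"
  define G where "G = \<lparr>verts = V, edges = {}\<rparr>"
  have "{0, t} \<in> edges (Ktt t)" using t by (simp add: Ktt_edges)
  then have "\<not> contains_induced G (Ktt t)"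
    by (auto simp: contains_induced_def graph_iso_def induced_def G_def)
  then have "G \<in> Forb (Ktt t)" using V by (simp add: Forb_def is_graph_def G_def)
  then show "\<exists>H\<in>Forb (Ktt t). verts H = V" by (rule bexI[rotated]) (simp add: G_def)
qed (simp add: Forb_def)

text \<open>
  Bounded size leaves finitely many CRGs up to relabelling. The minimum over them is attained,
  so the error \<open>\<gamma>\<close> of the lower bound disappears in the limit.
\<close>

lemma finitely_many_crgs_suffice:
  fixes \<delta> :: real
  assumes \<delta>: "\<delta> > 0" "\<delta> \<le> 1" and t: "t \<ge> 1"
  shows "\<exists>\<K>. finite \<K> \<and> \<K> \<noteq> {} \<and> \<K> \<subseteq> crg_class (Forb (Ktt t)) \<and>
     (\<forall>p\<in>{\<delta>..1}. ed (Forb (Ktt t)) p = (MIN K\<in>\<K>. crg_g K p))"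
proof -
  let ?H = "Forb (Ktt t)"
  have F: "is_graph (Ktt t)" by (rule is_graph_complete_bipartite)
  have s: "spans_all ?H" by (rule spans_all_Forb_Ktt[OF t])
  from bounded_colouring[OF \<delta>(1) t] obtain N where
    N: "\<forall>p\<in>{\<delta>..1}. \<forall>K\<in>crg_class ?H. \<exists>n\<le>N. \<exists>c \<mu>. is_colouring {..<n} c \<and> \<not> embeds (Ktt t) {..<n} c \<and>
     \<mu> \<in> prob_masses {..<n} \<and> qform c p {..<n} \<mu> \<le> crg_g K p" ..
  define X where "X = (({..<N} \<times> {..<N}) \<rightarrow>\<^sub>E (UNIV :: colour set))"
  define \<K> where "\<K> = (\<lambda>(n, d). crg_of {..<n} (curry d)) ` ({..N} \<times> X) \<inter> crg_class ?H"
  have fin: "finite \<K>" unfolding \<K>_def X_def by (intro finite_Int disjI1 finite_imageI finite_cartesian_product finite_PiE) auto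
  have sub: "\<K> \<subseteq> crg_class ?H" by (simp add: \<K>_def)
  have reduce: "\<exists>K'\<in>\<K>. crg_g K' p \<le> crg_g K p" if p: "p \<in> {\<delta>..1}" and K: "K \<in> crg_class ?H" for p K
  proof -
    have p01: "p \<in> {0..1}" using p \<delta> by auto
    from N[rule_format, OF p K] obtain n c \<mu> where n: "n \<le> N" and c: "is_colouring {..<n} c" and ne: "\<not> embeds (Ktt t) {..<n} c"
      and \<mu>: "\<mu> \<in> prob_masses {..<n}" "qform c p {..<n} \<mu> \<le> crg_g K p" by blast
    define d where "d = restrict (\<lambda>(i, j). c i j) ({..<N} \<times> {..<N})"
    have dc: "curry d i j = c i j" if "i \<in> {..<n}" "j \<in> {..<n}" for i j
      using that n by (simp add: d_def)
    have dX: "d \<in> X" by (simp add: X_def d_def)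
    have "is_colouring {..<n} (curry d)" using c dc unfolding is_colouring_def by simp
    moreover have "\<not> embeds (Ktt t) {..<n} (curry d)" using ne embeds_cong[of "{..<n}" "curry d" c "Ktt t"] dc by simp
    ultimately have "crg_of {..<n} (curry d) \<in> crg_class ?H" "crg_g (crg_of {..<n} (curry d)) p \<le> qform (curry d) p {..<n} \<mu>"
      using crg_of_class[OF _ F] crg_g_crg_of INF_qform_le[OF p01 \<mu>(1)] by auto
    moreover have "qform (curry d) p {..<n} \<mu> = qform c p {..<n} \<mu>" by (rule qform_cong[OF dc])
    ultimately show ?thesis
      using \<mu>(2) n dX unfolding \<K>_def by (intro bexI[of _ "crg_of {..<n} (curry d)"]) force+
  qed
  have approx: "\<exists>n\<ge>n0. \<exists>K\<in>\<K>. crg_g K p \<le> max_dist ?H p n + \<gamma>" if p: "p \<in> {\<delta>..1}" and \<gamma>: "\<gamma> > 0" for p \<gamma> n0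
  proof -
    have p01: "p \<in> {0..1}" using p \<delta> by auto
    obtain n K where "n \<ge> n0" "K \<in> crg_class ?H" "crg_g K p \<le> max_dist ?H p n + \<gamma>"
      using crg_below_max_dist[OF F s p01 \<gamma>] by blast
    then show ?thesis using reduce[OF p] by (meson order_trans)
  qed
  have ne: "\<K> \<noteq> {}" using approx[of 1 1 0] \<delta> by auto
  have "ed ?H p = (MIN K\<in>\<K>. crg_g K p)" if p: "p \<in> {\<delta>..1}" for p
  proof (rule antisym)
    have p01: "p \<in> {0..1}" using p \<delta> by auto
    have "ed ?H p \<le> crg_g K p" if "K \<in> \<K>" for K
      using ed_le_crg_g[OF F s p01] sub that by blast
    then show "ed ?H p \<le> (MIN K\<in>\<K>. crg_g K p)" using fin ne by (simp add: Min_ge_iff)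
    show "(MIN K\<in>\<K>. crg_g K p) \<le> ed ?H p"
    proof (rule field_le_epsilon)
      fix \<gamma> :: real assume \<gamma>: "\<gamma> > 0"
      have "(MIN K\<in>\<K>. crg_g K p) - \<gamma> \<le> ed ?H p"
      proof (rule ed_ge[OF s p01])
        fix n0
        obtain n K where nK: "n \<ge> n0" "K \<in> \<K>" "crg_g K p \<le> max_dist ?H p n + \<gamma>"
          using approx[OF p \<gamma>] by blast
        have "(MIN K\<in>\<K>. crg_g K p) \<le> crg_g K p" using fin nK(2) by (intro Min_le) auto
        then show "\<exists>n\<ge>n0. (MIN K\<in>\<K>. crg_g K p) - \<gamma> \<le> max_dist ?H p n"
          using nK by (intro exI[of _ n]) auto
      qed
      then show "(MIN K\<in>\<K>. crg_g K p) \<le> ed ?H p + \<gamma>" by linarith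
    qed
  qed
  then show ?thesis using fin ne sub by blast
qed

theorem theorem1p7:
  fixes t :: nat
  assumes "t \<ge> 1"
  shows "\<not> (\<exists>p0 \<in> {0<..1::real}. accumulation_point (Forb (complete_bipartite t t)) p0)"
proof
  assume "\<exists>p0 \<in> {0<..1::real}. accumulation_point (Forb (complete_bipartite t t)) p0"
  then obtain p0 where p0: "0 < p0" "p0 \<le> 1" and acc: "accumulation_point (Forb (Ktt t)) p0" by auto
  obtain \<K> where "finite \<K>" "\<K> \<noteq> {}" "\<K> \<subseteq> crg_class (Forb (Ktt t))"
    and ed: "\<forall>p\<in>{p0 / 2..1}. ed (Forb (Ktt t)) p = (MIN K\<in>\<K>. crg_g K p)"
    using finitely_many_crgs_suffice[of "p0 / 2" t] p0 assms by auto
  moreover have "\<forall>p \<in> {p0 - p0 / 2<..<p0 + p0 / 2} \<inter> {0..1}. ed (Forb (Ktt t)) p = (MIN K\<in>\<K>. crg_g K p)"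
    using ed by auto
  ultimately have "regular_point (Forb (Ktt t)) p0"
    unfolding regular_point_def using p0 by (intro conjI exI[of _ "p0 / 2"] exI[of _ \<K>]) auto
  with acc show False by (simp add: accumulation_point_def)
qed

end
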